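(* In the setting of the context (with $\mathbf{U}\in\mathbf{V}_0\cap\mathbf{H}^3(\mathcal{O})$), suppose that $(p,\mathbf{u},w)\in L^2(\mathcal{O})\times\mathbf{V}_0\times H_0^2(\Omega)$ satisfies $$(\mathrm{div}\,\mathbf{u},q)_{\mathcal{O}}=\int_{\mathcal{O}}(\mathrm{div}\,\mathbf{U})\,pq\,dx+\int_{\mathcal{O}}(\mathbf{U}\cdot\nabla q)\,p\,dx\quad\text{for all }q\in W_{\mathbf{U}},$$ $$a_{\mathcal{O}}(\mathbf{u},\boldsymbol\psi)-(p,\mathrm{div}\,\boldsymbol\psi)_{\mathcal{O}}=-\int_{\mathcal{O}}(\mathbf{U}\cdot\nabla\mathbf{u})\cdot\boldsymbol\psi\,dx-(\Delta w,\Delta\beta)_\Omega\quad\text{for all }\boldsymbol\psi=\boldsymbol\psi(\beta)\in\mathbf{V}_\Omega .$$ Then $(p,\mathbf{u},w)$ satisfies almost everywhere the stationary system $$\mathbf{U}\cdot\nabla p+\mathrm{div}\,\mathbf{u}=0\ \text{ in }\mathcal{O},\qquad \mathbf{U}\cdot\nabla\mathbf{u}-\mathrm{div}\,\sigma(\mathbf{u})+\eta\mathbf{u}+\nabla p=0\ \text{ in }\mathcal{O},$$ $$(\sigma(\mathbf{u})\mathbf{n}-p\mathbf{n})\cdot\boldsymbol\tau=0\ \text{ on }\partial\mathcal{O},\qquad \mathbf{u}\cdot\mathbf{n}=0\ \text{ on }\partial\mathcal{O},$$ $$\Delta^2w+[2\nu\partial_{x_3}(\mathbf{u})_3+\lambda\,\mathrm{div}(\mathbf{u})-p]_\Omega=0\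 \text{ on }\Omega,\qquad w=\tfrac{\partial w}{\partial\nu}=0\ \text{ on }\partial\Omega,$$ (the tangential stress condition being understood in the sense given in the context), and in fact $[p,\mathbf{u},w,0]\in D(\mathcal{A})$ with $\mathcal{A}[p,\mathbf{u},w,0]=0$, i.e. $[p,\mathbf{u},w,0]\in \mathrm{Null}(\mathcal{A})$.
   Context: **Geometry.** $\mathcal{O}\subset\mathbb{R}^3$ is a bounded convex domain (hence with Lipschitz boundary), with unit outward normal $\mathbf{n}$. $\partial\mathcal{O}=\overline{S}\cup\overline{\Omega}$ with $S\cap\Omega=\emptyset$; $\Omega\subset\{x_3=0\}$ is flat, with Lipschitz boundary, and is identified with a domain in $\mathbb{R}^2$; $S\subset\{x_3\le 0\}$; $\mathbf{n}|_\Omega=(0,0,1)$. Constants: $\nu>0,\lambda\ge 0,\eta>0$. Functions are real-valued in the variational formulation. **Notation.** $\mathbf{L}^2(\mathcal{O})=[L^2(\mathcal{O})]^3$, $\mathbf{H}^s(\mathcal{O})=[H^s(\mathcal{O})]^3$; $(\cdot,\cdot)_D$ is the $L^2(D)$ inner product. $\epsilon_{ij}(\mathbf{u})=\frac12(\partial_{x_i}u_j+\partial_{x_j}u_i)$, $\sigma(\mathbf{u})=2\nu\,\epsilon(\mathbf{u})+\lambda\,\mathrm{div}(\mathbf{u})I_3$, $a_{\mathcal{O}}(\mathbf{u},\boldsymbol\psi)=(\sigma(\mathbf{u}),\epsilon(\boldsymbol\psi))_{\mathcal{O}}+\eta(\mathbf{u},\boldsymbol\psi)_{\mathcal{O}}$;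 $\mathbf{U}\cdot\nabla\mathbf{u}=(\mathbf{U}\cdot\nabla)\mathbf{u}$; $\partial/\partial\nu$ is the normal derivative on $\partial\Omega$. $$\mathbf{V}_0=\{\mathbf{v}\in\mathbf{H}^1(\mathcal{O}):\mathbf{v}\cdot\mathbf{n}=0\text{ on }\partial\mathcal{O}\},\quad TH^{1/2}(\partial\mathcal{O})=\{\mathbf{v}\in\mathbf{H}^{1/2}(\partial\mathcal{O}):\mathbf{v}\cdot\mathbf{n}=0\},$$ $$W_{\mathbf{U}}=\{q\in L^2(\mathcal{O}):\mathbf{U}\cdot\nabla q\in L^2(\mathcal{O})\},$$ $$\mathbf{V}_\Omega=\{\mathbf{v}=\mathbf{v}(\beta)\in\mathbf{H}^1(\mathcal{O}):\mathbf{v}\cdot\mathbf{n}=0\text{ on }S,\ \mathbf{v}\cdot\mathbf{n}=\beta\text{ on }\Omega\text{ with }\beta\in H_0^2(\Omega)\};$$ for $\boldsymbol\psi\in\mathbf{V}_\Omega$, $\beta$ denotes its normal trace on $\Omega$. **Traces.** When $(p,\mathbf{u})\in L^2(\mathcal{O})\times\mathbf{H}^1(\mathcal{O})$ and $\mathrm{div}\,\sigma(\mathbf{u})-\nabla p\in\mathbf{L}^2(\mathcal{O})$, the trace $\sigma(\mathbf{u})\mathbf{n}-p\mathbf{n}\in\mathbf{H}^{-1/2}(\partial\mathcal{O})$ is defined by $\langle\sigma(\mathbf{u})\mathbf{n}-p\mathbf{n},\boldsymbol\psi|_{\partial\mathcal{O}}\rangle=(\mathrm{div}\,\sigma(\mathbf{u})-\nabla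 p,\boldsymbol\psi)_{\mathcal{O}}+(\sigma(\mathbf{u}),\epsilon(\boldsymbol\psi))_{\mathcal{O}}-(p,\mathrm{div}\,\boldsymbol\psi)_{\mathcal{O}}$ for $\boldsymbol\psi\in\mathbf{H}^1(\mathcal{O})$. The tangential condition $(\sigma(\mathbf{u})\mathbf{n}-p\mathbf{n})\cdot\boldsymbol\tau=0$ means $\langle\sigma(\mathbf{u})\mathbf{n}-p\mathbf{n},\boldsymbol\tau\rangle=0$ for all $\boldsymbol\tau\in TH^{1/2}(\partial\mathcal{O})$. $[2\nu\partial_{x_3}(\mathbf{u})_3+\lambda\,\mathrm{div}(\mathbf{u})-p]_\Omega$ acts on $\beta\in H_0^2(\Omega)$ as the pairing of $\sigma(\mathbf{u})\mathbf{n}-p\mathbf{n}$ with the function equal to $\beta\mathbf{n}$ on $\Omega$ and $0$ on $S$; the plate equation means that the (distributional) sum of its terms is the zero element of $L^2(\Omega)$. **Operator $\mathcal{A}$** on $\mathcal{H}=L^2(\mathcal{O})\times\mathbf{L}^2(\mathcal{O})\times H_0^2(\Omega)\times L^2(\Omega)$: $$\mathcal{A}[p_0,\mathbf{u}_0,w_1,w_2]=\big[-\mathbf{U}\cdot\nabla p_0-\mathrm{div}\,\mathbf{u}_0,\ -\nabla p_0+\mathrm{div}\,\sigma(\mathbf{u}_0)-\eta\mathbf{u}_0-\mathbf{U}\cdot\nabla\mathbf{u}_0,\ w_2,\ -\Delta^2w_1-[2\nu\partial_{x_3}(\mathbf{u}_0)_3+\lambda\,\mathrm{div}\,\mathbf{u}_0]_\Omega+p_0|_\Omega\big],$$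 where $D(\mathcal{A})$ is the set of $[p_0,\mathbf{u}_0,w_1,w_2]\in L^2(\mathcal{O})\times\mathbf{H}^1(\mathcal{O})\times H_0^2(\Omega)\times H_0^2(\Omega)$ with: (i) $\mathbf{U}\cdot\nabla p_0\in L^2(\mathcal{O})$; (ii) $\mathrm{div}\,\sigma(\mathbf{u}_0)-\nabla p_0\in\mathbf{L}^2(\mathcal{O})$; (iii) the fourth component above in $L^2(\Omega)$; (iv) $\langle\sigma(\mathbf{u}_0)\mathbf{n}-p_0\mathbf{n},\boldsymbol\tau\rangle=0$ for all $\boldsymbol\tau\in TH^{1/2}(\partial\mathcal{O})$; (v) $\mathbf{u}_0=\boldsymbol\mu_0+\widetilde{\boldsymbol\mu}_0$ with $\boldsymbol\mu_0\in\mathbf{V}_0$, $\widetilde{\boldsymbol\mu}_0\in\mathbf{H}^1(\mathcal{O})$, $\widetilde{\boldsymbol\mu}_0|_S=0$, $\widetilde{\boldsymbol\mu}_0|_\Omega=w_2\mathbf{n}$. *)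

theory Defs
  imports "HOL-Analysis.Analysis"
begin

text \<open>
  Elements of \<open>L\<^sup>2\<close>- and Sobolev spaces are represented by functions on the whole space; only
  their values on the domain matter, and equality of classes is equality almost everywhere.
\<close>

section \<open>Lebesgue spaces, test functions, Sobolev spaces\<close>

definition L2_space :: "'a::euclidean_space set \<Rightarrow> ('a \<Rightarrow> 'b::euclidean_space) set" where
  "L2_space D = {f. f \<in> borel_measurable (lebesgue_on D) \<and>
                    integrable (lebesgue_on D) (\<lambda>x. (norm (f x))\<^sup>2)}"

definition L2_inner ::
  "'a::euclidean_space set \<Rightarrow> ('a \<Rightarrow> 'b::euclidean_space) \<Rightarrow> ('a \<Rightarrow> 'b) \<Rightarrow> real" where
  "L2_inner D f g = (LINT x|lebesgue_on D. f x \<bullet> g x)"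

definition pderivative :: "'a::euclidean_space \<Rightarrow> ('a \<Rightarrow> real) \<Rightarrow> 'a \<Rightarrow> real" where
  "pderivative b f x = frechet_derivative f (at x) b"

primrec C_k :: "nat \<Rightarrow> ('a::euclidean_space \<Rightarrow> real) \<Rightarrow> bool" where
  "C_k 0 f \<longleftrightarrow> continuous_on UNIV f"
| "C_k (Suc k) f \<longleftrightarrow> f differentiable_on UNIV \<and> (\<forall>b\<in>Basis. C_k k (pderivative b f))"

definition smooth :: "('a::euclidean_space \<Rightarrow> real) \<Rightarrow> bool" where
  "smooth f \<longleftrightarrow> (\<forall>k. C_k k f)"

definition test_functions :: "'a::euclidean_space set \<Rightarrow> ('a \<Rightarrow> real) set" where
  "test_functions D =
     {\<phi>. smooth \<phi> \<and> compact (closure {x. \<phi> x \<noteq> 0}) \<and> closure {x. \<phi> x \<noteq> 0} \<subseteq> D}"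

definition is_weak_deriv ::
  "'a::euclidean_space set \<Rightarrow> 'a \<Rightarrow> ('a \<Rightarrow> real) \<Rightarrow> ('a \<Rightarrow> real) \<Rightarrow> bool" where
  "is_weak_deriv D b f g \<longleftrightarrow>
     (\<forall>\<phi>\<in>test_functions D.
        (LINT x|lebesgue_on D. f x * pderivative b \<phi> x) = - (LINT x|lebesgue_on D. g x * \<phi> x))"

text \<open>A square-integrable weak derivative is unique up to null sets; the choice below picks a
  representative.\<close>

definition weak_deriv :: "'a::euclidean_space set \<Rightarrow> 'a \<Rightarrow> ('a \<Rightarrow> real) \<Rightarrow> 'a \<Rightarrow> real" where
  "weak_deriv D b f = (SOME g. g \<in> L2_space D \<and> is_weak_deriv D b f g)"

primrec Sobolev :: "nat \<Rightarrow> 'a::euclidean_space set \<Rightarrow> ('a \<Rightarrow> real) set" where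
  "Sobolev 0 D = L2_space D"
| "Sobolev (Suc k) D =
     {f \<in> L2_space D. \<forall>b\<in>Basis. \<exists>g\<in>Sobolev k D. is_weak_deriv D b f g}"

definition Sobolev_vec ::
  "nat \<Rightarrow> 'a::euclidean_space set \<Rightarrow> ('a \<Rightarrow> 'b::euclidean_space) set" where
  "Sobolev_vec k D = {v. \<forall>b\<in>Basis. (\<lambda>x. v x \<bullet> b) \<in> Sobolev k D}"

text \<open>The squared norm of \<open>H\<^sup>k(D)\<close>: the sum of the squared \<open>L\<^sup>2\<close>-norms of the derivative tensors of
  order \<open>0, \<dots>, k\<close>.\<close>

primrec Sobolev_sqnorm :: "nat \<Rightarrow> 'a::euclidean_space set \<Rightarrow> ('a \<Rightarrow> real) \<Rightarrow> real" where
  "Sobolev_sqnorm 0 D f = (LINT x|lebesgue_on D. (f x)\<^sup>2)"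
| "Sobolev_sqnorm (Suc k) D f =
     (LINT x|lebesgue_on D. (f x)\<^sup>2) + (\<Sum>b\<in>Basis. Sobolev_sqnorm k D (weak_deriv D b f))"

definition Sobolev_tendsto ::
  "nat \<Rightarrow> 'a::euclidean_space set \<Rightarrow> (nat \<Rightarrow> 'a \<Rightarrow> real) \<Rightarrow> ('a \<Rightarrow> real) \<Rightarrow> bool" where
  "Sobolev_tendsto k D \<phi> f \<longleftrightarrow> (\<lambda>j. Sobolev_sqnorm k D (\<lambda>x. \<phi> j x - f x)) \<longlonglongrightarrow> 0"

text \<open>\<open>H\<^sup>k\<^sub>0(D)\<close>, the closure of the test functions in \<open>H\<^sup>k(D)\<close>.\<close>

definition Sobolev0 :: "nat \<Rightarrow> 'a::euclidean_space set \<Rightarrow> ('a \<Rightarrow> real) set" where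
  "Sobolev0 k D =
     {f \<in> Sobolev k D. \<exists>\<phi>. (\<forall>j. \<phi> j \<in> test_functions D) \<and> Sobolev_tendsto k D \<phi> f}"

definition weak_grad :: "'a::euclidean_space set \<Rightarrow> ('a \<Rightarrow> real) \<Rightarrow> 'a \<Rightarrow> 'a" where
  "weak_grad D f x = (\<Sum>b\<in>Basis. weak_deriv D b f x *\<^sub>R b)"

definition weak_laplacian :: "'a::euclidean_space set \<Rightarrow> ('a \<Rightarrow> real) \<Rightarrow> 'a \<Rightarrow> real" where
  "weak_laplacian D f x = (\<Sum>b\<in>Basis. weak_deriv D b (weak_deriv D b f) x)"

definition laplacian :: "('a::euclidean_space \<Rightarrow> real) \<Rightarrow> 'a \<Rightarrow> real" where
  "laplacian f x = (\<Sum>b\<in>Basis. pderivative b (pderivative b f) x)"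

text \<open>The value at \<open>\<beta> \<in> H\<^sup>2\<^sub>0(D)\<close> of the distribution \<open>\<Delta>\<^sup>2w\<close>, which acts on test functions by
  \<open>\<phi> \<mapsto> \<integral> w \<Delta>\<^sup>2\<phi>\<close> and, for \<open>w \<in> H\<^sup>2(D)\<close>, extends continuously to \<open>H\<^sup>2\<^sub>0(D)\<close>.\<close>

definition bilaplacian_pairing ::
  "'a::euclidean_space set \<Rightarrow> ('a \<Rightarrow> real) \<Rightarrow> ('a \<Rightarrow> real) \<Rightarrow> real" where
  "bilaplacian_pairing D w \<beta> =
     (THE c. \<forall>\<phi>. (\<forall>j. \<phi> j \<in> test_functions D) \<and> Sobolev_tendsto 2 D \<phi> \<beta> \<longrightarrow>
        (\<lambda>j. LINT x|lebesgue_on D. w x * laplacian (laplacian (\<phi> j)) x) \<longlonglongrightarrow> c)"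


section \<open>Boundary measure, normal, traces\<close>

text \<open>The \<open>m\<close>-dimensional Hausdorff outer measure, normalised so as to agree with surface area.
  It is a metric outer measure, hence countably additive on the Borel sets, so
  \<^const>\<open>measure_of\<close> below does not degenerate.\<close>

definition hausdorff_outer :: "nat \<Rightarrow> 'a::metric_space set \<Rightarrow> ennreal" where
  "hausdorff_outer m A =
     (SUP \<delta>\<in>{0<..}.
        INF V\<in>{V :: nat \<Rightarrow> 'a set. A \<subseteq> (\<Union>i. V i) \<and>
                 (\<forall>i. bounded (V i) \<and> diameter (V i) \<le> (\<delta>::real))}.
          (\<Sum>i. if V i = {} then 0
                else ennreal (unit_ball_vol (real m) * (diameter (V i) / 2) ^ m)))"

definition hausdorff_measure :: "nat \<Rightarrow> 'a::metric_space measure" where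
  "hausdorff_measure m = measure_of UNIV (sets borel) (hausdorff_outer m)"

definition boundary_measure :: "'a::euclidean_space set \<Rightarrow> 'a measure" where
  "boundary_measure D = restrict_space (completion (hausdorff_measure (DIM('a) - 1))) (frontier D)"

text \<open>The unit vector \<open>\<nu>\<close> is the outward normal at \<open>y \<in> \<partial>D\<close> if, to first order at \<open>y\<close>, the set \<open>D\<close> is
  the half-space \<open>{x. \<nu> \<bullet> (x - y) < 0}\<close>.  Such a vector is unique, and for a Lipschitz (in
  particular for a bounded convex) domain it exists at almost all boundary points.\<close>

definition is_outward_normal :: "'a::euclidean_space set \<Rightarrow> 'a \<Rightarrow> 'a \<Rightarrow> bool" where
  "is_outward_normal D y \<nu> \<longleftrightarrow> norm \<nu> = 1 \<and>
     (\<forall>\<epsilon>>0. \<exists>r>0. \<forall>x\<in>ball y r.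
        (x \<in> D \<longrightarrow> \<nu> \<bullet> (x - y) \<le> \<epsilon> * norm (x - y)) \<and>
        (x \<notin> D \<longrightarrow> \<nu> \<bullet> (x - y) \<ge> - \<epsilon> * norm (x - y)))"

definition outward_normal :: "'a::euclidean_space set \<Rightarrow> 'a \<Rightarrow> 'a" where
  "outward_normal D y = (THE \<nu>. is_outward_normal D y \<nu>)"

definition lipschitz_boundary :: "'a::euclidean_space set \<Rightarrow> bool" where
  "lipschitz_boundary D \<longleftrightarrow>
     (\<forall>x\<in>frontier D. \<exists>r>0. \<exists>e \<gamma> L. norm e = 1 \<and> L-lipschitz_on UNIV \<gamma> \<and>
        D \<inter> ball x r = {y \<in> ball x r. y \<bullet> e < \<gamma> (y - (y \<bullet> e) *\<^sub>R e)})"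

text \<open>\<open>g \<in> L\<^sup>2(\<partial>D)\<close> is the trace of \<open>v \<in> H\<^sup>1(D)\<close>: the trace operator is the continuous extension to
  \<open>H\<^sup>1(D)\<close> of the restriction to \<open>\<partial>D\<close> of functions that are smooth up to the boundary.\<close>

definition has_trace_real ::
  "'a::euclidean_space set \<Rightarrow> ('a \<Rightarrow> real) \<Rightarrow> ('a \<Rightarrow> real) \<Rightarrow> bool" where
  "has_trace_real D v g \<longleftrightarrow>
     v \<in> Sobolev 1 D \<and>
     g \<in> borel_measurable (boundary_measure D) \<and> integrable (boundary_measure D) (\<lambda>y. (g y)\<^sup>2) \<and>
     (\<exists>\<phi>. (\<forall>j. smooth (\<phi> j) \<and> \<phi> j \<in> Sobolev 1 D) \<and>
          Sobolev_tendsto 1 D \<phi> v \<and>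
          (\<lambda>j. \<integral>\<^sup>+ y. ennreal ((\<phi> j y - g y)\<^sup>2) \<partial>boundary_measure D) \<longlonglongrightarrow> 0)"

definition has_trace ::
  "'a::euclidean_space set \<Rightarrow> ('a \<Rightarrow> 'b::euclidean_space) \<Rightarrow> ('a \<Rightarrow> 'b) \<Rightarrow> bool" where
  "has_trace D v g \<longleftrightarrow> (\<forall>b\<in>Basis. has_trace_real D (\<lambda>x. v x \<bullet> b) (\<lambda>y. g y \<bullet> b))"

text \<open>\<open>v = g\<close> on \<open>\<Gamma> \<subseteq> \<partial>D\<close>, and \<open>v \<cdot> n = \<beta>\<close> on \<open>\<Gamma> \<subseteq> \<partial>D\<close>, in the sense of traces.\<close>

definition trace_on ::
  "'a::euclidean_space set \<Rightarrow> ('a \<Rightarrow> 'b::euclidean_space) \<Rightarrow> 'a set \<Rightarrow> ('a \<Rightarrow> 'b) \<Rightarrow> bool" where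
  "trace_on D v \<Gamma> g \<longleftrightarrow>
     (\<exists>h. has_trace D v h \<and> (AE y in boundary_measure D. y \<in> \<Gamma> \<longrightarrow> h y = g y))"

definition normal_trace_on ::
  "'a::euclidean_space set \<Rightarrow> ('a \<Rightarrow> 'a) \<Rightarrow> 'a set \<Rightarrow> ('a \<Rightarrow> real) \<Rightarrow> bool" where
  "normal_trace_on D v \<Gamma> \<beta> \<longleftrightarrow>
     (\<exists>h. has_trace D v h \<and>
          (AE y in boundary_measure D. y \<in> \<Gamma> \<longrightarrow> h y \<bullet> outward_normal D y = \<beta> y))"

text \<open>\<open>H\<^sup>1\<^sup>/\<^sup>2(\<partial>D)\<close> is the space of traces of \<open>H\<^sup>1(D)\<close>-functions.\<close>

definition H_half :: "'a::euclidean_space set \<Rightarrow> ('a \<Rightarrow> 'b::euclidean_space) set" where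
  "H_half D = {g. \<exists>v\<in>Sobolev_vec 1 D. has_trace D v g}"

definition TH_half :: "'a::euclidean_space set \<Rightarrow> ('a \<Rightarrow> 'a) set" where
  "TH_half D =
     {\<tau> \<in> H_half D. AE y in boundary_measure D. \<tau> y \<bullet> outward_normal D y = 0}"


section \<open>The domain and the flat part of its boundary\<close>

definition emb :: "real^2 \<Rightarrow> real^3" where
  "emb z = vector [z $ 1, z $ 2, 0]"

definition proj :: "real^3 \<Rightarrow> real^2" where
  "proj y = vector [y $ 1, y $ 2]"

definition flow_plate_geometry :: "(real^3) set \<Rightarrow> (real^3) set \<Rightarrow> (real^2) set \<Rightarrow> bool" where
  "flow_plate_geometry D S \<Omega> \<longleftrightarrow>
     open D \<and> D \<noteq> {} \<and> bounded D \<and> convex D \<and>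
     open \<Omega> \<and> \<Omega> \<noteq> {} \<and> connected \<Omega> \<and> lipschitz_boundary \<Omega> \<and>
     frontier D = closure S \<union> closure (emb ` \<Omega>) \<and> S \<inter> emb ` \<Omega> = {} \<and>
     S \<subseteq> {x. x $ 3 \<le> 0} \<and>
     (\<forall>z\<in>\<Omega>. outward_normal D (emb z) = axis 3 1)"


section \<open>Function spaces and forms of the flow-plate system\<close>

text \<open>Derivatives of fields on \<open>D\<close> are weak derivatives; \<open>weak_jacobian D u x $ i $ j\<close> is
  \<open>\<partial>u\<^sub>i/\<partial>x\<^sub>j\<close>.\<close>

definition weak_jacobian :: "(real^3) set \<Rightarrow> (real^3 \<Rightarrow> real^3) \<Rightarrow> real^3 \<Rightarrow> real^3^3" where
  "weak_jacobian D u x = (\<chi> i j. weak_deriv D (axis j 1) (\<lambda>y. u y $ i) x)"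

definition weak_div :: "(real^3) set \<Rightarrow> (real^3 \<Rightarrow> real^3) \<Rightarrow> real^3 \<Rightarrow> real" where
  "weak_div D u x = (\<Sum>i\<in>UNIV. weak_jacobian D u x $ i $ i)"

definition strain :: "(real^3) set \<Rightarrow> (real^3 \<Rightarrow> real^3) \<Rightarrow> real^3 \<Rightarrow> real^3^3" where
  "strain D u x =
     (\<chi> i j. 1/2 * (weak_jacobian D u x $ j $ i + weak_jacobian D u x $ i $ j))"

definition stress ::
  "(real^3) set \<Rightarrow> real \<Rightarrow> real \<Rightarrow> (real^3 \<Rightarrow> real^3) \<Rightarrow> real^3 \<Rightarrow> real^3^3" where
  "stress D nu lam u x = (2 * nu) *\<^sub>R strain D u x + (lam * weak_div D u x) *\<^sub>R mat 1"

definition a_form ::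
  "(real^3) set \<Rightarrow> real \<Rightarrow> real \<Rightarrow> real \<Rightarrow> (real^3 \<Rightarrow> real^3) \<Rightarrow> (real^3 \<Rightarrow> real^3) \<Rightarrow> real" where
  "a_form D nu lam eta u \<psi> =
     L2_inner D (stress D nu lam u) (strain D \<psi>) + eta * L2_inner D u \<psi>"

text \<open>\<open>(U \<cdot> \<nabla>)u\<close> for \<open>u \<in> H\<^sup>1(D)\<^sup>3\<close>.\<close>

definition convection ::
  "(real^3) set \<Rightarrow> (real^3 \<Rightarrow> real^3) \<Rightarrow> (real^3 \<Rightarrow> real^3) \<Rightarrow> real^3 \<Rightarrow> real^3" where
  "convection D U u x = weak_jacobian D u x *v U x"

text \<open>For \<open>q \<in> L\<^sup>2(D)\<close>, \<open>U \<cdot> \<nabla>q\<close> is the distribution \<open>\<phi> \<mapsto> - \<integral> q div(\<phi> U)\<close>; \<open>is_transport D U q f\<close>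
  says that the function \<open>f\<close> represents it.\<close>

definition is_transport ::
  "(real^3) set \<Rightarrow> (real^3 \<Rightarrow> real^3) \<Rightarrow> (real^3 \<Rightarrow> real) \<Rightarrow> (real^3 \<Rightarrow> real) \<Rightarrow> bool" where
  "is_transport D U q f \<longleftrightarrow>
     (\<forall>\<phi>\<in>test_functions D.
        (LINT x|lebesgue_on D. f x * \<phi> x) =
        - (LINT x|lebesgue_on D.
             q x * ((\<Sum>j\<in>UNIV. U x $ j * pderivative (axis j 1) \<phi> x) + weak_div D U x * \<phi> x)))"

definition W_space :: "(real^3) set \<Rightarrow> (real^3 \<Rightarrow> real^3) \<Rightarrow> (real^3 \<Rightarrow> real) set" where
  "W_space D U = {q \<in> L2_space D. \<exists>f\<in>L2_space D. is_transport D U q f}"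

definition transport ::
  "(real^3) set \<Rightarrow> (real^3 \<Rightarrow> real^3) \<Rightarrow> (real^3 \<Rightarrow> real) \<Rightarrow> real^3 \<Rightarrow> real" where
  "transport D U q = (SOME f. f \<in> L2_space D \<and> is_transport D U q f)"

definition V0_space :: "(real^3) set \<Rightarrow> (real^3 \<Rightarrow> real^3) set" where
  "V0_space D = {v \<in> Sobolev_vec 1 D. normal_trace_on D v (frontier D) (\<lambda>_. 0)}"

text \<open>\<open>\<psi> = \<psi>(\<beta>) \<in> V\<^sub>\<Omega>\<close>.\<close>

definition in_V_Omega ::
  "(real^3) set \<Rightarrow> (real^3) set \<Rightarrow> (real^2) set \<Rightarrow> (real^3 \<Rightarrow> real^3) \<Rightarrow> (real^2 \<Rightarrow> real) \<Rightarrow> bool"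
  where
  "in_V_Omega D S \<Omega> \<psi> \<beta> \<longleftrightarrow>
     \<psi> \<in> Sobolev_vec 1 D \<and> \<beta> \<in> Sobolev0 2 \<Omega> \<and>
     normal_trace_on D \<psi> S (\<lambda>_. 0) \<and> normal_trace_on D \<psi> (emb ` \<Omega>) (\<lambda>y. \<beta> (proj y))"

text \<open>The function \<open>F\<close> represents the distribution \<open>div \<sigma>(u) - \<nabla>p\<close>.\<close>

definition is_stress_div ::
  "(real^3) set \<Rightarrow> real \<Rightarrow> real \<Rightarrow> (real^3 \<Rightarrow> real) \<Rightarrow> (real^3 \<Rightarrow> real^3) \<Rightarrow> (real^3 \<Rightarrow> real^3) \<Rightarrow> bool"
  where
  "is_stress_div D nu lam p u F \<longleftrightarrow>
     (\<forall>i. \<forall>\<phi>\<in>test_functions D.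
        (LINT x|lebesgue_on D. F x $ i * \<phi> x) =
        - (LINT x|lebesgue_on D.
             (\<Sum>j\<in>UNIV. stress D nu lam u x $ i $ j * pderivative (axis j 1) \<phi> x))
        + (LINT x|lebesgue_on D. p x * pderivative (axis i 1) \<phi> x))"

definition stress_div ::
  "(real^3) set \<Rightarrow> real \<Rightarrow> real \<Rightarrow> (real^3 \<Rightarrow> real) \<Rightarrow> (real^3 \<Rightarrow> real^3) \<Rightarrow> real^3 \<Rightarrow> real^3" where
  "stress_div D nu lam p u = (SOME F. F \<in> L2_space D \<and> is_stress_div D nu lam p u F)"

text \<open>\<open>\<langle>\<sigma>(u)n - pn, g\<rangle>\<close> for \<open>g \<in> H\<^sup>1\<^sup>/\<^sup>2(\<partial>D)\<^sup>3\<close>; by Green's formula the value does not depend on the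
  extension \<open>\<psi>\<close> of \<open>g\<close>.\<close>

definition stress_trace ::
  "(real^3) set \<Rightarrow> real \<Rightarrow> real \<Rightarrow> (real^3 \<Rightarrow> real) \<Rightarrow> (real^3 \<Rightarrow> real^3) \<Rightarrow> (real^3 \<Rightarrow> real^3) \<Rightarrow> real"
  where
  "stress_trace D nu lam p u g =
     (THE c. \<forall>\<psi>\<in>Sobolev_vec 1 D. has_trace D \<psi> g \<longrightarrow>
        c = L2_inner D (stress_div D nu lam p u) \<psi>
            + L2_inner D (stress D nu lam u) (strain D \<psi>)
            - L2_inner D p (weak_div D \<psi>))"

text \<open>The boundary field \<open>\<beta> n\<close> on \<open>\<Omega>\<close>, extended by \<open>0\<close>.\<close>

definition plate_field ::
  "(real^3) set \<Rightarrow> (real^2) set \<Rightarrow> (real^2 \<Rightarrow> real) \<Rightarrow> real^3 \<Rightarrow> real^3" where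
  "plate_field D \<Omega> \<beta> y =
     (if y \<in> emb ` \<Omega> then \<beta> (proj y) *\<^sub>R outward_normal D y else 0)"

text \<open>\<open>\<langle>\<Delta>\<^sup>2w + [2\<nu> \<partial>\<^sub>3u\<^sub>3 + \<lambda> div u - p]\<^sub>\<Omega>, \<beta>\<rangle>\<close> for \<open>\<beta> \<in> H\<^sup>2\<^sub>0(\<Omega>)\<close>.\<close>

definition plate_functional ::
  "(real^3) set \<Rightarrow> (real^2) set \<Rightarrow> real \<Rightarrow> real \<Rightarrow> (real^3 \<Rightarrow> real) \<Rightarrow> (real^3 \<Rightarrow> real^3) \<Rightarrow>
   (real^2 \<Rightarrow> real) \<Rightarrow> (real^2 \<Rightarrow> real) \<Rightarrow> real" where
  "plate_functional D \<Omega> nu lam p u w \<beta> =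
     bilaplacian_pairing \<Omega> w \<beta> + stress_trace D nu lam p u (plate_field D \<Omega> \<beta>)"

text \<open>The function \<open>f\<close> represents \<open>- \<Delta>\<^sup>2w - [2\<nu> \<partial>\<^sub>3u\<^sub>3 + \<lambda> div u]\<^sub>\<Omega> + p|\<^sub>\<Omega>\<close>.\<close>

definition is_plate_force ::
  "(real^3) set \<Rightarrow> (real^2) set \<Rightarrow> real \<Rightarrow> real \<Rightarrow> (real^3 \<Rightarrow> real) \<Rightarrow> (real^3 \<Rightarrow> real^3) \<Rightarrow>
   (real^2 \<Rightarrow> real) \<Rightarrow> (real^2 \<Rightarrow> real) \<Rightarrow> bool" where
  "is_plate_force D \<Omega> nu lam p u w f \<longleftrightarrow>
     (\<forall>\<beta>\<in>Sobolev0 2 \<Omega>. L2_inner \<Omega> f \<beta> = - plate_functional D \<Omega> nu lam p u w \<beta>)"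

definition plate_force ::
  "(real^3) set \<Rightarrow> (real^2) set \<Rightarrow> real \<Rightarrow> real \<Rightarrow> (real^3 \<Rightarrow> real) \<Rightarrow> (real^3 \<Rightarrow> real^3) \<Rightarrow>
   (real^2 \<Rightarrow> real) \<Rightarrow> real^2 \<Rightarrow> real" where
  "plate_force D \<Omega> nu lam p u w =
     (SOME f. f \<in> L2_space \<Omega> \<and> is_plate_force D \<Omega> nu lam p u w f)"


section \<open>The generator\<close>

type_synonym state =
  "(real^3 \<Rightarrow> real) \<times> (real^3 \<Rightarrow> real^3) \<times> (real^2 \<Rightarrow> real) \<times> (real^2 \<Rightarrow> real)"

definition dom_A ::
  "(real^3) set \<Rightarrow> (real^3) set \<Rightarrow> (real^2) set \<Rightarrow> real \<Rightarrow> real \<Rightarrow> (real^3 \<Rightarrow> real^3) \<Rightarrow> state set"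
  where
  "dom_A D S \<Omega> nu lam U =
     {(p, u, w1, w2).
        p \<in> L2_space D \<and> u \<in> Sobolev_vec 1 D \<and> w1 \<in> Sobolev0 2 \<Omega> \<and> w2 \<in> Sobolev0 2 \<Omega> \<and>
        (\<exists>f\<in>L2_space D. is_transport D U p f) \<and>
        (\<exists>F\<in>L2_space D. is_stress_div D nu lam p u F) \<and>
        (\<exists>f\<in>L2_space \<Omega>. is_plate_force D \<Omega> nu lam p u w1 f) \<and>
        (\<forall>\<tau>\<in>TH_half D. stress_trace D nu lam p u \<tau> = 0) \<and>
        (\<exists>\<mu>\<in>V0_space D. \<exists>\<mu>'\<in>Sobolev_vec 1 D.
           trace_on D \<mu>' S (\<lambda>_. 0) \<and>
           trace_on D \<mu>' (emb ` \<Omega>) (\<lambda>y. w2 (proj y) *\<^sub>R outward_normal D y) \<and>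
           (AE x in lebesgue_on D. u x = \<mu> x + \<mu>' x))}"

fun op_A ::
  "(real^3) set \<Rightarrow> (real^2) set \<Rightarrow> real \<Rightarrow> real \<Rightarrow> real \<Rightarrow> (real^3 \<Rightarrow> real^3) \<Rightarrow> state \<Rightarrow> state" where
  "op_A D \<Omega> nu lam eta U (p, u, w1, w2) =
     (\<lambda>x. - transport D U p x - weak_div D u x,
      \<lambda>x. stress_div D nu lam p u x - eta *\<^sub>R u x - convection D U u x,
      w2,
      plate_force D \<Omega> nu lam p u w1)"

text \<open>The zero element of \<open>L\<^sup>2(D) \<times> L\<^sup>2(D)\<^sup>3 \<times> H\<^sup>2\<^sub>0(\<Omega>) \<times> L\<^sup>2(\<Omega>)\<close>, whose elements are classes of
  functions modulo null sets.\<close>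

fun state_zero :: "(real^3) set \<Rightarrow> (real^2) set \<Rightarrow> state \<Rightarrow> bool" where
  "state_zero D \<Omega> (f1, f2, f3, f4) \<longleftrightarrow>
     (AE x in lebesgue_on D. f1 x = 0) \<and> (AE x in lebesgue_on D. f2 x = 0) \<and>
     (AE z in lebesgue_on \<Omega>. f3 z = 0) \<and> (AE z in lebesgue_on \<Omega>. f4 z = 0)"

definition null_A ::
  "(real^3) set \<Rightarrow> (real^3) set \<Rightarrow> (real^2) set \<Rightarrow> real \<Rightarrow> real \<Rightarrow> real \<Rightarrow> (real^3 \<Rightarrow> real^3) \<Rightarrow> state set"
  where
  "null_A D S \<Omega> nu lam eta U =
     {X \<in> dom_A D S \<Omega> nu lam U. state_zero D \<Omega> (op_A D \<Omega> nu lam eta U X)}"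

end

theory Submission
  imports Defs
begin

text \<open>
  Testing the first equation with test functions \<open>q\<close> shows that \<open>U \<cdot> \<nabla>p = - div u\<close>, and testing the
  second one with \<open>\<psi> = \<phi> e\<^sub>i\<close> shows that \<open>div \<sigma>(u) - \<nabla>p = (U \<cdot> \<nabla>)u + \<eta>u\<close>.  That the right-hand side
  is square integrable rests on the boundedness of \<open>U \<in> H\<^sup>3(D)\<close>.  The latter is proved by duality: by
  integration by parts along the three edges of a parallelepiped \<open>x + [0,1]e\<^sub>1 + [0,1]e\<^sub>2 + [0,1]e\<^sub>3\<close>
  inside \<open>D\<close>, the integral \<open>\<integral> U \<phi>\<close> is a sum of integrals of derivatives of \<open>U\<close> of order at most \<open>3\<close>
  against iterated line averages of \<open>\<phi>\<close>, which are bounded by \<open>\<integral> |\<phi>|\<close> over the volume of the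
  parallelepiped; convexity bounds this volume from below.

  The second equation then reads
  \<open>(div \<sigma>(u) - \<nabla>p, \<psi>) + (\<sigma>(u), \<epsilon>(\<psi>)) - (p, div \<psi>) = - (\<Delta>w, \<Delta>\<beta>)\<close>, whose left-hand side is the stress
  trace.  It vanishes on tangential fields, and on \<open>\<beta> n\<close> it cancels \<open>\<Delta>\<^sup>2w\<close>.  For this, \<open>\<beta> n\<close> extended
  by \<open>0\<close> has to be the trace of some field in \<open>H\<^sup>1(D)\<close>: one extends \<open>\<beta>\<close> along the rays of the cone over
  the plate whose apex is a point of \<open>D\<close>, cut off near the apex.  As \<open>D\<close> is convex, the cone meets
  the boundary only in its base.  Passing to the limit from test functions to \<open>\<beta>\<close> only needs an
  upper bound of the surface measure on the plate by Lebesgue measure, which follows from coverings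
  by squares.
\<close>

section \<open>Smooth functions\<close>

text \<open>\<open>weak_deriv\<close>, \<open>transport\<close>, \<open>stress_div\<close> and
  \<open>plate_force\<close> are picked by \<open>SOME\<close>; \<open>stress_trace\<close> and
  \<open>bilaplacian_pairing\<close> are defined by \<open>THE\<close>. Nothing can be said about
  them before a witness, and for \<open>THE\<close> also its uniqueness, is established. For the
  stress trace the weak equation gives one half: each extension of a tangential field, or of \<beta>
  n, is itself an admissible test field with the same \<beta>, so all extensions yield the same
  value. The other half is that some extension exists; for tangential fields this is part of
  \<open>TH_half\<close>, for \<beta> n it is the purpose of the cone. Boundedness of U matters
  because the gradient of u is only square integrable in (U \<cdot> \<nabla>)u. One integration by
  parts is spent per space dimension, which accounts for three derivatives; the constants do not
  depend on the base point, so local bounds combine into a global one. This bound and every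
  uniqueness statement for distributions rest on one fact: if the integrals of v against
  non-negative test functions are at most those of the constant C, then v \<le> C almost
  everywhere.\<close>

lemma pderivative_eq: "(f has_derivative f') (at x) \<Longrightarrow> pderivative b f x = f' b"
  unfolding pderivative_def using frechet_derivative_at by metis

lemma has_derivative_pderivative:
  fixes f :: "'a::euclidean_space \<Rightarrow> real"
  assumes "f differentiable (at x)"
  shows "(f has_derivative (\<lambda>h. \<Sum>b\<in>Basis. (h \<bullet> b) * pderivative b f x)) (at x)"
proof -
  have d: "(f has_derivative frechet_derivative f (at x)) (at x)"
    using assms by (simp add: frechet_derivative_works)
  then have lin: "linear (frechet_derivative f (at x))"
    by (rule has_derivative_linear)
  have "frechet_derivative f (at x) h = (\<Sum>b\<in>Basis. (h \<bullet> b) * pderivative b f x)" for h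
  proof -
    have "frechet_derivative f (at x) h = frechet_derivative f (at x) (\<Sum>b\<in>Basis. (h \<bullet> b) *\<^sub>R b)"
      by (simp add: euclidean_representation)
    also have "\<dots> = (\<Sum>b\<in>Basis. (h \<bullet> b) * pderivative b f x)"
      by (simp add: linear_sum[OF lin] linear_scale[OF lin] pderivative_def)
    finally show ?thesis .
  qed
  then have "frechet_derivative f (at x) = (\<lambda>h. \<Sum>b\<in>Basis. (h \<bullet> b) * pderivative b f x)"
    by blast
  with d show ?thesis by simp
qed

lemma C_k_Suc_differentiable: "C_k (Suc k) f \<Longrightarrow> f differentiable (at x)"
  by (auto simp: differentiable_on_def)

lemma C_k_Suc_has_derivative:
  "C_k (Suc k) f \<Longrightarrow> (f has_derivative (\<lambda>h. \<Sum>b\<in>Basis. (h \<bullet> b) * pderivative b f x)) (at x)"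
  by (intro has_derivative_pderivative C_k_Suc_differentiable)

lemma pderivative_expand:
  assumes "C_k (Suc k) f"
  shows "pderivative e f x = (\<Sum>b\<in>Basis. (e \<bullet> b) * pderivative b f x)"
  using pderivative_eq[OF C_k_Suc_has_derivative[OF assms]] .

section \<open>Calculus of k times continuously differentiable functions\<close>

lemma C_k_SucD: "C_k (Suc k) f \<Longrightarrow> C_k k f"
proof (induction k arbitrary: f)
  case 0
  then show ?case by (auto intro: differentiable_imp_continuous_on)
next
  case (Suc k)
  then show ?case by (metis C_k.simps(2))
qed

lemma C_k_mono: "C_k n f \<Longrightarrow> k \<le> n \<Longrightarrow> C_k k f"
  by (induction n) (auto simp: le_Suc_eq simp del: C_k.simps(2) dest: C_k_SucD)

lemma C_k_continuous: "C_k k f \<Longrightarrow> continuous_on UNIV f"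
  using C_k_mono[of k f 0] by simp

text \<open>\<open>C_k\<close> recurses through \<open>pderivative\<close>, which is read off from
  \<open>frechet_derivative\<close>. With this rule it is enough to exhibit any derivative
  \<open>f'\<close> explicitly; the inductions on k below go through it.\<close>

lemma C_k_SucI:
  assumes "\<And>x. (f has_derivative f' x) (at x)" "\<And>b. b \<in> Basis \<Longrightarrow> C_k k (\<lambda>x. f' x b)"
  shows "C_k (Suc k) f"
proof -
  have "pderivative b f = (\<lambda>x. f' x b)" for b
    using assms(1) pderivative_eq by blast
  then show ?thesis
    using assms by (auto simp: differentiable_on_def differentiable_def intro: has_derivative_at_withinI)
qed

lemma C_k_const: "C_k k (\<lambda>x. c)"
proof (induction k arbitrary: c)
  case (Suc k)
  show ?case by (rule C_k_SucI[where f'="\<lambda>x h. 0"]) (auto intro: Suc)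
qed simp

lemma C_k_linear: "bounded_linear f \<Longrightarrow> C_k k f"
proof (cases k)
  case 0
  assume "bounded_linear f"
  then show ?thesis using 0 by (simp add: linear_continuous_on)
next
  case (Suc n)
  assume "bounded_linear f"
  then have "\<And>x. (f has_derivative f) (at x)"
    by (rule bounded_linear_imp_has_derivative)
  then have "C_k (Suc n) f"
    by (rule C_k_SucI) (rule C_k_const)
  then show ?thesis using Suc by simp
qed

lemma C_k_add: "C_k k f \<Longrightarrow> C_k k g \<Longrightarrow> C_k k (\<lambda>x. f x + g x)"
proof (induction k arbitrary: f g)
  case 0
  then show ?case by (simp add: continuous_intros)
next
  case (Suc k)
  show ?case
  proof (rule C_k_SucI)
    show "((\<lambda>x. f x + g x) has_derivative (\<lambda>h. frechet_derivative f (at x) h + frechet_derivative g (at x) h)) (at x)" for x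
      using Suc.prems[THEN C_k_Suc_differentiable] by (intro has_derivative_add) (simp_all add: frechet_derivative_works)
    show "C_k k (\<lambda>x. frechet_derivative f (at x) b + frechet_derivative g (at x) b)" if "b \<in> Basis" for b
      using Suc.IH[of "pderivative b f" "pderivative b g"] Suc.prems that
      by (simp add: pderivative_def[abs_def])
  qed
qed

lemma C_k_mult: "C_k k f \<Longrightarrow> C_k k g \<Longrightarrow> C_k k (\<lambda>x. f x * g x)"
proof (induction k arbitrary: f g)
  case 0
  then show ?case by (simp add: continuous_intros)
next
  case (Suc k)
  show ?case
  proof (rule C_k_SucI)
    show "((\<lambda>x. f x * g x) has_derivative (\<lambda>h. f x * frechet_derivative g (at x) h + frechet_derivative f (at x) h * g x)) (at x)" for x
      using Suc.prems[THEN C_k_Suc_differentiable] by (intro has_derivative_mult) (simp_all add: frechet_derivative_works)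
    show "C_k k (\<lambda>x. f x * frechet_derivative g (at x) b + frechet_derivative f (at x) b * g x)" if "b \<in> Basis" for b
    proof -
      have "C_k k f" "C_k k g" using Suc.prems C_k_SucD by blast+
      then have "C_k k (\<lambda>x. f x * pderivative b g x)" "C_k k (\<lambda>x. pderivative b f x * g x)"
        using Suc.IH Suc.prems that by auto
      then have "C_k k (\<lambda>x. f x * pderivative b g x + pderivative b f x * g x)"
        by (rule C_k_add)
      then show ?thesis by (simp add: pderivative_def)
    qed
  qed
qed

lemma C_k_cmult: "C_k k f \<Longrightarrow> C_k k (\<lambda>x. c * f x)"
  by (intro C_k_mult C_k_const)

lemma C_k_diff: "C_k k f \<Longrightarrow> C_k k g \<Longrightarrow> C_k k (\<lambda>x. f x - g x)"
  using C_k_add[of k f "\<lambda>x. (-1) * g x"] C_k_cmult[of k g "-1"] by simp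

lemma C_k_sum: "(\<And>i. i \<in> I \<Longrightarrow> C_k k (f i)) \<Longrightarrow> C_k k (\<lambda>x. \<Sum>i\<in>I. f i x)"
proof (induction I rule: infinite_finite_induct)
  case (insert x F)
  then show ?case by (simp add: C_k_add)
qed (auto intro: C_k_const)

lemma C_k_prod: "(\<And>i. i \<in> I \<Longrightarrow> C_k k (f i)) \<Longrightarrow> C_k k (\<lambda>x. \<Prod>i\<in>I. f i x)"
proof (induction I rule: infinite_finite_induct)
  case (insert x F)
  then show ?case by (simp add: C_k_mult)
qed (auto intro: C_k_const)

lemma has_derivative_componentwise:
  fixes G :: "'a::euclidean_space \<Rightarrow> 'b::euclidean_space"
  assumes "\<And>c. c \<in> Basis \<Longrightarrow> (\<lambda>x. G x \<bullet> c) differentiable (at x)"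
  shows "(G has_derivative (\<lambda>h. \<Sum>c\<in>Basis. frechet_derivative (\<lambda>x. G x \<bullet> c) (at x) h *\<^sub>R c)) (at x)"
proof -
  have "((\<lambda>x. \<Sum>c\<in>Basis. (G x \<bullet> c) *\<^sub>R c) has_derivative
     (\<lambda>h. \<Sum>c\<in>Basis. frechet_derivative (\<lambda>x. G x \<bullet> c) (at x) h *\<^sub>R c)) (at x)"
    using assms by (intro has_derivative_sum has_derivative_scaleR_left) (simp add: frechet_derivative_works)
  then show ?thesis by (simp add: euclidean_representation)
qed

lemma has_derivative_compose_pderivative:
  fixes G :: "'a::euclidean_space \<Rightarrow> 'b::euclidean_space"
  assumes "f differentiable (at (G x))" "\<And>c. c \<in> Basis \<Longrightarrow> (\<lambda>x. G x \<bullet> c) differentiable (at x)"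
  shows "((\<lambda>x. f (G x)) has_derivative
     (\<lambda>h. \<Sum>c\<in>Basis. pderivative h (\<lambda>x. G x \<bullet> c) x * pderivative c f (G x))) (at x)"
proof -
  have "((\<lambda>x. f (G x)) has_derivative
    (\<lambda>h. \<Sum>c\<in>Basis. ((\<Sum>c\<in>Basis. frechet_derivative (\<lambda>x. G x \<bullet> c) (at x) h *\<^sub>R c) \<bullet> c) * pderivative c f (G x))) (at x)"
    using has_derivative_compose[OF has_derivative_componentwise[OF assms(2)] has_derivative_pderivative[OF assms(1)]] by simp
  then show ?thesis by (simp add: pderivative_def)
qed

text \<open>By the chain rule the derivative is a sum of products of derivatives of components of G
  with functions \<open>pderivative c f\<close> composed with G. The outer function changes while G
  stays, hence the induction generalises over f only.\<close>

lemma C_k_compose: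
  fixes G :: "'a::euclidean_space \<Rightarrow> 'b::euclidean_space"
  assumes "C_k k f" "\<And>c. c \<in> Basis \<Longrightarrow> C_k k (\<lambda>x. G x \<bullet> c)"
  shows "C_k k (\<lambda>x. f (G x))"
  using assms
proof (induction k arbitrary: f)
  case 0
  then have "continuous_on UNIV G"
    by (subst continuous_on_componentwise) simp
  then show ?case
    using 0 by (auto intro: continuous_on_compose2)
next
  case (Suc k)
  show ?case
  proof (rule C_k_SucI)
    show "((\<lambda>x. f (G x)) has_derivative
     (\<lambda>h. \<Sum>c\<in>Basis. pderivative h (\<lambda>x. G x \<bullet> c) x * pderivative c f (G x))) (at x)" for x
      by (intro has_derivative_compose_pderivative C_k_Suc_differentiable[OF Suc.prems(1)]
          C_k_Suc_differentiable[OF Suc.prems(2)])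
    show "C_k k (\<lambda>x. \<Sum>c\<in>Basis. pderivative b (\<lambda>x. G x \<bullet> c) x * pderivative c f (G x))" if "b \<in> Basis" for b
    proof (intro C_k_sum C_k_mult)
      fix c :: 'b assume c: "c \<in> Basis"
      show "C_k k (pderivative b (\<lambda>x. G x \<bullet> c))" using Suc.prems(2)[OF c] that by simp
      show "C_k k (\<lambda>x. pderivative c f (G x))"
      proof (rule Suc.IH)
        show "C_k k (pderivative c f)" using Suc.prems(1) c by simp
        show "C_k k (\<lambda>x. G x \<bullet> d)" if "d \<in> Basis" for d
          using Suc.prems(2)[OF that] by (rule C_k_SucD)
      qed
    qed
  qed
qed

lemma C_k_compose_real: "C_k k f \<Longrightarrow> C_k k g \<Longrightarrow> C_k k (\<lambda>x. f (g x :: real))"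
  by (rule C_k_compose) auto

lemma C_k_inverse:
  fixes f :: "'a::euclidean_space \<Rightarrow> real"
  assumes "C_k k f" "\<And>x. f x \<noteq> 0"
  shows "C_k k (\<lambda>x. inverse (f x))"
  using assms(1)
proof (induction k)
  case 0
  then show ?case using assms(2) by (simp add: continuous_on_inverse)
next
  case (Suc k)
  show ?case
  proof (rule C_k_SucI)
    show "((\<lambda>x. inverse (f x)) has_derivative (\<lambda>h. - (inverse (f x) * frechet_derivative f (at x) h * inverse (f x)))) (at x)" for x
      using Suc.prems[THEN C_k_Suc_differentiable] assms(2)
      by (intro Deriv.has_derivative_inverse) (simp_all add: frechet_derivative_works)
    show "C_k k (\<lambda>x. - (inverse (f x) * frechet_derivative f (at x) b * inverse (f x)))" if "b \<in> Basis" for b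
    proof -
      have "C_k k (\<lambda>x. inverse (f x))" "C_k k (pderivative b f)"
        using Suc that C_k_SucD by auto
      then have "C_k k (\<lambda>x. (-1) * (inverse (f x) * pderivative b f x * inverse (f x)))"
        by (intro C_k_mult C_k_const)
      then show ?thesis by (simp add: pderivative_def)
    qed
  qed
qed

text \<open>The classical function exp(-1/t), which is flat at 0. The powers of 1/t are included so
  that differentiation stays inside the family; the cutoffs below are built from
  \<open>flat_exp 0\<close>.\<close>

definition flat_exp :: "nat \<Rightarrow> real \<Rightarrow> real" where
  "flat_exp m t = (if t > 0 then (1/t)^m * exp (-1/t) else 0)"

lemma flat_exp_tendsto_0: "(flat_exp m \<longlongrightarrow> 0) (at_right 0)"
proof -
  have "((\<lambda>x::real. x^m / exp x) \<longlongrightarrow> 0) at_top"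
    by (rule tendsto_power_div_exp_0)
  then have "((\<lambda>t::real. (inverse t)^m / exp (inverse t)) \<longlongrightarrow> 0) (at_right 0)"
    by (rule filterlim_compose) (rule filterlim_inverse_at_top_right)
  then show ?thesis
  proof (rule Lim_transform_eventually)
    show "\<forall>\<^sub>F t in at_right 0. inverse t ^ m / exp (inverse t) = flat_exp m t"
      by (auto simp: flat_exp_def eventually_at_right_less exp_minus divide_inverse
          intro!: eventually_mono[OF eventually_at_right_less[of 0]])
  qed
qed

lemma flat_exp_DERIV: "(flat_exp m has_real_derivative (flat_exp (m+2) t - m * flat_exp (m+1) t)) (at t)"
proof (cases "t = 0")
  case True
  have "(flat_exp m has_real_derivative 0) (at 0)"
    unfolding has_field_derivative_iff
  proof -
    have "((\<lambda>y. (flat_exp m (0 + y) - flat_exp m 0) / y) \<longlongrightarrow> 0) (at 0)"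
    proof (subst filterlim_at_split, intro conjI)
      show "((\<lambda>y. (flat_exp m (0 + y) - flat_exp m 0) / y) \<longlongrightarrow> 0) (at_left 0)"
        by (rule tendsto_eventually) (auto simp: flat_exp_def eventually_at_left_field intro: exI[of _ "-1"])
      \<comment> \<open>On the right the difference quotient is \<open>flat_exp (m + 1)\<close>:
        dividing by y adds one power of 1/y.\<close>
      show "((\<lambda>y. (flat_exp m (0 + y) - flat_exp m 0) / y) \<longlongrightarrow> 0) (at_right 0)"
        by (rule Lim_transform_eventually[OF flat_exp_tendsto_0[of "m+1"]])
          (auto simp: flat_exp_def intro!: eventually_mono[OF eventually_at_right_less[of 0]])
    qed
    then show "((\<lambda>y. (flat_exp m y - flat_exp m 0) / (y - 0)) \<longlongrightarrow> 0) (at 0)" by simp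
  qed
  then show ?thesis using True by (simp add: flat_exp_def)
next
  case False
  show ?thesis
  proof (cases "t > 0")
    case True
    have "((\<lambda>t. (1/t)^m * exp (-1/t)) has_real_derivative (flat_exp (m+2) t - m * flat_exp (m+1) t)) (at t)"
    proof (rule DERIV_cong)
      have "((\<lambda>t. 1/t) has_real_derivative - ((1/t)^2)) (at t)"
        using True by (auto intro!: derivative_eq_intros simp: power2_eq_square)
      moreover from this have "((\<lambda>t. -1/t) has_real_derivative ((1/t)^2)) (at t)"
        using DERIV_minus by force
      ultimately show "((\<lambda>t. (1/t)^m * exp (-1/t)) has_real_derivative
        (real m * (- ((1/t)^2)) * (1/t)^(m - 1)) * exp (-1/t) + (exp (-1/t) * (1/t)^2) * (1/t)^m) (at t)"
        by (intro DERIV_mult DERIV_fun_exp) (auto dest: DERIV_power[where n=m] simp: algebra_simps)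
      \<comment> \<open>For m = 0 the exponent \<open>m - 1\<close> is truncated to 0, and both
        sides vanish through the factor m.\<close>
      have "real m * (1/t)^2 * (1/t)^(m - 1) = real m * (1/t)^(m+1)"
        by (cases m) (simp_all add: power_add[symmetric] numeral_2_eq_2)
      then show "(real m * (- ((1/t)^2)) * (1/t)^(m - 1)) * exp (-1/t) + (exp (-1/t) * (1/t)^2) * (1/t)^m
          = flat_exp (m+2) t - m * flat_exp (m+1) t"
        using True by (simp add: flat_exp_def power_add power2_eq_square mult.commute)
    qed
    moreover have "\<forall>\<^sub>F s in nhds t. flat_exp m s = (1/s)^m * exp (-1/s)"
      using eventually_nhds_in_open[of "{0<..}" t] True by (auto simp: flat_exp_def elim: eventually_mono)
    ultimately show ?thesis
      by (subst DERIV_cong_ev[OF refl _ refl])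
  next
    case neg: False
    have "\<forall>\<^sub>F s in nhds t. flat_exp m s = 0"
      using eventually_nhds_in_open[of "{..<0}" t] False neg by (auto simp: flat_exp_def elim!: eventually_mono)
    moreover have "flat_exp (m+2) t - m * flat_exp (m+1) t = 0" using neg by (simp add: flat_exp_def)
    ultimately show ?thesis
      using DERIV_cong_ev[OF refl, of "flat_exp m" "\<lambda>_. 0" t _ 0] by simp
  qed
qed

lemma C_k_flat_exp: "C_k k (flat_exp m)"
proof (induction k arbitrary: m)
  case 0
  show ?case
    unfolding C_k.simps
    by (intro continuous_at_imp_continuous_on ballI DERIV_isCont[OF flat_exp_DERIV])
next
  case (Suc k)
  show ?case
  proof (rule C_k_SucI)
    show "(flat_exp m has_derivative (*) (flat_exp (m+2) t - m * flat_exp (m+1) t)) (at t)" for t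
      using flat_exp_DERIV[of m t] by (simp add: has_field_derivative_def)
    show "C_k k (\<lambda>t. (flat_exp (m+2) t - m * flat_exp (m+1) t) * b)" if "b \<in> Basis" for b :: real
      by (intro C_k_mult C_k_diff C_k_cmult Suc C_k_const)
  qed
qed

section \<open>Closure properties of infinitely differentiable functions\<close>

lemma smoothD: "smooth f \<Longrightarrow> C_k k f"
  by (simp add: smooth_def)

lemma smoothI: "(\<And>k. C_k k f) \<Longrightarrow> smooth f"
  by (simp add: smooth_def)

lemma smooth_differentiable: "smooth f \<Longrightarrow> f differentiable (at x)"
  using C_k_Suc_differentiable smoothD by blast

lemma smooth_continuous: "smooth f \<Longrightarrow> continuous_on UNIV f"
  using C_k_continuous smoothD by blast

lemma smooth_pderivative: "smooth f \<Longrightarrow> smooth (pderivative b f)"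
proof (rule smoothI)
  fix k assume f: "smooth f"
  have "pderivative b f = (\<lambda>x. \<Sum>c\<in>Basis. (b \<bullet> c) * pderivative c f x)"
    using pderivative_expand[OF smoothD[OF f]] by blast
  moreover have "C_k k (\<lambda>x. \<Sum>c\<in>Basis. (b \<bullet> c) * pderivative c f x)"
    using smoothD[OF f, of "Suc k"] by (intro C_k_sum C_k_cmult) simp
  ultimately show "C_k k (pderivative b f)" by simp
qed

lemma smooth_const: "smooth (\<lambda>x. c)"
  by (intro smoothI C_k_const)

lemma smooth_add: "smooth f \<Longrightarrow> smooth g \<Longrightarrow> smooth (\<lambda>x. f x + g x)"
  by (simp add: smooth_def C_k_add)

lemma smooth_diff: "smooth f \<Longrightarrow> smooth g \<Longrightarrow> smooth (\<lambda>x. f x - g x)"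
  by (simp add: smooth_def C_k_diff)

lemma smooth_mult: "smooth f \<Longrightarrow> smooth g \<Longrightarrow> smooth (\<lambda>x. f x * g x)"
  by (simp add: smooth_def C_k_mult)

lemma smooth_sum: "(\<And>i. i \<in> I \<Longrightarrow> smooth (f i)) \<Longrightarrow> smooth (\<lambda>x. \<Sum>i\<in>I. f i x)"
  by (simp add: smooth_def C_k_sum)

lemma smooth_prod: "(\<And>i. i \<in> I \<Longrightarrow> smooth (f i)) \<Longrightarrow> smooth (\<lambda>x. \<Prod>i\<in>I. f i x)"
  by (simp add: smooth_def C_k_prod)

lemma smooth_linear: "bounded_linear f \<Longrightarrow> smooth f"
  by (intro smoothI C_k_linear)

lemma smooth_compose: 
  "smooth f \<Longrightarrow> (\<And>c. c \<in> Basis \<Longrightarrow> smooth (\<lambda>x. G x \<bullet> c)) \<Longrightarrow> smooth (\<lambda>x. f (G x))"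
  by (simp add: smooth_def C_k_compose)

lemma smooth_compose_real: "smooth f \<Longrightarrow> smooth g \<Longrightarrow> smooth (\<lambda>x. f (g x :: real))"
  by (simp add: smooth_def C_k_compose_real)

lemma smooth_inverse:
  fixes f :: "'a::euclidean_space \<Rightarrow> real"
  shows "smooth f \<Longrightarrow> (\<And>x. f x \<noteq> 0) \<Longrightarrow> smooth (\<lambda>x. inverse (f x))"
  by (simp add: smooth_def C_k_inverse)

lemma smooth_flat_exp: "smooth (flat_exp m)"
  by (intro smoothI C_k_flat_exp)

section \<open>Product rule and locality of partial derivatives\<close>

lemma pderivative_const: "pderivative b (\<lambda>x. c) = (\<lambda>x. 0)"
  by (intro ext pderivative_eq) (rule has_derivative_const)

lemma pderivative_mult:
  "f differentiable (at x) \<Longrightarrow> g differentiable (at x) \<Longrightarrow>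
   pderivative b (\<lambda>x. f x * g x) x = f x * pderivative b g x + pderivative b f x * g x"
  unfolding pderivative_def[of b f] pderivative_def[of b g] 
  by (intro pderivative_eq has_derivative_mult) (simp_all add: frechet_derivative_works)

lemma pderivative_eq_0:
  assumes "open T" "x \<in> T" "\<And>y. y \<in> T \<Longrightarrow> f y = 0"
  shows "pderivative b f x = 0"
proof -
  have "(f has_derivative (\<lambda>h. 0)) (at x)"
    by (rule has_derivative_transform_within_open[OF has_derivative_const assms(1,2)]) (simp add: assms(3))
  from pderivative_eq[OF this] show ?thesis .
qed

section \<open>Test functions\<close>

text \<open>Any compact K off which the function vanishes certifies compact support, so that for
  products, sums and derivatives no closure has to be computed.\<close>

lemma test_functionsI:
  assumes "smooth \<phi>" "compact K" "K \<subseteq> D" "\<And>x. x \<notin> K \<Longrightarrow> \<phi> x = 0"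
  shows "\<phi> \<in> test_functions D"
proof -
  have "closure {x. \<phi> x \<noteq> 0} \<subseteq> K"
    using assms(2,4) by (intro closure_minimal) (auto simp: compact_imp_closed)
  moreover from this have "compact (closure {x. \<phi> x \<noteq> 0})"
    using assms(2) by (metis closed_Int_compact closed_closure inf.absorb1)
  ultimately show ?thesis using assms unfolding test_functions_def by auto
qed

lemma test_functionsE:
  assumes "\<phi> \<in> test_functions D"
  obtains K where "smooth \<phi>" "compact K" "K \<subseteq> D" "\<And>x. x \<notin> K \<Longrightarrow> \<phi> x = 0"
  using assms closure_subset[of "{x. \<phi> x \<noteq> 0}"] unfolding test_functions_def by blast

lemma test_functions_smooth: "\<phi> \<in> test_functions D \<Longrightarrow> smooth \<phi>"
  by (simp add: test_functions_def)

lemma test_functions_mono: "D \<subseteq> D' \<Longrightarrow> test_functions D \<subseteq> test_functions D'"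
  by (auto simp: test_functions_def)

lemma test_functions_zero: "(\<lambda>x. 0) \<in> test_functions D"
  by (rule test_functionsI[where K="{}"]) (auto intro: smooth_const)

lemma test_functions_outside: "\<phi> \<in> test_functions D \<Longrightarrow> x \<notin> D \<Longrightarrow> \<phi> x = 0"
  by (auto elim: test_functionsE)

lemma test_functions_smooth_mult:
  assumes "\<phi> \<in> test_functions D" "smooth f"
  shows "(\<lambda>x. f x * \<phi> x) \<in> test_functions D"
proof -
  obtain K where "smooth \<phi>" "compact K" "K \<subseteq> D" "\<And>x. x \<notin> K \<Longrightarrow> \<phi> x = 0"
    using test_functionsE[OF assms(1)] by metis
  then show ?thesis
    by (intro test_functionsI[where K=K] smooth_mult assms) auto
qed

lemma pderivative_eq_0_outside:
  assumes "closed K" "\<And>x. x \<notin> K \<Longrightarrow> f x = 0" "x \<notin> K"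
  shows "pderivative b f x = 0"
  by (rule pderivative_eq_0[of "- K"]) (use assms in auto)

lemma test_functions_pderivative:
  assumes "\<phi> \<in> test_functions D"
  shows "pderivative b \<phi> \<in> test_functions D"
proof -
  obtain K where "smooth \<phi>" "compact K" "K \<subseteq> D" "\<And>x. x \<notin> K \<Longrightarrow> \<phi> x = 0"
    using test_functionsE[OF assms] by metis
  then show ?thesis
    by (intro test_functionsI[where K=K] smooth_pderivative pderivative_eq_0_outside[of K])
       (auto simp: compact_imp_closed)
qed

lemma test_functions_add:
  assumes "\<phi> \<in> test_functions D" "\<psi> \<in> test_functions D"
  shows "(\<lambda>x. \<phi> x + \<psi> x) \<in> test_functions D"
proof -
  obtain K where "smooth \<phi>" "compact K" "K \<subseteq> D" "\<And>x. x \<notin> K \<Longrightarrow> \<phi> x = 0"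
    using test_functionsE[OF assms(1)] by metis
  moreover obtain L where "smooth \<psi>" "compact L" "L \<subseteq> D" "\<And>x. x \<notin> L \<Longrightarrow> \<psi> x = 0"
    using test_functionsE[OF assms(2)] by metis
  ultimately show ?thesis
    by (intro test_functionsI[where K="K \<union> L"] smooth_add compact_Un) auto
qed

lemma test_functions_sum:
  "(\<And>i. i \<in> I \<Longrightarrow> \<phi> i \<in> test_functions D) \<Longrightarrow> (\<lambda>x. \<Sum>i\<in>I. \<phi> i x) \<in> test_functions D"
  by (induction I rule: infinite_finite_induct) (auto intro: test_functions_add test_functions_zero)

lemma test_functions_bounded:
  assumes "\<phi> \<in> test_functions D"
  obtains M where "M \<ge> 0" "\<And>x. \<bar>\<phi> x\<bar> \<le> M"
proof -
  obtain K where K: "smooth \<phi>" "compact K" "K \<subseteq> D" "\<And>x. x \<notin> K \<Longrightarrow> \<phi> x = 0"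
    using test_functionsE[OF assms] by metis
  have "compact (\<phi> ` K)"
    using K smooth_continuous by (intro compact_continuous_image) (auto intro: continuous_on_subset)
  then obtain M where "\<forall>y\<in>\<phi> ` K. norm y \<le> M"
    using compact_imp_bounded bounded_iff by metis
  then have "\<bar>\<phi> x\<bar> \<le> max M 0" for x
    by (cases "x \<in> K") (auto simp: K(4) le_max_iff_disj)
  then show thesis using that[of "max M 0"] by simp
qed

section \<open>Square-integrable functions\<close>

lemma L2_spaceD:
  assumes "f \<in> L2_space D"
  shows "f \<in> borel_measurable (lebesgue_on D)" "integrable (lebesgue_on D) (\<lambda>x. (norm (f x))\<^sup>2)"
  using assms by (auto simp: L2_space_def)

lemma L2_space_boundI:
  assumes f: "f \<in> borel_measurable (lebesgue_on D)"
    and g: "integrable (lebesgue_on D) g" "AE x in lebesgue_on D. (norm (f x))\<^sup>2 \<le> g x"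
  shows "f \<in> L2_space D"
  unfolding L2_space_def
proof (intro CollectI conjI)
  show "integrable (lebesgue_on D) (\<lambda>x. (norm (f x))\<^sup>2)"
  proof (rule Bochner_Integration.integrable_bound[OF g(1)])
    show "(\<lambda>x. (norm (f x))\<^sup>2) \<in> borel_measurable (lebesgue_on D)" using f by measurable
    show "AE x in lebesgue_on D. norm ((norm (f x))\<^sup>2) \<le> norm (g x)"
      using g(2) by eventually_elim auto
  qed
qed (rule f)

lemma L2_space_zero: "(\<lambda>x. 0) \<in> L2_space D"
  by (simp add: L2_space_def)

lemma norm_add_sq_le:
  fixes a b :: "'a::real_normed_vector"
  shows "(norm (a + b))\<^sup>2 \<le> 2 * (norm a)\<^sup>2 + 2 * (norm b)\<^sup>2"
proof -
  have "(norm (a + b))\<^sup>2 \<le> (norm a + norm b)\<^sup>2"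
    by (intro power_mono norm_triangle_ineq) simp
  also have "\<dots> \<le> 2 * (norm a)\<^sup>2 + 2 * (norm b)\<^sup>2"
    using zero_le_power2[of "norm a - norm b"] by (simp add: power2_eq_square algebra_simps)
  finally show ?thesis .
qed

lemma L2_space_add:
  assumes "f \<in> L2_space D" "g \<in> L2_space D"
  shows "(\<lambda>x. f x + g x) \<in> L2_space D"
proof (rule L2_space_boundI)
  show "(\<lambda>x. f x + g x) \<in> borel_measurable (lebesgue_on D)"
    using L2_spaceD(1)[OF assms(1)] L2_spaceD(1)[OF assms(2)] by measurable
  show "integrable (lebesgue_on D) (\<lambda>x. 2 * (norm (f x))\<^sup>2 + 2 * (norm (g x))\<^sup>2)"
    using L2_spaceD(2)[OF assms(1)] L2_spaceD(2)[OF assms(2)] by auto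
qed (simp add: norm_add_sq_le)

lemma L2_space_scaleR:
  assumes "f \<in> L2_space D"
  shows "(\<lambda>x. c *\<^sub>R f x) \<in> L2_space D"
proof (rule L2_space_boundI)
  show "(\<lambda>x. c *\<^sub>R f x) \<in> borel_measurable (lebesgue_on D)"
    using L2_spaceD(1)[OF assms(1)] by measurable
  show "integrable (lebesgue_on D) (\<lambda>x. c\<^sup>2 * (norm (f x))\<^sup>2)"
    using L2_spaceD(2)[OF assms(1)] by auto
qed (simp add: power_mult_distrib)

lemma L2_space_cmult: "f \<in> L2_space D \<Longrightarrow> (\<lambda>x. c * f x) \<in> L2_space D" for f :: "'a::euclidean_space \<Rightarrow> real"
  using L2_space_scaleR[of f D c] by simp

lemma L2_space_diff:
  "f \<in> L2_space D \<Longrightarrow> g \<in> L2_space D \<Longrightarrow> (\<lambda>x. f x - g x) \<in> L2_space D"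
  using L2_space_add[of f D "\<lambda>x. (-1) *\<^sub>R g x"] L2_space_scaleR[of g D "-1"] by simp

lemma L2_space_sum:
  "(\<And>i. i \<in> I \<Longrightarrow> f i \<in> L2_space D) \<Longrightarrow> (\<lambda>x. \<Sum>i\<in>I. f i x) \<in> L2_space D"
  by (induction I rule: infinite_finite_induct) (auto intro: L2_space_add L2_space_zero)

lemma L2_space_inner_left:
  assumes "f \<in> L2_space D" 
  shows "(\<lambda>x. f x \<bullet> b) \<in> L2_space D"
proof (rule L2_space_boundI)
  show "(\<lambda>x. f x \<bullet> b) \<in> borel_measurable (lebesgue_on D)"
    using L2_spaceD(1)[OF assms(1)] by measurable
  show "integrable (lebesgue_on D) (\<lambda>x. (norm b)\<^sup>2 * (norm (f x))\<^sup>2)"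
    using L2_spaceD(2)[OF assms(1)] by auto
  have "(norm (f x \<bullet> b))\<^sup>2 \<le> (norm (f x) * norm b)\<^sup>2" for x
    by (intro power_mono) (auto simp: Cauchy_Schwarz_ineq2)
  then show "AE x in lebesgue_on D. (norm (f x \<bullet> b))\<^sup>2 \<le> (norm b)\<^sup>2 * (norm (f x))\<^sup>2"
    by (simp add: power_mult_distrib mult.commute)
qed

lemma L2_space_componentwise:
  fixes f :: "'a::euclidean_space \<Rightarrow> 'b::euclidean_space"
  assumes "\<And>b. b \<in> Basis \<Longrightarrow> (\<lambda>x. f x \<bullet> b) \<in> L2_space D"
  shows "f \<in> L2_space D"
proof -
  have "(\<lambda>x. (f x \<bullet> b) *\<^sub>R b) \<in> L2_space D" if "b \<in> Basis" for b
  proof (rule L2_space_boundI)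
    show "(\<lambda>x. (f x \<bullet> b) *\<^sub>R b) \<in> borel_measurable (lebesgue_on D)"
      using L2_spaceD(1)[OF assms[OF that]] by measurable
    show "integrable (lebesgue_on D) (\<lambda>x. (norm (f x \<bullet> b))\<^sup>2)"
      using L2_spaceD(2)[OF assms[OF that]] .
  qed (use that in simp)
  then have "(\<lambda>x. \<Sum>b\<in>Basis. (f x \<bullet> b) *\<^sub>R b) \<in> L2_space D"
    by (rule L2_space_sum)
  then show ?thesis by (simp add: euclidean_representation)
qed

lemma L2_space_bounded_mult:
  fixes f g :: "'a::euclidean_space \<Rightarrow> real"
  assumes f: "f \<in> L2_space D" and g: "g \<in> borel_measurable (lebesgue_on D)"
    and M: "AE x in lebesgue_on D. \<bar>g x\<bar> \<le> M"
  shows "(\<lambda>x. g x * f x) \<in> L2_space D"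
proof (rule L2_space_boundI)
  show "(\<lambda>x. g x * f x) \<in> borel_measurable (lebesgue_on D)"
    using L2_spaceD(1)[OF f] g by measurable
  show "integrable (lebesgue_on D) (\<lambda>x. M\<^sup>2 * (norm (f x))\<^sup>2)"
    using L2_spaceD(2)[OF f] by auto
  show "AE x in lebesgue_on D. (norm (g x * f x))\<^sup>2 \<le> M\<^sup>2 * (norm (f x))\<^sup>2"
    using M
  proof eventually_elim
    case (elim x)
    then have "\<bar>g x\<bar>\<^sup>2 \<le> M\<^sup>2" by (intro power_mono) auto
    then show ?case by (simp add: power_mult_distrib mult_right_mono)
  qed
qed

lemma L2_inner_integrable:
  assumes "f \<in> L2_space D" "g \<in> L2_space D"
  shows "integrable (lebesgue_on D) (\<lambda>x. f x \<bullet> g x)"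
proof (rule Bochner_Integration.integrable_bound)
  show "integrable (lebesgue_on D) (\<lambda>x. (norm (f x))\<^sup>2 + (norm (g x))\<^sup>2)"
    using L2_spaceD(2)[OF assms(1)] L2_spaceD(2)[OF assms(2)] by auto
  show "(\<lambda>x. f x \<bullet> g x) \<in> borel_measurable (lebesgue_on D)"
    using L2_spaceD(1)[OF assms(1)] L2_spaceD(1)[OF assms(2)] by measurable
  have "\<bar>f x \<bullet> g x\<bar> \<le> (norm (f x))\<^sup>2 + (norm (g x))\<^sup>2" for x
  proof -
    have "\<bar>f x \<bullet> g x\<bar> \<le> norm (f x) * norm (g x)" by (rule Cauchy_Schwarz_ineq2)
    also have "\<dots> \<le> (norm (f x))\<^sup>2 + (norm (g x))\<^sup>2"
      using sum_squares_bound[of "norm (f x)" "norm (g x)"] mult_nonneg_nonneg[OF norm_ge_zero[of "f x"] norm_ge_zero[of "g x"]]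
      by linarith
    finally show ?thesis .
  qed
  then show "AE x in lebesgue_on D. norm (f x \<bullet> g x) \<le> norm ((norm (f x))\<^sup>2 + (norm (g x))\<^sup>2)"
    by simp
qed

lemma L2_mult_integrable:
  fixes f g :: "'a::euclidean_space \<Rightarrow> real"
  shows "f \<in> L2_space D \<Longrightarrow> g \<in> L2_space D \<Longrightarrow> integrable (lebesgue_on D) (\<lambda>x. f x * g x)"
  using L2_inner_integrable[of f D g] by simp

text \<open>Young's inequality with a free weight c, used in place of Cauchy-Schwarz so that no
  square roots of integrals occur. In the limit argument c is taken large first, which makes the
  term with h small.\<close>

lemma L2_inner_diff_bound:
  fixes f g h :: "'a::euclidean_space \<Rightarrow> real"
  assumes "f \<in> L2_space D" "g \<in> L2_space D" "h \<in> L2_space D" "c > 0"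
  shows "\<bar>(LINT x|lebesgue_on D. f x * h x) - (LINT x|lebesgue_on D. g x * h x)\<bar>
    \<le> c * (LINT x|lebesgue_on D. (f x - g x)\<^sup>2) + (LINT x|lebesgue_on D. (h x)\<^sup>2) / c"
proof -
  have d: "(\<lambda>x. f x - g x) \<in> L2_space D" using assms by (intro L2_space_diff)
  note i = L2_mult_integrable[OF d assms(3)]
  have i2: "integrable (lebesgue_on D) (\<lambda>x. (f x - g x)\<^sup>2)" "integrable (lebesgue_on D) (\<lambda>x. (h x)\<^sup>2)"
    using L2_spaceD(2)[OF d] L2_spaceD(2)[OF assms(3)] by simp_all
  have "(LINT x|lebesgue_on D. f x * h x) - (LINT x|lebesgue_on D. g x * h x)
    = (LINT x|lebesgue_on D. (f x - g x) * h x)"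
    by (subst Bochner_Integration.integral_diff[symmetric]) (auto intro!: L2_mult_integrable assms simp: algebra_simps)
  also have "\<bar>\<dots>\<bar> \<le> (LINT x|lebesgue_on D. \<bar>(f x - g x) * h x\<bar>)"
    by (rule integral_abs_bound)
  also have "\<dots> \<le> (LINT x|lebesgue_on D. c * (f x - g x)\<^sup>2 + (h x)\<^sup>2 / c)"
  proof (rule integral_mono)
    show "integrable (lebesgue_on D) (\<lambda>x. \<bar>(f x - g x) * h x\<bar>)" using i by simp
    show "integrable (lebesgue_on D) (\<lambda>x. c * (f x - g x)\<^sup>2 + (h x)\<^sup>2 / c)" using i2 by auto
    fix x 
    define a b where "a = \<bar>f x - g x\<bar>" and "b = \<bar>h x\<bar>"
    have "2 * (c * a) * b \<le> (c * a)\<^sup>2 + b\<^sup>2"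
      using sum_squares_bound by blast
    moreover have "0 \<le> (c * a) * b" using assms(4) by (simp add: a_def b_def)
    ultimately have "c * (a * b) \<le> c * (c * a\<^sup>2 + b\<^sup>2 / c)"
      using assms(4) by (simp add: algebra_simps power2_eq_square)
    then have "a * b \<le> c * a\<^sup>2 + b\<^sup>2 / c"
      using assms(4) by (simp only: mult_le_cancel_left_pos)
    then show "\<bar>(f x - g x) * h x\<bar> \<le> c * (f x - g x)\<^sup>2 + (h x)\<^sup>2 / c"
      by (simp add: a_def b_def abs_mult)
  qed
  also have "\<dots> = c * (LINT x|lebesgue_on D. (f x - g x)\<^sup>2) + (LINT x|lebesgue_on D. (h x)\<^sup>2) / c"
    using i2 by simp
  finally show ?thesis .
qed

lemma L2_inner_tendsto:
  fixes f :: "nat \<Rightarrow> 'a::euclidean_space \<Rightarrow> real"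
  assumes f: "\<And>j. f j \<in> L2_space D" and g: "g \<in> L2_space D" and h: "h \<in> L2_space D"
    and lim: "(\<lambda>j. LINT x|lebesgue_on D. (f j x - g x)\<^sup>2) \<longlonglongrightarrow> 0"
  shows "(\<lambda>j. LINT x|lebesgue_on D. f j x * h x) \<longlonglongrightarrow> (LINT x|lebesgue_on D. g x * h x)"
proof (rule LIMSEQ_I)
  fix e :: real assume e: "e > 0"
  define H where "H = (LINT x|lebesgue_on D. (h x)\<^sup>2)"
  have H: "H \<ge> 0" by (simp add: H_def)
  \<comment> \<open>The summand 1 keeps c positive when H = 0 and makes \<open>H / c < e / 2\<close>
    strict.\<close>
  define c where "c = (2 * H + 1) / e"
  have c: "c > 0" using H e by (simp add: c_def)
  have Hc: "H / c < e / 2"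
    using H e by (simp add: c_def field_simps)
  have "\<forall>\<^sub>F j in sequentially. (LINT x|lebesgue_on D. (f j x - g x)\<^sup>2) < e / (2 * c)"
    using order_tendstoD(2)[OF lim, of "e / (2 * c)"] e c by simp
  then show "\<exists>no. \<forall>n\<ge>no. norm ((LINT x|lebesgue_on D. f n x * h x) - (LINT x|lebesgue_on D. g x * h x)) < e"
    unfolding eventually_sequentially
  proof (rule ex_forward, intro allI impI)
    fix N n assume "\<forall>n\<ge>N. (LINT x|lebesgue_on D. (f n x - g x)\<^sup>2) < e / (2 * c)" "N \<le> n"
    then have "c * (LINT x|lebesgue_on D. (f n x - g x)\<^sup>2) < e / 2"
      using c by (simp add: field_simps)
    then show "norm ((LINT x|lebesgue_on D. f n x * h x) - (LINT x|lebesgue_on D. g x * h x)) < e"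
      using L2_inner_diff_bound[OF f[of n] g h c] Hc unfolding H_def real_norm_def by linarith
  qed
qed

section \<open>Measurability, restriction to subsets, localisation of null sets\<close>

lemma continuous_measurable_lebesgue_on:
  fixes f :: "'a::euclidean_space \<Rightarrow> 'b::euclidean_space"
  assumes "continuous_on UNIV f"
  shows "f \<in> borel_measurable (lebesgue_on D)"
  using borel_measurable_continuous_onI[OF assms]
  by (simp add: measurable_completion measurable_restrict_space1)

lemma measurable_lborel_lebesgue_on:
  "f \<in> borel_measurable borel \<Longrightarrow> f \<in> borel_measurable (lebesgue_on D)"
  by (simp add: measurable_completion measurable_restrict_space1)

lemma L2_space_continuous_support:
  fixes f :: "'a::euclidean_space \<Rightarrow> 'b::euclidean_space"
  assumes "continuous_on UNIV f" "bounded B" "\<And>x. x \<notin> B \<Longrightarrow> f x = 0" "D \<in> sets lebesgue"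
  shows "f \<in> L2_space D"
proof -
  have K: "compact (closure B)" using assms(2) by (simp add: compact_closure)
  then have "compact (f ` closure B)"
    using assms(1) by (intro compact_continuous_image) (auto intro: continuous_on_subset)
  then obtain M where M: "\<forall>y\<in>f ` closure B. norm y \<le> M"
    using compact_imp_bounded bounded_iff by metis
  show ?thesis
  proof (rule L2_space_boundI)
    show "f \<in> borel_measurable (lebesgue_on D)"
      by (rule continuous_measurable_lebesgue_on[OF assms(1)])
    have "closure B \<in> lmeasurable" using K by (rule lmeasurable_compact)
    then have "integrable lebesgue (\<lambda>x. indicator (closure B) x * M\<^sup>2)"
      by (intro integrable_mult_left) (simp add: lmeasurable_iff_integrable)
    then have "integrable lebesgue (\<lambda>x. indicator D x *\<^sub>R (indicator (closure B) x * M\<^sup>2))"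
      using assms(4) by (intro integrable_mult_indicator)
    moreover have "D \<inter> space lebesgue \<in> sets lebesgue" using assms(4) by simp
    ultimately show "integrable (lebesgue_on D) (\<lambda>x. indicator (closure B) x * M\<^sup>2)"
      by (simp only: integrable_restrict_space)
    have "(norm (f x))\<^sup>2 \<le> indicator (closure B) x * M\<^sup>2" for x
    proof (cases "x \<in> closure B")
      case True
      then have "norm (f x) \<le> M" using M by auto
      then show ?thesis using True by (simp add: power_mono)
    next
      case False
      then have "f x = 0" using assms(3) closure_subset by blast
      then show ?thesis by simp
    qed
    then show "AE x in lebesgue_on D. (norm (f x))\<^sup>2 \<le> indicator (closure B) x * M\<^sup>2" by simp
  qed
qed

lemma test_functions_L2:
  assumes "\<phi> \<in> test_functions E" "D \<in> sets lebesgue"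
  shows "\<phi> \<in> L2_space D"
proof -
  obtain K where K: "smooth \<phi>" "compact K" "K \<subseteq> E" "\<And>x. x \<notin> K \<Longrightarrow> \<phi> x = 0"
    using test_functionsE[OF assms(1)] by metis
  then show ?thesis
    by (intro L2_space_continuous_support[where B=K] assms smooth_continuous) (auto simp: compact_imp_bounded)
qed

lemma LINT_lebesgue_on_eq_indicator:
  fixes f :: "'a::euclidean_space \<Rightarrow> real"
  shows "D \<in> sets lebesgue \<Longrightarrow> (LINT x|lebesgue_on D. f x) = (LINT x|lebesgue. indicator D x * f x)"
  by (subst integral_restrict_space) auto

lemma LINT_lebesgue_on_subset:
  fixes f :: "'a::euclidean_space \<Rightarrow> real"
  assumes "D \<in> sets lebesgue" "E \<in> sets lebesgue" "E \<subseteq> D" "\<And>x. x \<in> D - E \<Longrightarrow> f x = 0"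
  shows "(LINT x|lebesgue_on E. f x) = (LINT x|lebesgue_on D. f x)"
proof -
  have "(LINT x|lebesgue. indicator E x * f x) = (LINT x|lebesgue. indicator D x * f x)"
    by (rule Bochner_Integration.integral_cong) (use assms in \<open>auto simp: indicator_def\<close>)
  then show ?thesis using assms by (simp add: LINT_lebesgue_on_eq_indicator)
qed

text \<open>By Lindelof countably many of the given neighbourhoods cover D, so the exceptional set
  is a countable union of null sets. This reduces later statements to balls, where the measure is
  finite.\<close>

lemma AE_lebesgue_on_local:
  fixes D :: "'a::euclidean_space set"
  assumes "open D" "\<And>x. x \<in> D \<Longrightarrow> \<exists>N. open N \<and> x \<in> N \<and> (AE y in lebesgue_on N. P y)"
  shows "AE y in lebesgue_on D. P y"
proof -
  define F where "F = {N. open N \<and> (AE y in lebesgue_on N. P y)}"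
  obtain F' where F': "F' \<subseteq> F" "countable F'" "\<Union>F' = \<Union>F"
    using Lindelof[of F] unfolding F_def by auto
  have "AE y in lebesgue. \<forall>N\<in>F'. y \<in> N \<longrightarrow> P y"
  proof (subst AE_ball_countable[OF F'(2)], intro ballI)
    fix N assume "N \<in> F'"
    then have "open N" "AE y in lebesgue_on N. P y" using F'(1) by (auto simp: F_def)
    then show "AE y in lebesgue. y \<in> N \<longrightarrow> P y"
      by (subst (asm) AE_restrict_space_iff) auto
  qed
  moreover have "D \<subseteq> \<Union>F'" using assms(2) F'(3) unfolding F_def by blast
  ultimately have "AE y in lebesgue. y \<in> D \<longrightarrow> P y"
    by (auto elim!: eventually_mono)
  then show ?thesis using assms(1) by (subst AE_restrict_space_iff) auto
qed

lemma L2_space_integrable: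
  fixes f :: "'a::euclidean_space \<Rightarrow> real"
  assumes "f \<in> L2_space D" "D \<in> lmeasurable"
  shows "integrable (lebesgue_on D) f"
proof -
  interpret finite_measure "lebesgue_on D"
    by (rule finite_measure_lebesgue_on[OF assms(2)])
  have "(\<lambda>x. 1) \<in> L2_space D" by (simp add: L2_space_def)
  from L2_mult_integrable[OF assms(1) this] show ?thesis by simp
qed

lemma L2_space_subset:
  assumes "f \<in> L2_space D" "E \<subseteq> D" "E \<in> sets lebesgue" "D \<in> sets lebesgue"
  shows "f \<in> L2_space E"
proof -
  have E: "lebesgue_on E = restrict_space (lebesgue_on D) E"
    using assms by (simp add: restrict_restrict_space inf.absorb2)
  have E': "E \<inter> space (lebesgue_on D) \<in> sets (lebesgue_on D)"
    using assms by (auto simp: sets_restrict_space)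
  show ?thesis unfolding L2_space_def
  proof (intro CollectI conjI)
    show "f \<in> borel_measurable (lebesgue_on E)"
      unfolding E by (rule measurable_restrict_space1[OF L2_spaceD(1)[OF assms(1)]])
    show "integrable (lebesgue_on E) (\<lambda>x. (norm (f x))\<^sup>2)"
      unfolding E integrable_restrict_space[OF E']
      by (intro integrable_mult_indicator L2_spaceD(2)[OF assms(1)]) (use E' assms in \<open>simp add: inf.absorb1\<close>)
  qed
qed

section \<open>Approximation of open sets by test functions\<close>

text \<open>Outside the ball the argument is non-positive and the function is 0. Inside, the factor
  \<open>Suc n\<close> drives the argument to infinity, where \<open>flat_exp 0\<close> tends to 1;
  so the bumps converge pointwise to the indicator of the open ball.\<close>

definition ball_bump :: "'a::euclidean_space \<Rightarrow> real \<Rightarrow> nat \<Rightarrow> 'a \<Rightarrow> real" where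
  "ball_bump c r n x = flat_exp 0 (real (Suc n) * (r\<^sup>2 - (x - c) \<bullet> (x - c)))"

lemma smooth_inner_self: "smooth (\<lambda>x. (x - c) \<bullet> (x - c))" for c :: "'a::euclidean_space"
proof -
  have "smooth (\<lambda>x. (x - c) \<bullet> b)" if "b \<in> Basis" for b :: 'a
    unfolding inner_diff_left by (intro smooth_diff smooth_const smooth_linear bounded_linear_inner_left)
  then have "smooth (\<lambda>x. \<Sum>b\<in>Basis. ((x - c) \<bullet> b) * ((x - c) \<bullet> b))"
    by (intro smooth_sum smooth_mult)
  then show ?thesis by (subst euclidean_inner)
qed

lemma smooth_ball_bump: "smooth (ball_bump c r n)"
  unfolding ball_bump_def[abs_def]
  by (rule smooth_compose_real[OF smooth_flat_exp])
     (intro smooth_mult smooth_diff smooth_const smooth_inner_self)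

lemma ball_bump_range: "0 \<le> ball_bump c r n x" "ball_bump c r n x \<le> 1"
  by (auto simp: ball_bump_def flat_exp_def)

lemma ball_bump_outside: 
  assumes "r \<ge> 0" "x \<notin> ball c r" shows "ball_bump c r n x = 0"
proof -
  have "r \<le> norm (x - c)" using assms by (simp add: dist_norm norm_minus_commute)
  then have "r\<^sup>2 \<le> (x - c) \<bullet> (x - c)"
    using assms(1) by (simp add: power_mono power2_norm_eq_inner[symmetric])
  then have "\<not> real (Suc n) * (r\<^sup>2 - (x - c) \<bullet> (x - c)) > 0"
    by (simp add: zero_less_mult_iff)
  then show ?thesis unfolding ball_bump_def flat_exp_def by presburger
qed

lemma ball_bump_tendsto_1:
  assumes "x \<in> ball c r" shows "(\<lambda>n. ball_bump c r n x) \<longlonglongrightarrow> 1"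
proof -
  define a where "a = r\<^sup>2 - (x - c) \<bullet> (x - c)"
  have "norm (x - c) < r" using assms by (simp add: dist_norm norm_minus_commute)
  then have "(x - c) \<bullet> (x - c) < r\<^sup>2"
    by (simp add: power_strict_mono power2_norm_eq_inner[symmetric])
  then have a: "a > 0" by (simp add: a_def)
  have "(\<lambda>n. exp (- (1 / a) * inverse (real (Suc n)))) \<longlonglongrightarrow> exp (- (1 / a) * 0)"
    by (intro tendsto_intros LIMSEQ_inverse_real_of_nat)
  moreover have "ball_bump c r n x = exp (- (1 / a) * inverse (real (Suc n)))" for n
  proof -
    have "real (Suc n) * a > 0" using a by simp
    then show ?thesis unfolding ball_bump_def flat_exp_def a_def[symmetric] by (simp add: field_simps)
  qed
  ultimately show ?thesis by simp
qed

text \<open>G is a countable union of balls whose closures lie in G. The n-th function combines the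
  n-th bumps of the first n balls; its support lies in finitely many closed balls and is therefore
  compact in G.\<close>

lemma open_indicator_approx:
  fixes G :: "'a::euclidean_space set"
  assumes "open G"
  obtains \<phi> :: "nat \<Rightarrow> 'a \<Rightarrow> real" where "\<And>n. \<phi> n \<in> test_functions G"
    "\<And>n x. 0 \<le> \<phi> n x" "\<And>n x. \<phi> n x \<le> 1" "\<And>x. (\<lambda>n. \<phi> n x) \<longlonglongrightarrow> indicator G x"
proof -
  \<comment> \<open>The closed balls, not only the open ones, have to lie in G, because they will
    contain the supports.\<close>
  define B where "B = (\<lambda>p. ball (fst p) (snd p) :: 'a set) ` {p. snd p \<ge> 0 \<and> cball (fst p) (snd p) \<subseteq> G}"
  obtain B' where B': "B' \<subseteq> B" "countable B'" "\<Union>B' = \<Union>B"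
    using Lindelof[of B] unfolding B_def by auto
  have UB: "\<Union>B = G"
  proof
    show "\<Union>B \<subseteq> G" unfolding B_def using ball_subset_cball by fastforce
    show "G \<subseteq> \<Union>B"
    proof
      fix x assume "x \<in> G"
      then obtain e where "e > 0" "cball x e \<subseteq> G" using assms open_contains_cball by blast
      then show "x \<in> \<Union>B" unfolding B_def by (intro UnionI[of "ball x e"]) (auto intro!: image_eqI[of _ _ "(x, e)"])
    qed
  qed
  show thesis
  proof (cases "G = {}")
    case True
    then show thesis
      by (intro that[of "\<lambda>n x. 0"]) (auto intro: test_functions_zero)
  next
    case False
    then have "B' \<noteq> {}" using B'(3) UB by auto
    define E where "E = from_nat_into B'"
    have "E i \<in> B" for i using from_nat_into[OF \<open>B' \<noteq> {}\<close>] B'(1) by (auto simp: E_def)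
    then have "\<forall>i. \<exists>p. E i = ball (fst p) (snd p) \<and> snd p \<ge> 0 \<and> cball (fst p) (snd p) \<subseteq> G"
      unfolding B_def by blast
    then obtain p where p: "\<And>i. E i = ball (fst (p i)) (snd (p i))" "\<And>i. snd (p i) \<ge> 0"
      "\<And>i. cball (fst (p i)) (snd (p i)) \<subseteq> G" by metis
    have UE: "(\<Union>i. E i) = G"
      using range_from_nat_into[OF \<open>B' \<noteq> {}\<close> B'(2)] B'(3) UB by (simp add: E_def)
    define b where "b i n = ball_bump (fst (p i)) (snd (p i)) n" for i n
    \<comment> \<open>A smooth substitute for the maximum of the bumps: it stays in [0,1] and
      dominates each of its factors \<open>b i n\<close>.\<close>
    define \<phi> where "\<phi> n x = 1 - (\<Prod>i<n. 1 - b i n x)" for n x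
    have b01: "0 \<le> 1 - b i n x" "1 - b i n x \<le> 1" for i n x
      using ball_bump_range by (auto simp: b_def)
    show thesis
    proof (rule that[of \<phi>])
      fix n x
      show "0 \<le> \<phi> n x" unfolding \<phi>_def using b01 by (simp add: prod_le_1)
      show "\<phi> n x \<le> 1" unfolding \<phi>_def using b01 by (simp add: prod_nonneg)
      show "\<phi> n \<in> test_functions G"
      proof (rule test_functionsI)
        show "smooth (\<phi> n)" unfolding \<phi>_def[abs_def] b_def
          by (intro smooth_diff smooth_prod smooth_const smooth_ball_bump)
        show "compact (\<Union>i<n. cball (fst (p i)) (snd (p i)))" by (intro compact_UN) auto
        show "(\<Union>i<n. cball (fst (p i)) (snd (p i))) \<subseteq> G" using p(3) by blast
        fix x assume "x \<notin> (\<Union>i<n. cball (fst (p i)) (snd (p i)))"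
        then have "b i n x = 0" if "i < n" for i
        proof -
          have "x \<notin> cball (fst (p i)) (snd (p i))"
            using that \<open>x \<notin> (\<Union>i<n. cball (fst (p i)) (snd (p i)))\<close> by blast
          then show ?thesis
            unfolding b_def using p(2) ball_subset_cball by (intro ball_bump_outside) blast+
        qed
        then show "\<phi> n x = 0" by (simp add: \<phi>_def)
      qed
    next
      fix x
      show "(\<lambda>n. \<phi> n x) \<longlonglongrightarrow> indicator G x"
      proof (cases "x \<in> G")
        case True
        then obtain i where "x \<in> E i" using UE by blast
        then have "(\<lambda>n. b i n x) \<longlonglongrightarrow> 1" unfolding b_def p(1) by (rule ball_bump_tendsto_1)
        moreover have "\<forall>\<^sub>F n in sequentially. b i n x \<le> \<phi> n x"
          using eventually_gt_at_top[of i]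
        proof eventually_elim
          case (elim n)
          have "(\<Prod>i<n. 1 - b i n x) = (1 - b i n x) * (\<Prod>i\<in>{..<n} - {i}. 1 - b i n x)"
            using elim by (subst prod.remove[of _ i]) auto
          also have "\<dots> \<le> (1 - b i n x) * 1"
            using b01 by (intro mult_left_mono prod_le_1) auto
          finally show ?case by (simp add: \<phi>_def)
        qed
        moreover have "\<phi> n x \<le> 1" for n unfolding \<phi>_def using b01 by (simp add: prod_nonneg)
        ultimately have "(\<lambda>n. \<phi> n x) \<longlonglongrightarrow> 1"
          by (rule_tac tendsto_sandwich[where f="\<lambda>n. b i n x" and h="\<lambda>_. 1"]) (simp_all add: eventually_sequentially)
        then show ?thesis using True by simp
      next
        case False
        then have "b i n x = 0" for i n
          unfolding b_def using p(2,3) ball_subset_cball by (intro ball_bump_outside) blast+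
        then show ?thesis using False by (simp add: \<phi>_def)
      qed
    qed
  qed
qed

text \<open>Let S be the set where v > C. The inequality extends by dominated convergence from test
  functions to indicators of open sets, then to countable intersections of open sets, and hence to
  S. As C - v is negative on S, its integral over S can be non-negative only if S is a null
  set.\<close>

lemma AE_le_of_test_functions:
  fixes v :: "'a::euclidean_space \<Rightarrow> real"
  assumes D: "open D" "D \<in> lmeasurable" and v: "integrable (lebesgue_on D) v"
    and le: "\<And>\<phi>. \<phi> \<in> test_functions D \<Longrightarrow> (\<And>x. 0 \<le> \<phi> x) \<Longrightarrow>
      (LINT x|lebesgue_on D. v x * \<phi> x) \<le> C * (LINT x|lebesgue_on D. \<phi> x)"
  shows "AE x in lebesgue_on D. v x \<le> C"
proof -
  interpret finite_measure "lebesgue_on D"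
    by (rule finite_measure_lebesgue_on[OF D(2)])
  have D': "D \<in> sets lebesgue" using D by auto
  define f where "f x = C - v x" for x
  have f: "integrable (lebesgue_on D) f" unfolding f_def[abs_def] using v by simp
  then have fm[measurable]: "f \<in> borel_measurable (lebesgue_on D)" by auto
  have meas: "h \<in> borel_measurable borel \<Longrightarrow> h \<in> borel_measurable (lebesgue_on D)" for h :: "'a \<Rightarrow> real"
    by (rule measurable_lborel_lebesgue_on)
  \<comment> \<open>Test functions approximating the indicator of \<open>G \<inter> D\<close> are
    inserted; \<open>\<bar>f x\<bar>\<close> is the majorant.\<close>
  have open_nonneg: "0 \<le> (LINT x|lebesgue_on D. indicator G x * f x)" if "open G" for G
  proof -
    have "open (G \<inter> D)" using that D by auto
    then obtain \<phi> where \<phi>: "\<And>n. \<phi> n \<in> test_functions (G \<inter> D)"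
      "\<And>n x. 0 \<le> \<phi> n x" "\<And>n x. \<phi> n x \<le> 1" "\<And>x. (\<lambda>n. \<phi> n x) \<longlonglongrightarrow> indicator (G \<inter> D) x"
      using open_indicator_approx by blast
    have \<phi>b: "\<phi> n \<in> borel_measurable borel" for n
      using \<phi>(1)[of n] by (intro borel_measurable_continuous_onI smooth_continuous) (rule test_functions_smooth)
    have "(\<lambda>n. LINT x|lebesgue_on D. \<phi> n x * f x) \<longlonglongrightarrow> (LINT x|lebesgue_on D. indicator (G \<inter> D) x * f x)"
    proof (rule integral_dominated_convergence[where w="\<lambda>x. \<bar>f x\<bar>"])
      show "(\<lambda>x. indicator (G \<inter> D) x * f x) \<in> borel_measurable (lebesgue_on D)"
        by (rule borel_measurable_times[OF meas[OF borel_measurable_indicator] fm]) (use \<open>open (G \<inter> D)\<close> in simp)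
      show "(\<lambda>x. \<phi> n x * f x) \<in> borel_measurable (lebesgue_on D)" for n
        by (rule borel_measurable_times[OF meas[OF \<phi>b] fm])
      show "integrable (lebesgue_on D) (\<lambda>x. \<bar>f x\<bar>)" using f by simp
      show "AE x in lebesgue_on D. (\<lambda>n. \<phi> n x * f x) \<longlonglongrightarrow> indicator (G \<inter> D) x * f x"
        by (intro AE_I2 tendsto_mult \<phi>(4) tendsto_const)
      show "AE x in lebesgue_on D. norm (\<phi> n x * f x) \<le> \<bar>f x\<bar>" for n
        using \<phi>(2,3)[of n] by (intro AE_I2) (auto simp: abs_mult intro!: mult_left_le_one_le)
    qed
    moreover have "0 \<le> (LINT x|lebesgue_on D. \<phi> n x * f x)" for n
    proof -
      have t: "\<phi> n \<in> test_functions D" using \<phi>(1) test_functions_mono[of "G \<inter> D" D] by blast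
      have i: "integrable (lebesgue_on D) (\<phi> n)"
        by (intro L2_space_integrable test_functions_L2[OF t] D D')
      have i2: "integrable (lebesgue_on D) (\<lambda>x. v x * \<phi> n x)"
      proof (rule Bochner_Integration.integrable_bound)
        show "integrable (lebesgue_on D) (\<lambda>x. \<bar>v x\<bar>)" using v by simp
        show "(\<lambda>x. v x * \<phi> n x) \<in> borel_measurable (lebesgue_on D)"
          using meas[OF \<phi>b[of n]] v by measurable
        show "AE x in lebesgue_on D. norm (v x * \<phi> n x) \<le> norm \<bar>v x\<bar>"
          using \<phi>(2,3)[of n] by (intro AE_I2) (auto simp: abs_mult intro!: mult_right_le_one_le)
      qed
      have "(LINT x|lebesgue_on D. \<phi> n x * f x) = (LINT x|lebesgue_on D. C * \<phi> n x - v x * \<phi> n x)"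
        by (simp add: f_def algebra_simps)
      also have "\<dots> = C * (LINT x|lebesgue_on D. \<phi> n x) - (LINT x|lebesgue_on D. v x * \<phi> n x)"
        using i i2 by simp
      finally show ?thesis using le[OF t \<phi>(2)] by simp
    qed
    ultimately have "0 \<le> (LINT x|lebesgue_on D. indicator (G \<inter> D) x * f x)"
      by (auto intro: LIMSEQ_le_const)
    also have "\<dots> = (LINT x|lebesgue_on D. indicator G x * f x)"
      by (rule Bochner_Integration.integral_cong) (auto simp: indicator_def)
    finally show ?thesis .
  qed
  define S where "S = {x \<in> D. f x < 0}"
  have "{x \<in> space (lebesgue_on D). f x < 0} \<in> sets (lebesgue_on D)" by measurable
  then have S: "S \<in> sets lebesgue"
    using D' by (auto simp: S_def sets_restrict_space_iff)
  obtain C' T where CT: "gdelta C'" "T \<in> null_sets lebesgue" "S \<union> T = C'" "disjnt S T"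
    \<comment> \<open>Up to the null set T, S is a countable intersection of open sets. The finite
      intersections \<open>G n\<close> below are still open and decrease to it.\<close>
    using lebesgue_set_almost_gdelta[OF S] by metis
  obtain F :: "nat \<Rightarrow> 'a set" where F: "C' = \<Inter>(range F)" "\<And>n. open (F n)"
    using CT(1) by (auto elim: gdelta.cases)
  define G where "G n = (\<Inter>i\<le>n. F i)" for n
  have G: "open (G n)" for n unfolding G_def using F(2) by auto
  have limG: "(\<lambda>n. indicator (G n) x :: real) \<longlonglongrightarrow> indicator C' x" for x
  proof (rule tendsto_eventually)
    show "\<forall>\<^sub>F n in sequentially. (indicator (G n) x :: real) = indicator C' x"
    proof (cases "x \<in> C'")
      case True
      then show ?thesis by (auto simp: F(1) G_def)
    next
      case False
      then obtain m where "x \<notin> F m" using F(1) by auto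
      then show ?thesis using False
        by (intro eventually_mono[OF eventually_ge_at_top[of m]]) (auto simp: G_def indicator_def)
    qed
  qed
  have Cb: "C' \<in> sets borel" unfolding F(1) using F(2) by (intro sets.countable_INT) auto
  have "(\<lambda>n. LINT x|lebesgue_on D. indicator (G n) x * f x) \<longlonglongrightarrow> (LINT x|lebesgue_on D. indicator C' x * f x)"
  proof (rule integral_dominated_convergence[where w="\<lambda>x. \<bar>f x\<bar>"])
    show "(\<lambda>x. indicator C' x * f x) \<in> borel_measurable (lebesgue_on D)"
      by (rule borel_measurable_times[OF meas[OF borel_measurable_indicator] fm]) (use Cb in simp)
    show "(\<lambda>x. indicator (G n) x * f x) \<in> borel_measurable (lebesgue_on D)" for n
      by (rule borel_measurable_times[OF meas[OF borel_measurable_indicator] fm]) (use G[of n] in simp)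
    show "integrable (lebesgue_on D) (\<lambda>x. \<bar>f x\<bar>)" using f by simp
    show "AE x in lebesgue_on D. (\<lambda>n. indicator (G n) x * f x) \<longlonglongrightarrow> indicator C' x * f x"
      by (intro AE_I2 tendsto_mult limG tendsto_const)
    show "AE x in lebesgue_on D. norm (indicator (G n) x * f x) \<le> \<bar>f x\<bar>" for n
      by (intro AE_I2) (auto simp: indicator_def)
  qed
  then have "0 \<le> (LINT x|lebesgue_on D. indicator C' x * f x)"
    using open_nonneg[OF G] by (intro LIMSEQ_le_const) auto
  moreover have "AE x in lebesgue_on D. x \<notin> T"
    using AE_not_in[OF CT(2)] D' by (subst AE_restrict_space_iff) auto
  then have eq: "AE x in lebesgue_on D. indicator C' x * f x = indicator S x * f x"
    by eventually_elim (use CT(3) in \<open>auto simp: indicator_def\<close>)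
  moreover have Sm[measurable]: "S \<in> sets (lebesgue_on D)"
    using S D' by (auto simp: sets_restrict_space_iff S_def)
  have iS: "integrable (lebesgue_on D) (\<lambda>x. - (indicator S x * f x))"
    using integrable_mult_indicator[OF Sm f] by simp
  have "(LINT x|lebesgue_on D. indicator C' x * f x) = (LINT x|lebesgue_on D. indicator S x * f x)"
  proof (rule integral_cong_AE[OF _ _ eq])
    show "(\<lambda>x. indicator C' x * f x) \<in> borel_measurable (lebesgue_on D)"
      by (rule borel_measurable_times[OF meas[OF borel_measurable_indicator] fm]) (use Cb in simp)
    show "(\<lambda>x. indicator S x * f x) \<in> borel_measurable (lebesgue_on D)"
      by (intro borel_measurable_times borel_measurable_indicator Sm fm)
  qed
  ultimately have "0 \<le> (LINT x|lebesgue_on D. indicator S x * f x)" by simp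
  moreover have nn: "- (indicator S x * f x) \<ge> 0" for x
    by (auto simp: indicator_def S_def)
  then have "0 \<le> (LINT x|lebesgue_on D. - (indicator S x * f x))" by (intro Bochner_Integration.integral_nonneg) auto
  ultimately have "(LINT x|lebesgue_on D. - (indicator S x * f x)) = 0" by simp
  then have "AE x in lebesgue_on D. - (indicator S x * f x) = 0"
    using integral_nonneg_eq_0_iff_AE[OF iS] nn by simp
  then show ?thesis
    using AE_space by eventually_elim (auto simp: indicator_def S_def f_def split: if_splits)
qed

text \<open>The one-sided bound with C = 0 is applied to f and to -f. It requires integrability,
  which square integrability gives only on sets of finite measure; hence the passage to
  balls.\<close>

lemma fundamental_lemma_variations:
  fixes f :: "'a::euclidean_space \<Rightarrow> real"
  assumes D: "open D" and f: "f \<in> L2_space D"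
    and 0: "\<And>\<phi>. \<phi> \<in> test_functions D \<Longrightarrow> (LINT x|lebesgue_on D. f x * \<phi> x) = 0"
  shows "AE x in lebesgue_on D. f x = 0"
proof (rule AE_lebesgue_on_local[OF D])
  fix x assume "x \<in> D"
  then obtain e where e: "e > 0" "ball x e \<subseteq> D" using D open_contains_ball by blast
  define N where "N = ball x e"
  have N: "open N" "N \<in> lmeasurable" "N \<subseteq> D" "x \<in> N" using e by (auto simp: N_def)
  have ND: "N \<in> sets lebesgue" "D \<in> sets lebesgue" using N D by auto
  have fN: "integrable (lebesgue_on N) f"
    by (intro L2_space_integrable L2_space_subset[OF f] N ND)
  have 00: "(LINT x|lebesgue_on N. f x * \<phi> x) = 0" if "\<phi> \<in> test_functions N" for \<phi>
  proof -
    have "\<phi> \<in> test_functions D" using that test_functions_mono[OF N(3)] by blast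
    then show ?thesis
      using 0 LINT_lebesgue_on_subset[OF ND(2,1) N(3), of "\<lambda>x. f x * \<phi> x"]
        test_functions_outside[OF that] by auto
  qed
  have "AE y in lebesgue_on N. f y \<le> 0"
    by (rule AE_le_of_test_functions[OF N(1,2) fN]) (simp add: 00)
  moreover have "AE y in lebesgue_on N. - f y \<le> 0"
    by (rule AE_le_of_test_functions[OF N(1,2)]) (use fN 00 in simp_all)
  ultimately have "AE y in lebesgue_on N. f y = 0" by eventually_elim simp
  then show "\<exists>N. open N \<and> x \<in> N \<and> (AE y in lebesgue_on N. f y = 0)" using N by blast
qed

lemma L2_AE_eq_of_test_functions:
  fixes f g :: "'a::euclidean_space \<Rightarrow> real"
  assumes D: "open D" and L: "f \<in> L2_space D" "g \<in> L2_space D"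
    and eq: "\<And>\<phi>. \<phi> \<in> test_functions D \<Longrightarrow>
      (LINT x|lebesgue_on D. f x * \<phi> x) = (LINT x|lebesgue_on D. g x * \<phi> x)"
  shows "AE x in lebesgue_on D. f x = g x"
proof -
  have "AE x in lebesgue_on D. f x - g x = 0"
  proof (rule fundamental_lemma_variations[OF D L2_space_diff[OF L]])
    fix \<phi> assume \<phi>: "\<phi> \<in> test_functions D"
    then have "\<phi> \<in> L2_space D" using D by (intro test_functions_L2) auto
    then show "(LINT x|lebesgue_on D. (f x - g x) * \<phi> x) = 0"
      using eq[OF \<phi>] L by (simp add: left_diff_distrib L2_mult_integrable)
  qed
  then show ?thesis by simp
qed

section \<open>Weak derivatives and Sobolev spaces\<close>

lemma smooth_has_real_derivative_line:
  assumes "smooth f"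
  shows "((\<lambda>s. f (x + s *\<^sub>R b)) has_real_derivative pderivative b f (x + s *\<^sub>R b)) (at s)"
proof -
  have "((\<lambda>s. x + s *\<^sub>R b) has_derivative (\<lambda>h. h *\<^sub>R b)) (at s)"
    by (auto intro!: derivative_eq_intros)
  moreover have d: "(f has_derivative frechet_derivative f (at (x + s *\<^sub>R b))) (at (x + s *\<^sub>R b))"
    using smooth_differentiable[OF assms] by (simp add: frechet_derivative_works)
  ultimately have "((\<lambda>s. f (x + s *\<^sub>R b)) has_derivative 
      (\<lambda>h. frechet_derivative f (at (x + s *\<^sub>R b)) (h *\<^sub>R b))) (at s)"
    by (rule has_derivative_compose)
  moreover have "frechet_derivative f (at (x + s *\<^sub>R b)) (h *\<^sub>R b) = pderivative b f (x + s *\<^sub>R b) * h" for h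
    using linear_scale[OF has_derivative_linear[OF d]] by (simp add: pderivative_def mult.commute)
  ultimately show ?thesis by (simp add: has_field_derivative_def)
qed

lemma smooth_increment_le:
  assumes "smooth f" "\<And>y. \<bar>pderivative b f y\<bar> \<le> M" 
  shows "\<bar>f (x + t *\<^sub>R b) - f x\<bar> \<le> M * \<bar>t\<bar>"
proof -
  have "norm (f (x + t *\<^sub>R b) - f (x + 0 *\<^sub>R b)) \<le> M * norm (t - 0)"
    by (rule field_differentiable_bound[of UNIV "\<lambda>s. f (x + s *\<^sub>R b)" "\<lambda>s. pderivative b f (x + s *\<^sub>R b)"])
       (use smooth_has_real_derivative_line[OF assms(1)] assms(2) in auto)
  then show ?thesis by simp
qed

text \<open>The integral of a difference quotient vanishes by translation invariance.\<close>

lemma LINT_pderivative_eq_0: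
  assumes "\<phi> \<in> test_functions UNIV"
  shows "(LINT x|lebesgue. pderivative b \<phi> x) = 0"
proof -
  have s: "smooth \<phi>" and s': "smooth (pderivative b \<phi>)"
    using test_functions_smooth assms smooth_pderivative by blast+
  obtain K where K: "compact K" "\<And>x. x \<notin> K \<Longrightarrow> \<phi> x = 0"
    using test_functionsE[OF assms] by metis
  obtain r where r: "\<And>x. x \<in> K \<Longrightarrow> norm x \<le> r"
    using compact_imp_bounded[OF K(1)] bounded_iff by metis
  obtain M where M: "M \<ge> 0" "\<And>y. \<bar>pderivative b \<phi> y\<bar> \<le> M"
    using test_functions_bounded[OF test_functions_pderivative[OF assms]] by metis
  define t where "t n = inverse (real (Suc n))" for n
  have t: "t n > 0" "t n \<le> 1" for n by (auto simp: t_def inverse_le_1_iff)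
  \<comment> \<open>All translates of the support by \<open>t n *\<^sub>R b\<close> stay in this
    ball because \<open>t n \<le> 1\<close>; it carries the majorant of the difference
    quotients.\<close>
  define B where "B = cball (0::'a) (r + norm b)"
  have m: "\<phi> \<in> borel_measurable borel" "pderivative b \<phi> \<in> borel_measurable borel"
    using s s' smooth_continuous borel_measurable_continuous_onI by blast+
  have i: "integrable lborel \<phi>"
  proof -
    have "\<phi> \<in> L2_space K" by (rule test_functions_L2[OF assms fmeasurableD[OF lmeasurable_compact[OF K(1)]]])
    then have "integrable (lebesgue_on K) \<phi>" using K by (intro L2_space_integrable lmeasurable_compact)
    then have "integrable lebesgue (\<lambda>x. indicator K x *\<^sub>R \<phi> x)"
      using K by (subst (asm) integrable_restrict_space) (auto simp: lmeasurable_compact fmeasurableD)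
    also have "(\<lambda>x. indicator K x *\<^sub>R \<phi> x) = \<phi>" using K(2) by (intro ext) (auto simp: indicator_def)
    finally show ?thesis using m by (simp add: integrable_completion)
  qed
  define q where "q n x = (\<phi> (t n *\<^sub>R b + x) - \<phi> x) / t n" for n x
  have mt: "(\<lambda>x. \<phi> (t n *\<^sub>R b + x)) \<in> borel_measurable borel" for n
    using m(1) by measurable
  have "(\<lambda>n. LINT x|lborel. q n x) \<longlonglongrightarrow> (LINT x|lborel. pderivative b \<phi> x)"
  proof (rule integral_dominated_convergence[where w="\<lambda>x. indicator B x * M"])
    show "pderivative b \<phi> \<in> borel_measurable lborel" using m(2) by simp
    show "q n \<in> borel_measurable lborel" for n
      unfolding q_def[abs_def] using m(1) mt[of n] by measurable
    have "emeasure lborel B < \<infinity>" unfolding B_def by (intro emeasure_bounded_finite bounded_cball)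
    then show "integrable lborel (\<lambda>x. indicator B x * M)"
      by (intro integrable_mult_left integrable_real_indicator) (auto simp: B_def)
    show "AE x in lborel. (\<lambda>n. q n x) \<longlonglongrightarrow> pderivative b \<phi> x"
    proof (rule AE_I2)
      fix x
      have "((\<lambda>h. (\<phi> (x + (0 + h) *\<^sub>R b) - \<phi> (x + 0 *\<^sub>R b)) / h) \<longlongrightarrow> pderivative b \<phi> (x + 0 *\<^sub>R b)) (at 0)"
        using smooth_has_real_derivative_line[OF s, of x b 0] unfolding DERIV_def .
      moreover have "filterlim t (at 0) sequentially"
        unfolding t_def using LIMSEQ_inverse_real_of_nat by (auto intro!: filterlim_atI)
      ultimately have "(\<lambda>n. (\<phi> (x + (0 + t n) *\<^sub>R b) - \<phi> (x + 0 *\<^sub>R b)) / t n) \<longlonglongrightarrow> pderivative b \<phi> (x + 0 *\<^sub>R b)"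
        by (rule filterlim_compose)
      then show "(\<lambda>n. q n x) \<longlonglongrightarrow> pderivative b \<phi> x"
        by (simp add: q_def add.commute)
    qed
    show "AE x in lborel. norm (q n x) \<le> indicator B x * M" for n
    proof (rule AE_I2)
      fix x
      show "norm (q n x) \<le> indicator B x * M"
      proof (cases "x \<in> B")
        case True
        have "\<bar>\<phi> (x + t n *\<^sub>R b) - \<phi> x\<bar> \<le> M * \<bar>t n\<bar>" by (rule smooth_increment_le[OF s M(2)])
        then show ?thesis using True t(1)[of n] by (simp add: q_def add.commute field_simps)
      next
        case False
        have "norm (t n *\<^sub>R b + x) \<ge> norm x - norm (t n *\<^sub>R b)"
          using norm_diff_ineq[of x "t n *\<^sub>R b"] by (simp add: add.commute)
        moreover have "norm (t n *\<^sub>R b) \<le> norm b"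
          using t[of n] by (simp add: mult_left_le_one_le)
        moreover have "norm x > r + norm b" using False by (simp add: B_def)
        ultimately have "norm (t n *\<^sub>R b + x) > r" "norm x > r"
          using norm_ge_zero[of b] by linarith+
        then have "\<phi> (t n *\<^sub>R b + x) = 0" "\<phi> x = 0" using r K(2) by force+
        then show ?thesis by (simp add: q_def False)
      qed
    qed
  qed
  moreover have "(LINT x|lborel. q n x) = 0" for n
  proof -
    have e: "(LINT x|lborel. \<phi> (t n *\<^sub>R b + x)) = (LINT x|lborel. \<phi> x)"
      using integral_distr[of "(+) (t n *\<^sub>R b)" lborel borel \<phi>] m(1) by (simp add: lborel_distr_plus)
    have "integrable lborel (\<lambda>x. \<phi> (t n *\<^sub>R b + x))"
      using integrable_distr_eq[of "(+) (t n *\<^sub>R b)" lborel borel \<phi>] m(1) i by (simp add: lborel_distr_plus)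
    then show ?thesis unfolding q_def using i e by simp
  qed
  ultimately have "(LINT x|lborel. pderivative b \<phi> x) = 0"
    by (auto simp: LIMSEQ_const_iff)
  then show ?thesis using m by (simp add: integral_completion)
qed

text \<open>The product of f with a test function is again a test function, so the integral of its
  derivative vanishes; the product rule turns this into the weak formulation.\<close>

lemma smooth_is_weak_deriv:
  assumes "smooth f" "D \<in> sets lebesgue"
  shows "is_weak_deriv D b f (pderivative b f)"
  unfolding is_weak_deriv_def
proof
  fix \<phi> assume \<phi>: "\<phi> \<in> test_functions D"
  have s: "smooth \<phi>" using \<phi> by (rule test_functions_smooth)
  have f\<phi>: "(\<lambda>x. f x * \<phi> x) \<in> test_functions D" by (rule test_functions_smooth_mult[OF \<phi> assms(1)])
  \<comment> \<open>D may be unbounded and h unbounded on D, so integrability is obtained on the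
    compact set K that carries the product.\<close>
  have i: "integrable (lebesgue_on D) (\<lambda>x. h x * \<psi> x)" if h: "smooth h" and \<psi>: "\<psi> \<in> test_functions D" for h \<psi>
  proof -
    obtain K where K: "compact K" "K \<subseteq> D" "\<And>x. x \<notin> K \<Longrightarrow> \<psi> x = 0" using test_functionsE[OF \<psi>] by metis
    have "(\<lambda>x. h x * \<psi> x) \<in> test_functions D" by (rule test_functions_smooth_mult[OF \<psi> h])
    then have "(\<lambda>x. h x * \<psi> x) \<in> L2_space K" by (rule test_functions_L2[OF _ fmeasurableD[OF lmeasurable_compact[OF K(1)]]])
    then have "integrable (lebesgue_on K) (\<lambda>x. h x * \<psi> x)"
      using K by (intro L2_space_integrable lmeasurable_compact)
    then have "integrable lebesgue (\<lambda>x. indicator K x *\<^sub>R (h x * \<psi> x))"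
      using K by (subst (asm) integrable_restrict_space) (auto simp: lmeasurable_compact fmeasurableD)
    also have "(\<lambda>x. indicator K x *\<^sub>R (h x * \<psi> x)) = (\<lambda>x. indicator D x *\<^sub>R (h x * \<psi> x))"
      using K(2,3) by (force simp: indicator_def)
    finally show ?thesis using assms(2) by (subst integrable_restrict_space) auto
  qed
  have "0 = (LINT x|lebesgue. pderivative b (\<lambda>x. f x * \<phi> x) x)"
    using LINT_pderivative_eq_0 f\<phi> test_functions_mono[of D UNIV] by (metis subsetD subset_UNIV)
  also have "\<dots> = (LINT x|lebesgue_on UNIV. pderivative b (\<lambda>x. f x * \<phi> x) x)"
    by (simp add: LINT_lebesgue_on_eq_indicator)
  also have "\<dots> = (LINT x|lebesgue_on D. pderivative b (\<lambda>x. f x * \<phi> x) x)"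
    using assms(2) test_functions_outside[OF test_functions_pderivative[OF f\<phi>]]
    by (intro LINT_lebesgue_on_subset[symmetric]) auto
  also have "\<dots> = (LINT x|lebesgue_on D. f x * pderivative b \<phi> x + pderivative b f x * \<phi> x)"
    using smooth_differentiable[OF assms(1)] smooth_differentiable[OF s] by (simp add: pderivative_mult)
  also have "\<dots> = (LINT x|lebesgue_on D. f x * pderivative b \<phi> x) + (LINT x|lebesgue_on D. pderivative b f x * \<phi> x)"
    by (intro Bochner_Integration.integral_add i assms \<phi> test_functions_pderivative smooth_pderivative)
  finally show "(LINT x|lebesgue_on D. f x * pderivative b \<phi> x) = - (LINT x|lebesgue_on D. pderivative b f x * \<phi> x)"
    by simp
qed

section \<open>Weak derivatives: uniqueness, linearity, limits\<close>

lemma is_weak_deriv_unique: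
  assumes "open D" "g \<in> L2_space D" "h \<in> L2_space D"
    and "is_weak_deriv D b f g" "is_weak_deriv D b f h"
  shows "AE x in lebesgue_on D. g x = h x"
  using assms by (intro L2_AE_eq_of_test_functions) (auto simp: is_weak_deriv_def)

text \<open>Makes the choice in \<open>weak_deriv\<close> usable: once some square-integrable weak
  derivative is known, the chosen one is a weak derivative too and agrees with it almost
  everywhere.\<close>

lemma weak_deriv_works:
  assumes "open D" "g \<in> L2_space D" "is_weak_deriv D b f g"
  shows "weak_deriv D b f \<in> L2_space D" "is_weak_deriv D b f (weak_deriv D b f)"
    "AE x in lebesgue_on D. weak_deriv D b f x = g x"
proof -
  have "weak_deriv D b f \<in> L2_space D \<and> is_weak_deriv D b f (weak_deriv D b f)"
    unfolding weak_deriv_def by (rule someI[of _ g]) (use assms in simp)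
  then show "weak_deriv D b f \<in> L2_space D" "is_weak_deriv D b f (weak_deriv D b f)"
    by auto
  then show "AE x in lebesgue_on D. weak_deriv D b f x = g x"
    using assms by (intro is_weak_deriv_unique) 
qed

lemma is_weak_deriv_add:
  assumes "D \<in> sets lebesgue" "f \<in> L2_space D" "g \<in> L2_space D" "f' \<in> L2_space D" "g' \<in> L2_space D"
    "is_weak_deriv D b f f'" "is_weak_deriv D b g g'"
  shows "is_weak_deriv D b (\<lambda>x. f x + g x) (\<lambda>x. f' x + g' x)"
  unfolding is_weak_deriv_def
proof
  fix \<phi> assume \<phi>: "\<phi> \<in> test_functions D"
  have "pderivative b \<phi> \<in> L2_space D" "\<phi> \<in> L2_space D"
    using \<phi> test_functions_pderivative test_functions_L2 assms(1) by blast+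
  then have "integrable (lebesgue_on D) (\<lambda>x. f x * pderivative b \<phi> x)" "integrable (lebesgue_on D) (\<lambda>x. g x * pderivative b \<phi> x)"
    "integrable (lebesgue_on D) (\<lambda>x. f' x * \<phi> x)" "integrable (lebesgue_on D) (\<lambda>x. g' x * \<phi> x)"
    using assms by (auto intro: L2_mult_integrable)
  then show "(LINT x|lebesgue_on D. (f x + g x) * pderivative b \<phi> x) = - (LINT x|lebesgue_on D. (f' x + g' x) * \<phi> x)"
    using assms(6,7) \<phi> by (simp add: distrib_right is_weak_deriv_def)
qed

lemma is_weak_deriv_cmult:
  assumes "is_weak_deriv D b f f'"
  shows "is_weak_deriv D b (\<lambda>x. c * f x) (\<lambda>x. c * f' x)"
  using assms by (simp add: is_weak_deriv_def mult.assoc)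

lemma is_weak_deriv_zero: "is_weak_deriv D b (\<lambda>x. 0) (\<lambda>x. 0)"
  by (simp add: is_weak_deriv_def)

lemma is_weak_deriv_diff:
  assumes "D \<in> sets lebesgue" "f \<in> L2_space D" "g \<in> L2_space D" "f' \<in> L2_space D" "g' \<in> L2_space D"
    "is_weak_deriv D b f f'" "is_weak_deriv D b g g'"
  shows "is_weak_deriv D b (\<lambda>x. f x - g x) (\<lambda>x. f' x - g' x)"
  using is_weak_deriv_add[of D f "\<lambda>x. (-1) * g x" f' "\<lambda>x. (-1) * g' x" b] assms
    is_weak_deriv_cmult[OF assms(7), of "-1"] L2_space_cmult[of _ D "-1"] by simp

lemma is_weak_deriv_cong_AE:
  assumes "D \<in> sets lebesgue" "f \<in> L2_space D" "f' \<in> L2_space D" "AE x in lebesgue_on D. f x = f' x"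
  shows "is_weak_deriv D b f g \<longleftrightarrow> is_weak_deriv D b f' g"
proof -
  have "(LINT x|lebesgue_on D. f x * pderivative b \<phi> x) = (LINT x|lebesgue_on D. f' x * pderivative b \<phi> x)"
    if \<phi>: "\<phi> \<in> test_functions D" for \<phi>
  proof (rule integral_cong_AE)
    have p: "pderivative b \<phi> \<in> L2_space D"
      using \<phi> test_functions_pderivative test_functions_L2 assms(1) by blast
    show "(\<lambda>x. f x * pderivative b \<phi> x) \<in> borel_measurable (lebesgue_on D)"
      "(\<lambda>x. f' x * pderivative b \<phi> x) \<in> borel_measurable (lebesgue_on D)"
      using L2_spaceD(1)[OF p] L2_spaceD(1)[OF assms(2)] L2_spaceD(1)[OF assms(3)] by (auto intro: borel_measurable_times)
    show "AE x in lebesgue_on D. f x * pderivative b \<phi> x = f' x * pderivative b \<phi> x"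
      using assms(4) by eventually_elim simp
  qed
  then show ?thesis by (simp add: is_weak_deriv_def)
qed

text \<open>The conclusion is equality of functions, not merely almost everywhere: the predicates
  under \<open>SOME\<close> coincide, so the choices coincide. This is why
  \<open>Sobolev_sqnorm_cong_AE\<close> needs no induction.\<close>

lemma weak_deriv_cong_AE:
  assumes "D \<in> sets lebesgue" "f \<in> L2_space D" "f' \<in> L2_space D" "AE x in lebesgue_on D. f x = f' x"
  shows "weak_deriv D b f = weak_deriv D b f'"
  unfolding weak_deriv_def using is_weak_deriv_cong_AE[OF assms] by simp

text \<open>Closedness of the weak derivative under convergence in L^2: both sides of the defining
  identity are pairings with fixed square-integrable functions. It will identify the derivatives of
  the extended plate field.\<close>

lemma is_weak_deriv_limit:
  assumes D: "D \<in> sets lebesgue"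
    and f: "\<And>j. f j \<in> L2_space D" "f' \<in> L2_space D" "(\<lambda>j. LINT x|lebesgue_on D. (f j x - f' x)\<^sup>2) \<longlonglongrightarrow> 0"
    and g: "\<And>j. g j \<in> L2_space D" "g' \<in> L2_space D" "(\<lambda>j. LINT x|lebesgue_on D. (g j x - g' x)\<^sup>2) \<longlonglongrightarrow> 0"
    and d: "\<And>j. is_weak_deriv D b (f j) (g j)"
  shows "is_weak_deriv D b f' g'"
  unfolding is_weak_deriv_def
proof
  fix \<phi> assume \<phi>: "\<phi> \<in> test_functions D"
  have p: "pderivative b \<phi> \<in> L2_space D" "\<phi> \<in> L2_space D"
    using \<phi> test_functions_pderivative test_functions_L2 D by blast+
  have "(\<lambda>j. LINT x|lebesgue_on D. f j x * pderivative b \<phi> x) \<longlonglongrightarrow> (LINT x|lebesgue_on D. f' x * pderivative b \<phi> x)"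
    by (rule L2_inner_tendsto[OF f(1,2) p(1) f(3)])
  moreover have "(\<lambda>j. LINT x|lebesgue_on D. g j x * \<phi> x) \<longlonglongrightarrow> (LINT x|lebesgue_on D. g' x * \<phi> x)"
    by (rule L2_inner_tendsto[OF g(1,2) p(2) g(3)])
  then have "(\<lambda>j. - (LINT x|lebesgue_on D. g j x * \<phi> x)) \<longlonglongrightarrow> - (LINT x|lebesgue_on D. g' x * \<phi> x)"
    by (rule tendsto_minus)
  ultimately show "(LINT x|lebesgue_on D. f' x * pderivative b \<phi> x) = - (LINT x|lebesgue_on D. g' x * \<phi> x)"
    using d \<phi> unfolding is_weak_deriv_def by (auto intro: LIMSEQ_unique)
qed

section \<open>Sobolev spaces: inclusions, linearity, smooth members\<close>

lemma Sobolev_L2: "f \<in> Sobolev k D \<Longrightarrow> f \<in> L2_space D"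
  by (cases k) auto

lemma Sobolev_SucD: "f \<in> Sobolev (Suc k) D \<Longrightarrow> f \<in> Sobolev k D"
proof (induction k arbitrary: f)
  case (Suc k)
  have f: "f \<in> L2_space D \<and> (\<forall>b\<in>Basis. \<exists>g\<in>Sobolev (Suc k) D. is_weak_deriv D b f g)"
    using Suc.prems by (simp only: Sobolev.simps(2)[of "Suc k" D]) blast
  then have "\<forall>b\<in>Basis. \<exists>g\<in>Sobolev k D. is_weak_deriv D b f g"
    using Suc.IH by blast
  then show ?case using f by (simp only: Sobolev.simps(2)[of k D]) blast
qed simp

lemma Sobolev_mono: "f \<in> Sobolev n D \<Longrightarrow> k \<le> n \<Longrightarrow> f \<in> Sobolev k D"
  by (induction n) (auto simp: le_Suc_eq simp del: Sobolev.simps(2) dest: Sobolev_SucD)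

lemma Sobolev_zero: "(\<lambda>x. 0) \<in> Sobolev k D"
proof (induction k)
  case (Suc k)
  then show ?case using is_weak_deriv_zero L2_space_zero by auto
qed (simp add: L2_space_zero)

lemma Sobolev_add:
  assumes "D \<in> sets lebesgue" 
  shows "f \<in> Sobolev k D \<Longrightarrow> g \<in> Sobolev k D \<Longrightarrow> (\<lambda>x. f x + g x) \<in> Sobolev k D"
proof (induction k arbitrary: f g)
  case (Suc k)
  have "\<exists>h\<in>Sobolev k D. is_weak_deriv D b (\<lambda>x. f x + g x) h" if b: "b \<in> Basis" for b
  proof -
    obtain f' g' where "f' \<in> Sobolev k D" "is_weak_deriv D b f f'" "g' \<in> Sobolev k D" "is_weak_deriv D b g g'"
      using Suc.prems b unfolding Sobolev.simps(2) by blast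
    then show ?thesis
      using Suc.prems by (intro bexI[of _ "\<lambda>x. f' x + g' x"] is_weak_deriv_add Suc.IH assms) (auto dest: Sobolev_L2)
  qed
  then show ?case using Suc.prems L2_space_add by auto
qed (simp add: L2_space_add)

lemma Sobolev_cmult:
  "f \<in> Sobolev k D \<Longrightarrow> (\<lambda>x. c * f x) \<in> Sobolev k D"
proof (induction k arbitrary: f)
  case (Suc k)
  have "\<exists>h\<in>Sobolev k D. is_weak_deriv D b (\<lambda>x. c * f x) h" if b: "b \<in> Basis" for b
  proof -
    obtain f' where "f' \<in> Sobolev k D" "is_weak_deriv D b f f'" 
      using Suc.prems b by auto
    then show ?thesis
      by (intro bexI[of _ "\<lambda>x. c * f' x"] is_weak_deriv_cmult Suc.IH)
  qed
  then show ?case using Suc.prems L2_space_cmult by auto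
qed (simp add: L2_space_cmult)

lemma Sobolev_diff:
  "D \<in> sets lebesgue \<Longrightarrow> f \<in> Sobolev k D \<Longrightarrow> g \<in> Sobolev k D \<Longrightarrow> (\<lambda>x. f x - g x) \<in> Sobolev k D"
  using Sobolev_add[of D f k "\<lambda>x. (-1) * g x"] Sobolev_cmult[of g k D "-1"] by simp

lemma Sobolev_cong_AE:
  assumes "D \<in> sets lebesgue" "f \<in> Sobolev k D" "f' \<in> L2_space D" "AE x in lebesgue_on D. f x = f' x"
  shows "f' \<in> Sobolev k D"
proof (cases k)
  case (Suc n)
  have "is_weak_deriv D b f g \<longleftrightarrow> is_weak_deriv D b f' g" for b g
    by (rule is_weak_deriv_cong_AE) (use assms Sobolev_L2 in auto)
  then show ?thesis using assms by (simp add: Suc)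
qed (use assms in simp)

lemma weak_deriv_Sobolev:
  assumes "open D" "f \<in> Sobolev (Suc k) D" "b \<in> Basis"
  shows "weak_deriv D b f \<in> Sobolev k D" "is_weak_deriv D b f (weak_deriv D b f)"
proof -
  obtain g where g: "g \<in> Sobolev k D" "is_weak_deriv D b f g" using assms by auto
  note w = weak_deriv_works[OF assms(1) Sobolev_L2[OF g(1)] g(2)]
  show "is_weak_deriv D b f (weak_deriv D b f)" by (rule w)
  show "weak_deriv D b f \<in> Sobolev k D"
    by (rule Sobolev_cong_AE[OF _ g(1) w(1)]) (use assms(1) w(3) in auto)
qed

lemma weak_deriv_smooth:
  assumes "open D" "smooth f" "pderivative b f \<in> L2_space D"
  shows "AE x in lebesgue_on D. weak_deriv D b f x = pderivative b f x"
  using weak_deriv_works(3)[OF assms(1,3) smooth_is_weak_deriv] assms by auto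

lemma weak_deriv_diff:
  assumes "open D" "f \<in> Sobolev 1 D" "g \<in> Sobolev 1 D" "b \<in> Basis"
  shows "AE x in lebesgue_on D. weak_deriv D b (\<lambda>x. f x - g x) x = weak_deriv D b f x - weak_deriv D b g x"
proof -
  note f = weak_deriv_Sobolev[OF assms(1) assms(2)[unfolded One_nat_def] assms(4)]
  note g = weak_deriv_Sobolev[OF assms(1) assms(3)[unfolded One_nat_def] assms(4)]
  show ?thesis
    using f g assms Sobolev_L2 by (intro weak_deriv_works(3) L2_space_diff is_weak_deriv_diff) auto
qed

lemma L2_space_bounded_domain:
  assumes "bounded D" "D \<in> sets lebesgue" "continuous_on UNIV f"
  shows "f \<in> L2_space D"
proof -
  have "compact (closure D)" using assms(1) by (simp add: compact_closure)
  then have "compact (f ` closure D)"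
    using assms(3) by (intro compact_continuous_image) (auto intro: continuous_on_subset)
  then obtain M where M: "\<forall>y\<in>f ` closure D. norm y \<le> M"
    using compact_imp_bounded bounded_iff by metis
  interpret finite_measure "lebesgue_on D"
    using assms by (intro finite_measure_lebesgue_on bounded_set_imp_lmeasurable)
  show ?thesis
  proof (rule L2_space_boundI)
    show "f \<in> borel_measurable (lebesgue_on D)" by (rule continuous_measurable_lebesgue_on[OF assms(3)])
    show "integrable (lebesgue_on D) (\<lambda>x. M\<^sup>2)" by simp
    show "AE x in lebesgue_on D. (norm (f x))\<^sup>2 \<le> M\<^sup>2"
      using M closure_subset[of D] by (intro AE_I2 power_mono) auto
  qed
qed

lemma smooth_Sobolev:
  assumes "bounded D" "D \<in> sets lebesgue" "smooth f"
  shows "f \<in> Sobolev k D"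
  using assms(3)
proof (induction k arbitrary: f)
  case 0
  then show ?case using L2_space_bounded_domain assms smooth_continuous by auto
next
  case (Suc k)
  have "\<exists>g\<in>Sobolev k D. is_weak_deriv D b f g" for b
    by (rule bexI[of _ "pderivative b f"])
      (rule smooth_is_weak_deriv[OF Suc.prems assms(2)] Suc.IH[OF smooth_pderivative[OF Suc.prems]])+
  then show ?case using L2_space_bounded_domain[OF assms(1,2) smooth_continuous[OF Suc.prems]] by simp
qed

lemma test_functions_Sobolev:
  assumes "D \<in> sets lebesgue" "\<phi> \<in> test_functions E"
  shows "\<phi> \<in> Sobolev k D"
  using assms(2)
proof (induction k arbitrary: \<phi>)
  case 0
  then show ?case using test_functions_L2 assms(1) by auto
next
  case (Suc k)
  have "\<exists>g\<in>Sobolev k D. is_weak_deriv D b \<phi> g" for b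
    by (rule bexI[of _ "pderivative b \<phi>"])
      (rule smooth_is_weak_deriv[OF test_functions_smooth[OF Suc.prems] assms(1)]
        Suc.IH[OF test_functions_pderivative[OF Suc.prems]])+
  then show ?case using test_functions_L2[OF Suc.prems assms(1)] by simp
qed

section \<open>Sobolev norms, convergence, and functions with vanishing trace\<close>

lemma Sobolev_sqnorm_nonneg: "0 \<le> Sobolev_sqnorm k D f"
  by (induction k arbitrary: f) (auto intro!: add_nonneg_nonneg sum_nonneg)

lemma Sobolev_sqnorm_mono: "Sobolev_sqnorm k D f \<le> Sobolev_sqnorm (Suc k) D f"
proof (induction k arbitrary: f)
  case 0
  then show ?case by (auto intro!: sum_nonneg)
next
  case (Suc k)
  then have "(\<Sum>b\<in>Basis. Sobolev_sqnorm k D (weak_deriv D b f)) \<le> (\<Sum>b\<in>Basis. Sobolev_sqnorm (Suc k) D (weak_deriv D b f))"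
    by (intro sum_mono) 
  then show ?case by simp
qed

lemma Sobolev_sqnorm_cong_AE:
  assumes "D \<in> sets lebesgue" "f \<in> L2_space D" "f' \<in> L2_space D" "AE x in lebesgue_on D. f x = f' x"
  shows "Sobolev_sqnorm k D f = Sobolev_sqnorm k D f'"
proof -
  have "(LINT x|lebesgue_on D. (f x)\<^sup>2) = (LINT x|lebesgue_on D. (f' x)\<^sup>2)"
  proof (rule integral_cong_AE)
    show "(\<lambda>x. (f x)\<^sup>2) \<in> borel_measurable (lebesgue_on D)" "(\<lambda>x. (f' x)\<^sup>2) \<in> borel_measurable (lebesgue_on D)"
      using L2_spaceD(1)[OF assms(2)] L2_spaceD(1)[OF assms(3)] by (auto intro: borel_measurable_power)
    show "AE x in lebesgue_on D. (f x)\<^sup>2 = (f' x)\<^sup>2" using assms(4) by eventually_elim simp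
  qed
  then show ?thesis
    using weak_deriv_cong_AE[OF assms] by (cases k) auto
qed

lemma tendsto_0_le_nonneg:
  fixes f g :: "nat \<Rightarrow> real"
  assumes "g \<longlonglongrightarrow> 0" "\<And>j. 0 \<le> f j" "\<And>j. f j \<le> g j"
  shows "f \<longlonglongrightarrow> 0"
  by (rule tendsto_sandwich[of "\<lambda>_. 0" f sequentially g]) (use assms in auto)

lemma Sobolev_tendsto_L2:
  assumes "Sobolev_tendsto k D \<phi> f"
  shows "(\<lambda>j. LINT x|lebesgue_on D. (\<phi> j x - f x)\<^sup>2) \<longlonglongrightarrow> 0"
proof -
  have "(LINT x|lebesgue_on D. (h x)\<^sup>2) \<le> Sobolev_sqnorm k D h" for h
    by (cases k) (auto intro!: sum_nonneg Sobolev_sqnorm_nonneg)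
  then show ?thesis
    by (intro tendsto_0_le_nonneg[OF assms[unfolded Sobolev_tendsto_def]] Bochner_Integration.integral_nonneg) auto
qed

lemma Sobolev_tendsto_SucD:
  assumes "Sobolev_tendsto (Suc k) D \<phi> f"
  shows "Sobolev_tendsto k D \<phi> f"
  unfolding Sobolev_tendsto_def
  by (rule tendsto_0_le_nonneg[OF assms[unfolded Sobolev_tendsto_def] Sobolev_sqnorm_nonneg Sobolev_sqnorm_mono])

text \<open>The norm of order k + 1 contains the weak derivative of the difference. This chosen
  representative is identified almost everywhere with the classical derivative of the test function
  minus the weak derivative of f.\<close>

lemma Sobolev_tendsto_pderivative:
  assumes D: "open D" and \<phi>: "\<And>j. \<phi> j \<in> test_functions E" and f: "f \<in> Sobolev (Suc k) D"
    and lim: "Sobolev_tendsto (Suc k) D \<phi> f" and b: "b \<in> Basis"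
  shows "Sobolev_tendsto k D (\<lambda>j. pderivative b (\<phi> j)) (weak_deriv D b f)"
proof -
  have D': "D \<in> sets lebesgue" using D by auto
  have f1: "f \<in> Sobolev 1 D" using f by (rule Sobolev_mono) simp
  have eq: "Sobolev_sqnorm k D (weak_deriv D b (\<lambda>x. \<phi> j x - f x)) = Sobolev_sqnorm k D (\<lambda>x. pderivative b (\<phi> j) x - weak_deriv D b f x)" for j
  proof (rule Sobolev_sqnorm_cong_AE[OF D'])
    have p1: "\<phi> j \<in> Sobolev 1 D" by (rule test_functions_Sobolev[OF D' \<phi>])
    have p2: "pderivative b (\<phi> j) \<in> L2_space D" by (intro test_functions_L2[OF test_functions_pderivative[OF \<phi>] D'])
    show "(\<lambda>x. pderivative b (\<phi> j) x - weak_deriv D b f x) \<in> L2_space D"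
      using weak_deriv_Sobolev[OF D f b] Sobolev_L2 p2 by (intro L2_space_diff) auto
    show "weak_deriv D b (\<lambda>x. \<phi> j x - f x) \<in> L2_space D"
      using Sobolev_L2 weak_deriv_Sobolev(1)[OF D Sobolev_diff[OF D' p1 f1, unfolded One_nat_def] b] by blast
    show "AE x in lebesgue_on D. weak_deriv D b (\<lambda>x. \<phi> j x - f x) x = pderivative b (\<phi> j) x - weak_deriv D b f x"
      using weak_deriv_diff[OF D p1 f1 b] weak_deriv_smooth[OF D test_functions_smooth[OF \<phi>] p2]
      by eventually_elim simp
  qed
  have "Sobolev_sqnorm k D (\<lambda>x. pderivative b (\<phi> j) x - weak_deriv D b f x) \<le> Sobolev_sqnorm (Suc k) D (\<lambda>x. \<phi> j x - f x)" for j
  proof -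
    have "Sobolev_sqnorm k D (weak_deriv D b (\<lambda>x. \<phi> j x - f x)) \<le> (\<Sum>c\<in>Basis. Sobolev_sqnorm k D (weak_deriv D c (\<lambda>x. \<phi> j x - f x)))"
      using b by (intro member_le_sum Sobolev_sqnorm_nonneg) auto
    also have "\<dots> \<le> Sobolev_sqnorm (Suc k) D (\<lambda>x. \<phi> j x - f x)"
      by (simp add: Bochner_Integration.integral_nonneg)
    finally show ?thesis by (simp only: eq)
  qed
  then show ?thesis
    unfolding Sobolev_tendsto_def
    by (rule tendsto_0_le_nonneg[OF lim[unfolded Sobolev_tendsto_def] Sobolev_sqnorm_nonneg])
qed

lemma test_functions_Sobolev0:
  assumes "open D" "\<phi> \<in> test_functions D"
  shows "\<phi> \<in> Sobolev0 k D"
proof -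
  have D: "D \<in> sets lebesgue" using assms(1) by auto
  \<comment> \<open>Not immediate from the recursion: the chosen weak derivative of 0 is known to
    vanish only almost everywhere.\<close>
  have "Sobolev_sqnorm k D (\<lambda>x. 0) = 0"
  proof (induction k)
    case (Suc k)
    have "Sobolev_sqnorm k D (weak_deriv D b (\<lambda>x. 0)) = 0" for b
    proof -
      have w: "weak_deriv D b (\<lambda>x. 0) \<in> L2_space D" "AE x in lebesgue_on D. weak_deriv D b (\<lambda>x. 0) x = 0"
        using weak_deriv_works[OF assms(1) L2_space_zero is_weak_deriv_zero] by auto
      show ?thesis
        using Sobolev_sqnorm_cong_AE[OF D w(1) L2_space_zero w(2)] Suc by simp
    qed
    then show ?case by simp
  qed simp
  then have "Sobolev_tendsto k D (\<lambda>j. \<phi>) \<phi>" by (simp add: Sobolev_tendsto_def)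
  then show ?thesis
    using assms(2) test_functions_Sobolev[OF D assms(2)] unfolding Sobolev0_def by auto
qed

text \<open>The approximating test functions serve as the smooth functions in the definition of the
  trace. As D is open, it is disjoint from its frontier, so they vanish there identically.\<close>

lemma has_trace_real_zero:
  assumes "v \<in> Sobolev 1 D" "\<And>j. \<phi> j \<in> test_functions D" "open D" "Sobolev_tendsto 1 D \<phi> v"
  shows "has_trace_real D v (\<lambda>y. 0)"
  unfolding has_trace_real_def
proof (intro conjI exI[of _ \<phi>] allI)
  show "(\<lambda>j. \<integral>\<^sup>+ y. ennreal ((\<phi> j y - 0)\<^sup>2) \<partial>boundary_measure D) \<longlonglongrightarrow> 0"
  proof -
    have "(\<integral>\<^sup>+ y. ennreal ((\<phi> j y - 0)\<^sup>2) \<partial>boundary_measure D) = (\<integral>\<^sup>+ y. 0 \<partial>boundary_measure D)" for j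
    proof (rule nn_integral_cong)
      fix y assume "y \<in> space (boundary_measure D)"
      then have "y \<notin> D" using assms(3)
        by (auto simp: boundary_measure_def space_restrict_space frontier_def interior_open)
      then show "ennreal ((\<phi> j y - 0)\<^sup>2) = 0" using test_functions_outside[OF assms(2)] by simp
    qed
    then show ?thesis by simp
  qed
qed (use assms test_functions_smooth[OF assms(2)] test_functions_Sobolev[OF _ assms(2)] in \<open>simp_all del: Sobolev.simps One_nat_def\<close>)

lemma Sobolev0_has_trace_zero:
  assumes "open D" "v \<in> Sobolev0 k D" "k \<ge> 1"
  shows "has_trace_real D v (\<lambda>y. 0)"
proof -
  obtain \<phi> where \<phi>: "v \<in> Sobolev k D" "\<And>j. \<phi> j \<in> test_functions D" "Sobolev_tendsto k D \<phi> v"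
    using assms(2) unfolding Sobolev0_def by auto
  have "Sobolev_tendsto 1 D \<phi> v" 
    using assms(3) \<phi>(3) by (induction k rule: dec_induct) (auto dest: Sobolev_tendsto_SucD)
  then show ?thesis
    by (rule has_trace_real_zero[OF Sobolev_mono[OF \<phi>(1) assms(3)] \<phi>(2) assms(1)])
qed

lemma Sobolev0_weak_deriv:
  assumes "open D" "v \<in> Sobolev0 (Suc k) D" "b \<in> Basis"
  shows "weak_deriv D b v \<in> Sobolev0 k D"
proof -
  obtain \<phi> where \<phi>: "v \<in> Sobolev (Suc k) D" "\<And>j. \<phi> j \<in> test_functions D" "Sobolev_tendsto (Suc k) D \<phi> v"
    using assms(2) unfolding Sobolev0_def by blast
  show ?thesis unfolding Sobolev0_def
    by (intro CollectI conjI exI[of _ "\<lambda>j. pderivative b (\<phi> j)"] allI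
        weak_deriv_Sobolev(1)[OF assms(1) \<phi>(1) assms(3)] test_functions_pderivative[OF \<phi>(2)]
        Sobolev_tendsto_pderivative[OF assms(1) \<phi>(2,1,3) assms(3)])
qed

section \<open>Functions in \<open>H\<^sup>3\<close> of a convex domain are bounded\<close>

text \<open>The minus sign spreads the support of \<phi> in the direction +e. Two weights occur:
  \<open>1 - s\<close> gives the part that is differentiated along e, and 1 gives the remainder in
  the integration by parts.\<close>

definition line_average :: "(real \<Rightarrow> real) \<Rightarrow> 'a::euclidean_space \<Rightarrow> ('a \<Rightarrow> real) \<Rightarrow> 'a \<Rightarrow> real" where
  "line_average c e \<phi> y = integral {0..1} (\<lambda>s. c s * \<phi> (y - s *\<^sub>R e))"

lemma continuous_on_line_average_integrand:
  fixes c :: "real \<Rightarrow> real" and \<phi> :: "'a::euclidean_space \<Rightarrow> real"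
  assumes "continuous_on {0..1} c" "continuous_on UNIV \<phi>"
  shows "continuous_on {0..1} (\<lambda>s. c s * \<phi> (y - s *\<^sub>R e))"
  by (rule continuous_on_mult[OF assms(1)], rule continuous_on_compose2[OF assms(2)])
     (auto intro!: continuous_intros)

lemma line_average_has_derivative:
  fixes \<phi> :: "'a::euclidean_space \<Rightarrow> real"
  assumes c: "continuous_on {0..1} c" and \<phi>: "smooth \<phi>"
  shows "(line_average c e \<phi> has_derivative (\<lambda>h. \<Sum>b\<in>Basis. (h \<bullet> b) * line_average c e (pderivative b \<phi>) y)) (at y)"
proof -
  \<comment> \<open>The derivative of the integrand as a bounded linear map, the form in which the
    Leibniz rule integrates derivatives.\<close>
  define fx :: "'a \<Rightarrow> real \<Rightarrow> 'a \<Rightarrow>\<^sub>L real"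
    where "fx x t = (\<Sum>b\<in>Basis. (c t * pderivative b \<phi> (x - t *\<^sub>R e)) *\<^sub>R blinfun_inner_left b)" for x t
  have fx_apply: "blinfun_apply (fx x t) h = (\<Sum>b\<in>Basis. (c t * pderivative b \<phi> (x - t *\<^sub>R e)) * (h \<bullet> b))" for x t h
    by (simp add: fx_def blinfun.sum_left blinfun.scaleR_left)
  have dc: "continuous_on S (\<lambda>z. pderivative b \<phi> (g z))" if "continuous_on S g" for b S and g :: "'z::topological_space \<Rightarrow> 'a"
    using continuous_on_compose2[OF smooth_continuous[OF smooth_pderivative[OF \<phi>]] that] by auto
  have cont: "continuous_on (UNIV \<times> cbox 0 1) (\<lambda>(x, t). fx x t)"
    unfolding fx_def case_prod_unfold
    by (intro continuous_intros continuous_on_compose2[OF c] dc) auto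
  have "((\<lambda>x. integral (cbox 0 1) (\<lambda>t. c t * \<phi> (x - t *\<^sub>R e))) has_derivative
        blinfun_apply (integral (cbox 0 1) (fx y))) (at y within UNIV)"
  proof (rule leibniz_rule[OF _ _ cont])
    fix x :: 'a and t :: real
    have d: "(\<phi> has_derivative (\<lambda>h. \<Sum>b\<in>Basis. (h \<bullet> b) * pderivative b \<phi> (x - t *\<^sub>R e))) (at (x - t *\<^sub>R e))"
      by (intro has_derivative_pderivative smooth_differentiable \<phi>)
    have "((\<lambda>x. x - t *\<^sub>R e) has_derivative (\<lambda>h. h)) (at x)"
      by (auto intro!: derivative_eq_intros)
    from has_derivative_compose[OF this d]
    have "((\<lambda>x. c t * \<phi> (x - t *\<^sub>R e)) has_derivative (\<lambda>h. c t * (\<Sum>b\<in>Basis. (h \<bullet> b) * pderivative b \<phi> (x - t *\<^sub>R e)))) (at x)"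
      by (rule has_derivative_mult_right)
    moreover have "(\<lambda>h. c t * (\<Sum>b\<in>Basis. (h \<bullet> b) * pderivative b \<phi> (x - t *\<^sub>R e))) = blinfun_apply (fx x t)"
      by (auto simp: fx_apply sum_distrib_left algebra_simps)
    ultimately show "((\<lambda>x. c t * \<phi> (x - t *\<^sub>R e)) has_derivative blinfun_apply (fx x t)) (at x within UNIV)"
      by simp
    show "(\<lambda>t. c t * \<phi> (x - t *\<^sub>R e)) integrable_on cbox 0 1"
      using continuous_on_line_average_integrand[OF c smooth_continuous[OF \<phi>]]
      by (intro integrable_continuous) simp
  qed auto
  moreover have "blinfun_apply (integral (cbox 0 1) (fx y)) = (\<lambda>h. \<Sum>b\<in>Basis. (h \<bullet> b) * line_average c e (pderivative b \<phi>) y)"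
  proof
    fix h
    have i: "fx y integrable_on cbox 0 1"
      by (intro integrable_continuous continuous_on_compose2[OF cont, of _ "\<lambda>t. (y, t)", simplified]) (auto intro!: continuous_intros)
    have "blinfun_apply (integral (cbox 0 1) (fx y)) h = integral (cbox 0 1) (\<lambda>t. blinfun_apply (fx y t) h)"
      using integral_linear[OF i, of "\<lambda>L. blinfun_apply L h"] by (simp add: o_def blinfun.bounded_linear_left)
    also have "\<dots> = (\<Sum>b\<in>Basis. integral (cbox 0 1) (\<lambda>t. (c t * pderivative b \<phi> (y - t *\<^sub>R e)) * (h \<bullet> b)))"
      unfolding fx_apply
      by (intro integral_sum integrable_continuous continuous_intros continuous_on_compose2[OF c] dc) auto
    also have "\<dots> = (\<Sum>b\<in>Basis. (h \<bullet> b) * line_average c e (pderivative b \<phi>) y)"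
      by (simp add: line_average_def mult.commute)
    finally show "blinfun_apply (integral (cbox 0 1) (fx y)) h = (\<Sum>b\<in>Basis. (h \<bullet> b) * line_average c e (pderivative b \<phi>) y)" .
  qed
  ultimately show ?thesis
    by (simp add: line_average_def[abs_def])
qed

lemma smooth_line_average:
  fixes \<phi> :: "'a::euclidean_space \<Rightarrow> real"
  assumes c: "continuous_on {0..1} c" and \<phi>: "smooth \<phi>"
  shows "smooth (line_average c e \<phi>)"
proof (rule smoothI)
  fix k show "C_k k (line_average c e \<phi>)"
    using \<phi>
  proof (induction k arbitrary: \<phi>)
    case 0
    then show ?case
      unfolding C_k.simps
      by (intro continuous_at_imp_continuous_on ballI has_derivative_continuous[OF line_average_has_derivative[OF c]])
  next
    case (Suc k)
    show ?case
      by (rule C_k_SucI[OF line_average_has_derivative[OF c Suc.prems]])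
        (intro C_k_sum C_k_cmult Suc.IH smooth_pderivative Suc.prems)
  qed
qed

text \<open>Integration by parts along the direction \<open>e\<close>.\<close>

lemma line_average_decomposition:
  fixes \<phi> :: "'a::euclidean_space \<Rightarrow> real"
  assumes \<phi>: "smooth \<phi>"
  shows "\<phi> y = pderivative e (line_average (\<lambda>s. 1 - s) e \<phi>) y + line_average (\<lambda>s. 1) e \<phi> y"
proof -
  have c: "continuous_on {0..1} (\<lambda>s::real. 1 - s)" by (intro continuous_intros)
  have dc: "continuous_on S (\<lambda>z. pderivative b \<phi> (g z))" if "continuous_on S g" for b S and g :: "'z::topological_space \<Rightarrow> 'a"
    using continuous_on_compose2[OF smooth_continuous[OF smooth_pderivative[OF \<phi>]] that] by auto
  have pc: "continuous_on S (\<lambda>z. \<phi> (g z))" if "continuous_on S g" for S and g :: "'z::topological_space \<Rightarrow> 'a"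
    using continuous_on_compose2[OF smooth_continuous[OF \<phi>] that] by auto
  have "pderivative e (line_average (\<lambda>s. 1 - s) e \<phi>) y = (\<Sum>b\<in>Basis. (e \<bullet> b) * line_average (\<lambda>s. 1 - s) e (pderivative b \<phi>) y)"
    by (rule pderivative_eq[OF line_average_has_derivative[OF c \<phi>]])
  also have "\<dots> = integral {0..1} (\<lambda>s. \<Sum>b\<in>Basis. (e \<bullet> b) * ((1 - s) * pderivative b \<phi> (y - s *\<^sub>R e)))"
    unfolding line_average_def integral_mult_right[symmetric]
    by (rule integral_sum[symmetric]) (auto intro!: integrable_continuous_real continuous_intros dc)
  also have "\<dots> = integral {0..1} (\<lambda>s. (1 - s) * pderivative e \<phi> (y - s *\<^sub>R e))"
    by (simp add: pderivative_expand[OF smoothD[OF \<phi>], of e] sum_distrib_left mult.left_commute)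
  finally have 1: "pderivative e (line_average (\<lambda>s. 1 - s) e \<phi>) y = integral {0..1} (\<lambda>s. (1 - s) * pderivative e \<phi> (y - s *\<^sub>R e))" .
  \<comment> \<open>The integrand is the derivative of
    \<open>- (1 - s) * \<phi> (y - s *\<^sub>R e)\<close> in s. The weight vanishes at s = 1, so
    \<phi> at y is the only boundary term.\<close>
  have "((\<lambda>s. (1 - s) * pderivative e \<phi> (y - s *\<^sub>R e) + \<phi> (y - s *\<^sub>R e)) has_integral 
      (- (1 - 1) * \<phi> (y - 1 *\<^sub>R e) - (- (1 - 0) * \<phi> (y - 0 *\<^sub>R e)))) {0..1}"
  proof (rule fundamental_theorem_of_calculus)
    fix s :: real
    have me: "pderivative (- e) \<phi> x = - pderivative e \<phi> x" for x
      unfolding pderivative_def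
      by (rule linear_neg[OF has_derivative_linear[of \<phi> _ "at x"]])
        (use smooth_differentiable[OF \<phi>] in \<open>simp add: frechet_derivative_works\<close>)
    have "((\<lambda>s. \<phi> (y - s *\<^sub>R e)) has_real_derivative - pderivative e \<phi> (y - s *\<^sub>R e)) (at s)"
      using smooth_has_real_derivative_line[OF \<phi>, of y "- e" s] by (simp add: me)
    then have "((\<lambda>s. - (1 - s) * \<phi> (y - s *\<^sub>R e)) has_real_derivative 
        (1 - s) * pderivative e \<phi> (y - s *\<^sub>R e) + \<phi> (y - s *\<^sub>R e)) (at s)"
      by (auto intro!: derivative_eq_intros simp: algebra_simps)
    then show "((\<lambda>s. - (1 - s) * \<phi> (y - s *\<^sub>R e)) has_vector_derivative 
        (1 - s) * pderivative e \<phi> (y - s *\<^sub>R e) + \<phi> (y - s *\<^sub>R e)) (at s within {0..1})"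
      by (simp add: has_real_derivative_iff_has_vector_derivative has_vector_derivative_at_within)
  qed simp
  then have "integral {0..1} (\<lambda>s. (1 - s) * pderivative e \<phi> (y - s *\<^sub>R e) + \<phi> (y - s *\<^sub>R e)) = \<phi> y"
    by (simp add: integral_unique)
  also have "integral {0..1} (\<lambda>s. (1 - s) * pderivative e \<phi> (y - s *\<^sub>R e) + \<phi> (y - s *\<^sub>R e))
    = integral {0..1} (\<lambda>s. (1 - s) * pderivative e \<phi> (y - s *\<^sub>R e)) + integral {0..1} (\<lambda>s. \<phi> (y - s *\<^sub>R e))"
    by (rule integral_add) (auto intro!: integrable_continuous_real continuous_intros dc pc)
  finally show ?thesis by (simp add: 1 line_average_def)
qed

lemma line_average_bound:
  assumes c: "continuous_on {0..1} c" "\<And>s. s \<in> {0..1} \<Longrightarrow> \<bar>c s\<bar> \<le> 1" and \<phi>: "continuous_on UNIV \<phi>"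
  shows "ennreal \<bar>line_average c e \<phi> y\<bar> \<le> (\<integral>\<^sup>+s. indicator {0..1} s * ennreal \<bar>\<phi> (y - s *\<^sub>R e)\<bar> \<partial>lborel)"
proof -
  let ?f = "\<lambda>s. c s * \<phi> (y - s *\<^sub>R e)"
  have i: "set_integrable lborel {0..1} ?f"
    by (intro borel_integrable_atLeastAtMost' continuous_on_line_average_integrand c \<phi>)
  have "line_average c e \<phi> y = (LINT s|lborel. indicator {0..1} s *\<^sub>R ?f s)"
    using set_borel_integral_eq_integral(2)[OF i] by (simp add: line_average_def set_lebesgue_integral_def)
  then have "ennreal \<bar>line_average c e \<phi> y\<bar> \<le> (\<integral>\<^sup>+s. ennreal (norm (indicator {0..1} s *\<^sub>R ?f s)) \<partial>lborel)"
    using integral_norm_bound_ennreal[OF i[unfolded set_integrable_def]] by simp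
  also have "\<dots> \<le> (\<integral>\<^sup>+s. indicator {0..1} s * ennreal \<bar>\<phi> (y - s *\<^sub>R e)\<bar> \<partial>lborel)"
  proof (rule nn_integral_mono)
    fix s :: real
    show "ennreal (norm (indicator {0..1} s *\<^sub>R ?f s)) \<le> indicator {0..1} s * ennreal \<bar>\<phi> (y - s *\<^sub>R e)\<bar>"
      using c(2)[of s] by (cases "s \<in> {0..1}") (auto simp: abs_mult mult_left_le_one_le intro!: ennreal_leI)
  qed
  finally show ?thesis .
qed

text \<open>The Minkowski sum of K with the segment from 0 to e, which contains the support of a
  line average along e. Written as an image of a product so that compactness is inherited.\<close>

definition sweep :: "'a::euclidean_space set \<Rightarrow> 'a \<Rightarrow> 'a set" where
  "sweep K e = (\<lambda>(k, s). k + s *\<^sub>R e) ` (K \<times> {0..1})"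

lemma compact_sweep: "compact K \<Longrightarrow> compact (sweep K e)"
  unfolding sweep_def case_prod_unfold
  by (intro compact_continuous_image compact_Times continuous_intros) auto

lemma subset_sweep: "K \<subseteq> sweep K e"
  unfolding sweep_def by (force intro!: image_eqI[where x="(_, 0)"])

lemma line_average_outside:
  assumes "\<And>x. x \<notin> K \<Longrightarrow> \<phi> x = 0" "y \<notin> sweep K e"
  shows "line_average c e \<phi> y = 0"
proof -
  have "\<phi> (y - s *\<^sub>R e) = 0" if "s \<in> {0..1}" for s
  proof (rule assms(1), rule notI)
    assume "y - s *\<^sub>R e \<in> K"
    then have "y \<in> sweep K e" unfolding sweep_def
      by (intro image_eqI[where x="(y - s *\<^sub>R e, s)"]) (use that in auto)
    then show False using assms(2) by simp
  qed
  then have "((\<lambda>s. c s * \<phi> (y - s *\<^sub>R e)) has_integral 0) {0..1}"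
    by (intro has_integral_is_0) simp
  then show ?thesis by (simp add: line_average_def integral_unique)
qed

primrec sweeps :: "'a::euclidean_space set \<Rightarrow> 'a list \<Rightarrow> 'a set" where
  "sweeps K [] = K"
| "sweeps K (e # es) = sweeps (sweep K e) es"

lemma subset_sweeps: "K \<subseteq> sweeps K es"
proof (induction es arbitrary: K)
  case (Cons e es)
  then show ?case using subset_sweep[of K e] by auto
qed simp

text \<open>Extended non-negative values allow averaging repeatedly without integrability
  conditions. The head of the list is averaged first, in step with the recursion of
  \<open>sweeps\<close>.\<close>

primrec iterated_average :: "'a::euclidean_space list \<Rightarrow> ('a \<Rightarrow> ennreal) \<Rightarrow> 'a \<Rightarrow> ennreal" where
  "iterated_average [] g = g"
| "iterated_average (e # es) g =
     iterated_average es (\<lambda>y. \<integral>\<^sup>+s. indicator {0..1} s * g (y - s *\<^sub>R e) \<partial>lborel)"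

lemma iterated_average_mono: "(\<And>y. g y \<le> h y) \<Longrightarrow> iterated_average es g y \<le> iterated_average es h y"
proof (induction es arbitrary: g h)
  case (Cons e es)
  have "(\<integral>\<^sup>+s. indicator {0..1} s * g (y - s *\<^sub>R e) \<partial>lborel) \<le> (\<integral>\<^sup>+s. indicator {0..1} s * h (y - s *\<^sub>R e) \<partial>lborel)" for y
    by (intro nn_integral_mono mult_left_mono Cons.prems) simp
  then show ?case using Cons.IH by simp
qed simp

text \<open>The invariant of the induction that follows. B bounds what is left of \<phi> after
  averaging along all of \<open>es\<close>; for the empty list it is a bound of the supremum. That
  the swept set stays in D makes every intermediate average a test function on D.\<close>

definition sweep_admissible ::
  "'a::euclidean_space set \<Rightarrow> real \<Rightarrow> 'a list \<Rightarrow> ('a \<Rightarrow> real) \<Rightarrow> 'a set \<Rightarrow> real \<Rightarrow> bool" where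
  "sweep_admissible D R es \<phi> K B \<longleftrightarrow> (\<forall>e\<in>set es. norm e \<le> R) \<and>
     smooth \<phi> \<and> compact K \<and> (\<forall>x. x \<notin> K \<longrightarrow> \<phi> x = 0) \<and> sweeps K es \<subseteq> D \<and> B \<ge> 0 \<and>
     (\<forall>y. iterated_average es (\<lambda>y. ennreal \<bar>\<phi> y\<bar>) y \<le> ennreal B)"

text \<open>Integration by parts along the first direction e writes \<phi> as the e-derivative of an
  average T plus an average A. The first term moves a derivative to v, the second is paired with v
  itself; both averages are admissible for the shorter list with the same B. C is fixed before the
  directions, \<phi>, K and B, which later makes the bound uniform over D.\<close>

lemma Sobolev_weak_bound:
  fixes D :: "'a::euclidean_space set"
  assumes D: "open D" "D \<in> lmeasurable" and R: "R \<ge> 0"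
  shows "v \<in> Sobolev k D \<Longrightarrow> \<exists>C\<ge>0. \<forall>es \<phi> K B. length es = k \<and> sweep_admissible D R es \<phi> K B \<longrightarrow>
     \<bar>LINT x|lebesgue_on D. v x * \<phi> x\<bar> \<le> C * B"
proof (induction k arbitrary: v)
  case 0
  then have v: "integrable (lebesgue_on D) v" using L2_space_integrable D by auto
  show ?case
  proof (intro exI[of _ "LINT x|lebesgue_on D. \<bar>v x\<bar>"] conjI allI impI)
    fix es \<phi> K B
    assume "length (es::'a list) = 0 \<and> sweep_admissible D R es \<phi> K B"
    then have a: "length es = 0" "(\<forall>e\<in>set es. norm e \<le> R) \<and>
     smooth \<phi> \<and> compact K \<and> (\<forall>x. x \<notin> K \<longrightarrow> \<phi> x = 0) \<and> sweeps K es \<subseteq> D \<and> B \<ge> 0 \<and>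
     (\<forall>y. iterated_average es (\<lambda>y. ennreal \<bar>\<phi> y\<bar>) y \<le> ennreal B)"
      unfolding sweep_admissible_def by blast+
    have B: "\<bar>\<phi> y\<bar> \<le> B" for y using a by auto
    have \<phi>m: "\<phi> \<in> borel_measurable (lebesgue_on D)"
      using a by (intro continuous_measurable_lebesgue_on smooth_continuous) simp
    have i: "integrable (lebesgue_on D) (\<lambda>x. \<bar>v x\<bar> * B)" using v by auto
    have le: "norm (v x * \<phi> x) \<le> \<bar>v x\<bar> * B" for x using B by (simp add: abs_mult mult_left_mono)
    have i2: "integrable (lebesgue_on D) (\<lambda>x. v x * \<phi> x)"
      by (rule Bochner_Integration.integrable_bound[OF i])
        (use v \<phi>m le a in \<open>auto intro: borel_measurable_times intro!: AE_I2\<close>)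
    have "\<bar>LINT x|lebesgue_on D. v x * \<phi> x\<bar> \<le> (LINT x|lebesgue_on D. \<bar>v x * \<phi> x\<bar>)"
      by (rule integral_abs_bound)
    also have "\<dots> \<le> (LINT x|lebesgue_on D. \<bar>v x\<bar> * B)"
      using i2 i le by (intro integral_mono) auto
    finally show "\<bar>LINT x|lebesgue_on D. v x * \<phi> x\<bar> \<le> (LINT x|lebesgue_on D. \<bar>v x\<bar>) * B" by simp
  qed simp
next
  case (Suc k)
  have D': "D \<in> sets lebesgue" using D by auto
  have vL: "v \<in> L2_space D" using Suc.prems by simp
  have "\<forall>b\<in>Basis. \<exists>g\<in>Sobolev k D. is_weak_deriv D b v g" using Suc.prems by simp
  then obtain g where g: "\<And>b. b \<in> Basis \<Longrightarrow> g b \<in> Sobolev k D" "\<And>b. b \<in> Basis \<Longrightarrow> is_weak_deriv D b v (g b)"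
    by metis
  obtain C0 where C0: "C0 \<ge> 0" "\<And>es \<phi> K B. length es = k \<and> sweep_admissible D R es \<phi> K B \<Longrightarrow>
     \<bar>LINT x|lebesgue_on D. v x * \<phi> x\<bar> \<le> C0 * B"
    using Suc.IH[OF Sobolev_SucD[OF Suc.prems]] by blast
  have "\<forall>b\<in>Basis. \<exists>C\<ge>0. \<forall>es \<phi> K B. length es = k \<and> sweep_admissible D R es \<phi> K B \<longrightarrow>
     \<bar>LINT x|lebesgue_on D. g b x * \<phi> x\<bar> \<le> C * B"
    using Suc.IH[OF g(1)] by blast
  then obtain C where C: "\<And>b. b \<in> Basis \<Longrightarrow> C b \<ge> 0" "\<And>b es \<phi> K B. b \<in> Basis \<Longrightarrow> length es = k \<and> sweep_admissible D R es \<phi> K B \<Longrightarrow>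
     \<bar>LINT x|lebesgue_on D. g b x * \<phi> x\<bar> \<le> C b * B"
    by metis
  show ?case
  \<comment> \<open>The factor R bounds the coordinates \<open>e \<bullet> b\<close> when the
    e-derivative of T is expanded in the basis; \<open>C0\<close> accounts for A.\<close>
  proof (intro exI[of _ "(\<Sum>b\<in>Basis. R * C b) + C0"] conjI allI impI)
    show "0 \<le> (\<Sum>b\<in>Basis. R * C b) + C0" using C(1) C0(1) R by (auto intro!: add_nonneg_nonneg sum_nonneg)
    fix es \<phi> K B
    assume "length (es::'a list) = Suc k \<and> sweep_admissible D R es \<phi> K B"
    then have a: "length es = Suc k" "(\<forall>e\<in>set es. norm e \<le> R) \<and>
     smooth \<phi> \<and> compact K \<and> (\<forall>x. x \<notin> K \<longrightarrow> \<phi> x = 0) \<and> sweeps K es \<subseteq> D \<and> B \<ge> 0 \<and>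
     (\<forall>y. iterated_average es (\<lambda>y. ennreal \<bar>\<phi> y\<bar>) y \<le> ennreal B)"
      unfolding sweep_admissible_def by blast+
    obtain e es' where es: "es = e # es'" using a(1) by (cases es) auto
    have \<phi>: "smooth \<phi>" and e: "norm e \<le> R" and B: "B \<ge> 0" using a es by auto
    define T where "T = line_average (\<lambda>s. 1 - s) e \<phi>"
    define A where "A = line_average (\<lambda>s. 1) e \<phi>"
    have TA: "smooth T" "smooth A"
      unfolding T_def A_def by (intro smooth_line_average \<phi> continuous_intros)+
    have le: "ennreal \<bar>T y\<bar> \<le> (\<integral>\<^sup>+s. indicator {0..1} s * ennreal \<bar>\<phi> (y - s *\<^sub>R e)\<bar> \<partial>lborel)"
      "ennreal \<bar>A y\<bar> \<le> (\<integral>\<^sup>+s. indicator {0..1} s * ennreal \<bar>\<phi> (y - s *\<^sub>R e)\<bar> \<partial>lborel)" for y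
      unfolding T_def A_def by (intro line_average_bound smooth_continuous \<phi> continuous_intros; simp)+
    have good: "length es' = k \<and> sweep_admissible D R es' F (sweep K e) B" if "F = T \<or> F = A" for F
      unfolding sweep_admissible_def
    proof (intro conjI allI impI)
      show "smooth F" using that TA by auto
      show "compact (sweep K e)" using a compact_sweep by blast
      show "F x = 0" if "x \<notin> sweep K e" for x
        using line_average_outside[of K \<phi> x e] a that \<open>F = T \<or> F = A\<close> by (auto simp: T_def A_def)
      show "iterated_average es' (\<lambda>y. ennreal \<bar>F y\<bar>) y \<le> ennreal B" for y
      proof -
        have "iterated_average es' (\<lambda>y. ennreal \<bar>F y\<bar>) y \<le> iterated_average es (\<lambda>y. ennreal \<bar>\<phi> y\<bar>) y"
          unfolding es iterated_average.simps by (rule iterated_average_mono) (use that le in auto)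
        also have "\<dots> \<le> ennreal B" using a by simp
        finally show ?thesis .
      qed
    qed (use a es in auto)
    have sub: "sweep K e \<subseteq> D" using subset_sweeps[of "sweep K e" es'] a es by auto
    have Tt: "T \<in> test_functions D" "A \<in> test_functions D"
      using good[of T] good[of A] sub TA unfolding sweep_admissible_def by (auto intro!: test_functionsI[of _ "sweep K e"])
    have iA: "integrable (lebesgue_on D) (\<lambda>x. v x * A x)"
      by (intro L2_mult_integrable vL test_functions_L2[OF Tt(2)] D')
    have iT: "integrable (lebesgue_on D) (\<lambda>x. v x * pderivative b T x)" for b
      by (intro L2_mult_integrable vL test_functions_L2[OF test_functions_pderivative[OF Tt(1)]] D')
    have "\<phi> x = (\<Sum>b\<in>Basis. (e \<bullet> b) * pderivative b T x) + A x" for x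
      using line_average_decomposition[OF \<phi>, of x e] pderivative_expand[OF smoothD[OF TA(1)], of e x]
      unfolding T_def A_def by simp
    then have "(LINT x|lebesgue_on D. v x * \<phi> x) = (LINT x|lebesgue_on D. (\<Sum>b\<in>Basis. (e \<bullet> b) * (v x * pderivative b T x)) + v x * A x)"
      by (simp add: distrib_left sum_distrib_left mult.left_commute)
    also have "\<dots> = (\<Sum>b\<in>Basis. (e \<bullet> b) * (LINT x|lebesgue_on D. v x * pderivative b T x)) + (LINT x|lebesgue_on D. v x * A x)"
      using iA iT by simp
    also have "\<dots> = (\<Sum>b\<in>Basis. - (e \<bullet> b) * (LINT x|lebesgue_on D. g b x * T x)) + (LINT x|lebesgue_on D. v x * A x)"
      using g(2) Tt(1) by (simp add: is_weak_deriv_def)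
    finally have "\<bar>LINT x|lebesgue_on D. v x * \<phi> x\<bar> \<le> (\<Sum>b\<in>Basis. \<bar>- (e \<bullet> b) * (LINT x|lebesgue_on D. g b x * T x)\<bar>) + \<bar>LINT x|lebesgue_on D. v x * A x\<bar>"
      using sum_abs[of "\<lambda>b. - (e \<bullet> b) * (LINT x|lebesgue_on D. g b x * T x)" Basis] by linarith
    also have "\<dots> \<le> (\<Sum>b\<in>Basis. R * (C b * B)) + C0 * B"
    proof (intro add_mono sum_mono)
      fix b :: 'a assume b: "b \<in> Basis"
      have "\<bar>e \<bullet> b\<bar> \<le> R" using Basis_le_norm[OF b, of e] e by simp
      then show "\<bar>- (e \<bullet> b) * (LINT x|lebesgue_on D. g b x * T x)\<bar> \<le> R * (C b * B)"
        unfolding abs_mult abs_minus_cancel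
        using C(2)[OF b good[of T]] R by (intro mult_mono) auto
    qed (rule C0(2)[OF good[of A]], simp)
    also have "\<dots> = ((\<Sum>b\<in>Basis. R * C b) + C0) * B"
      by (simp add: distrib_right sum_distrib_right mult.assoc)
    finally show "\<bar>LINT x|lebesgue_on D. v x * \<phi> x\<bar> \<le> ((\<Sum>b\<in>Basis. R * C b) + C0) * B" .
  qed
qed

section \<open>Linear changes of variables in Lebesgue integrals\<close>

lemma linear_continuous_on_euclidean:
  fixes f :: "'a::euclidean_space \<Rightarrow> 'b::real_normed_vector"
  shows "linear f \<Longrightarrow> continuous_on S f"
  by (simp add: linear_continuous_on linear_conv_bounded_linear)

lemma borel_measurable_linear:
  fixes f :: "'a::euclidean_space \<Rightarrow> 'b::euclidean_space"
  shows "linear f \<Longrightarrow> f \<in> borel_measurable borel"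
  by (intro borel_measurable_continuous_onI linear_continuous_on_euclidean)

text \<open>Such a map only renames coordinates: preimages of boxes are boxes with the same side
  lengths, and Lebesgue measure is determined by boxes. This identifies vectors with nested pairs,
  for which Fubini is available.\<close>

lemma lborel_distr_Basis_bij:
  fixes f :: "'a::euclidean_space \<Rightarrow> 'b::euclidean_space"
  assumes "linear f" and bij: "bij_betw f Basis Basis"
  shows "distr lborel borel f = lborel"
proof (rule lborel_eqI[symmetric])
  have fm: "f \<in> borel_measurable borel"
    by (rule borel_measurable_linear) (rule assms(1))
  have fb: "f x \<bullet> f b = x \<bullet> b" if "b \<in> Basis" for x b
  proof -
    have "f x = (\<Sum>c\<in>Basis. (x \<bullet> c) *\<^sub>R f c)"
      by (metis (no_types, lifting) assms(1) euclidean_representation linear_scale linear_sum sum.cong)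
    then have "f x \<bullet> f b = (\<Sum>c\<in>Basis. (x \<bullet> c) * (f c \<bullet> f b))" by (simp add: inner_sum_left)
    also have "\<dots> = (\<Sum>c\<in>Basis. if c = b then x \<bullet> c else 0)"
    proof (rule sum.cong[OF refl])
      fix c :: 'a assume c: "c \<in> Basis"
      have "f c \<in> Basis" "f b \<in> Basis" "f c = f b \<longleftrightarrow> c = b"
        using bij that c by (auto simp: bij_betw_def inj_on_eq_iff)
      then show "(x \<bullet> c) * (f c \<bullet> f b) = (if c = b then x \<bullet> c else 0)"
        by (simp add: inner_Basis)
    qed
    finally show ?thesis using that by simp
  qed
  fix l u :: 'b assume le: "\<And>b. b \<in> Basis \<Longrightarrow> l \<bullet> b \<le> u \<bullet> b"
  define g where "g y = (\<Sum>b\<in>Basis. (y \<bullet> f b) *\<^sub>R b)" for y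
  have gb: "g y \<bullet> b = y \<bullet> f b" if "b \<in> Basis" for y b
    using that by (simp add: g_def)
  have "f -` box l u = box (g l) (g u)"
  proof (rule set_eqI)
    fix x
    have "x \<in> f -` box l u \<longleftrightarrow> (\<forall>c\<in>f ` Basis. l \<bullet> c < f x \<bullet> c \<and> f x \<bullet> c < u \<bullet> c)"
      using bij by (simp add: mem_box bij_betw_def)
    then show "x \<in> f -` box l u \<longleftrightarrow> x \<in> box (g l) (g u)"
      by (simp add: mem_box gb fb)
  qed
  then have "emeasure (distr lborel borel f) (box l u) = emeasure lborel (box (g l) (g u))"
    using fm by (simp add: emeasure_distr)
  also have "\<dots> = (\<Prod>b\<in>Basis. (g u - g l) \<bullet> b)"
    using le bij by (intro emeasure_lborel_box) (auto simp: gb bij_betw_def)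
  also have "(\<Prod>b\<in>Basis. (g u - g l) \<bullet> b) = (\<Prod>b\<in>Basis. (u - l) \<bullet> f b)"
    by (rule prod.cong) (auto simp: inner_diff_left gb)
  also have "\<dots> = (\<Prod>b\<in>Basis. (u - l) \<bullet> b)"
    using prod.reindex_bij_betw[OF bij, of "\<lambda>b. (u - l) \<bullet> b"] .
  finally show "emeasure (distr lborel borel f) (box l u) = ennreal (\<Prod>b\<in>Basis. (u - l) \<bullet> b)" by simp
qed simp

text \<open>The image measure under A, weighted by the absolute determinant, gives each box its
  volume because the determinants of A and its inverse multiply to 1; so it is Lebesgue
  measure.\<close>

lemma nn_integral_lborel_linear:
  fixes A :: "real^'n::{finite,wellorder} \<Rightarrow> real^'n::{finite,wellorder}" and g :: "real^'n::{finite,wellorder} \<Rightarrow> ennreal"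
  assumes A: "linear A" and d: "det (matrix A) \<noteq> 0" and g: "g \<in> borel_measurable borel"
  shows "ennreal \<bar>det (matrix A)\<bar> * (\<integral>\<^sup>+x. g (A x) \<partial>lborel) = (\<integral>\<^sup>+x. g x \<partial>lborel)"
proof -
  have inv: "bij A" using A d det_nz_iff_inj by (metis bij_def linear_injective_imp_surjective)
  have Am[measurable]: "A \<in> borel_measurable borel"
    by (rule borel_measurable_linear) (rule A)
  define B where "B = inv A"
  have B: "linear B" unfolding B_def using A inv by (metis bij_def inj_linear_imp_inv_linear)
  have AB: "A \<circ> B = id" unfolding B_def using inv bij_is_surj surj_iff by blast
  have "matrix A ** matrix B = mat 1"
    using matrix_compose[OF B A] AB by (simp add: matrix_id_mat_1)
  then have dAB: "det (matrix A) * det (matrix B) = 1"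
    by (metis det_I det_mul)
  define M where "M = density (distr lborel borel A) (\<lambda>_. ennreal \<bar>det (matrix A)\<bar>)"
  have "lborel = M"
  proof (rule lborel_eqI)
    fix l u :: "real^'n::{finite,wellorder}" assume le: "\<And>b. b \<in> Basis \<Longrightarrow> l \<bullet> b \<le> u \<bullet> b"
    have "A -` box l u = B ` box l u" 
      unfolding B_def using inv by (simp add: bij_vimage_eq_inv_image)
    have m: "B ` box l u \<in> lmeasurable" "measure lebesgue (B ` box l u) = \<bar>det (matrix B)\<bar> * measure lebesgue (box l u)"
      using measurable_linear_image[OF B] measure_linear_image[OF B] by auto
    have "A -` box l u \<in> sets borel" using measurable_sets_borel[OF Am, of "box l u"] by simp
    have "emeasure M (box l u) = ennreal \<bar>det (matrix A)\<bar> * emeasure (distr lborel borel A) (box l u)"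
      unfolding M_def by (subst emeasure_density_const) auto
    also have "emeasure (distr lborel borel A) (box l u) = emeasure lborel (A -` box l u)"
      by (simp add: emeasure_distr)
    also have "\<dots> = emeasure lebesgue (B ` box l u)"
      using \<open>A -` box l u \<in> sets borel\<close> \<open>A -` box l u = B ` box l u\<close> by simp
    also have "\<dots> = ennreal (\<bar>det (matrix B)\<bar> * measure lebesgue (box l u))"
      using m by (simp add: emeasure_eq_measure2 fmeasurableD2)
    also have "ennreal \<bar>det (matrix A)\<bar> * \<dots> = ennreal (\<bar>det (matrix A) * det (matrix B)\<bar> * measure lebesgue (box l u))"
      by (simp add: ennreal_mult' abs_mult mult.assoc)
    also have "\<dots> = ennreal (\<Prod>b\<in>Basis. (u - l) \<bullet> b)"
      using le unfolding dAB by simp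
    finally show "emeasure M (box l u) = ennreal (\<Prod>b\<in>Basis. (u - l) \<bullet> b)" .
  qed (simp add: M_def)
  then have "(\<integral>\<^sup>+x. g x \<partial>lborel) = (\<integral>\<^sup>+x. g x \<partial>M)" by simp
  also have "\<dots> = ennreal \<bar>det (matrix A)\<bar> * (\<integral>\<^sup>+x. g (A x) \<partial>lborel)"
    unfolding M_def using g by (subst nn_integral_density) (auto simp: nn_integral_cmult nn_integral_distr)
  finally show ?thesis by simp
qed

lemma nn_integral_lborel_reflect:
  fixes g :: "'a::euclidean_space \<Rightarrow> ennreal"
  assumes [measurable]: "g \<in> borel_measurable borel"
  shows "(\<integral>\<^sup>+x. g (y - x) \<partial>lborel) = (\<integral>\<^sup>+x. g x \<partial>lborel)"
proof -
  have "(\<integral>\<^sup>+x. g x \<partial>lborel) = (\<integral>\<^sup>+x. g x \<partial>(density (distr lborel borel (\<lambda>x. y + (-1) *\<^sub>R x)) (\<lambda>_. ennreal (\<bar>- 1\<bar>^DIM('a)))))"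
    using lborel_affine[of "-1" y] by simp
  also have "\<dots> = (\<integral>\<^sup>+x. g (y - x) \<partial>lborel)"
    by (subst nn_integral_density) (auto simp: nn_integral_distr)
  finally show ?thesis by simp
qed

lemma Basis_vec3: "(Basis :: (real^3) set) = {axis 1 1, axis 2 1, axis 3 1}"
  by (auto simp: Basis_vec_def UNIV_3)

lemma nn_integral_lborel_vec3:
  fixes g :: "real^3 \<Rightarrow> ennreal"
  assumes g[measurable]: "g \<in> borel_measurable borel"
  shows "(\<integral>\<^sup>+a. \<integral>\<^sup>+b. \<integral>\<^sup>+c. g (vector [a, b, c]) \<partial>lborel \<partial>lborel \<partial>lborel) = (\<integral>\<^sup>+x. g x \<partial>lborel)"
proof -
  define F :: "real \<times> real \<times> real \<Rightarrow> real^3" where "F p = vector [fst p, fst (snd p), snd (snd p)]" for p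
  have lin: "linear F"
    by (rule linearI) (auto simp: F_def vec_eq_iff forall_3)
  have Fm[measurable]: "F \<in> borel_measurable borel"
    by (rule borel_measurable_linear) (rule lin)
  have "F ` Basis = Basis"
    by (auto simp: Basis_prod_def Basis_vec3 F_def vec_eq_iff forall_3 axis_def image_iff)
  moreover have "inj_on F Basis"
    by (rule inj_onI) (auto simp: F_def vec_eq_iff forall_3)
  ultimately have bij: "bij_betw F Basis Basis" by (simp add: bij_betw_def)
  have "(\<integral>\<^sup>+x. g x \<partial>lborel) = (\<integral>\<^sup>+x. g x \<partial>distr lborel borel F)"
    by (simp add: lborel_distr_Basis_bij[OF lin bij])
  also have "\<dots> = (\<integral>\<^sup>+p. g (F p) \<partial>lborel)"
    by (rule nn_integral_distr) auto
  also have "\<dots> = (\<integral>\<^sup>+p. g (F p) \<partial>(lborel \<Otimes>\<^sub>M lborel))"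
    by (simp add: lborel_prod)
  also have "\<dots> = (\<integral>\<^sup>+a. \<integral>\<^sup>+q. g (F (a, q)) \<partial>lborel \<partial>lborel)"
    by (rule lborel.nn_integral_fst[symmetric]) (simp add: lborel_prod)
  also have "\<dots> = (\<integral>\<^sup>+a. \<integral>\<^sup>+b. \<integral>\<^sup>+c. g (F (a, b, c)) \<partial>lborel \<partial>lborel \<partial>lborel)"
  proof (rule nn_integral_cong)
    fix a :: real
    have "(\<integral>\<^sup>+q. g (F (a, q)) \<partial>lborel) = (\<integral>\<^sup>+q. g (F (a, q)) \<partial>(lborel \<Otimes>\<^sub>M lborel))"
      by (simp add: lborel_prod)
    also have "\<dots> = (\<integral>\<^sup>+b. \<integral>\<^sup>+c. g (F (a, b, c)) \<partial>lborel \<partial>lborel)"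
      by (rule lborel.nn_integral_fst[symmetric]) (simp add: lborel_prod)
    finally show "(\<integral>\<^sup>+q. g (F (a, q)) \<partial>lborel) = (\<integral>\<^sup>+b. \<integral>\<^sup>+c. g (F (a, b, c)) \<partial>lborel \<partial>lborel)" .
  qed
  finally show ?thesis by (simp add: F_def)
qed

text \<open>Dropping the indicators turns the three averages into an integral of g(y - A x) over the
  whole space, A having the edges as columns. The substitution costs the inverse determinant. The
  list is reversed because its head becomes the innermost integral.\<close>

lemma iterated_average_le_integral:
  fixes g :: "real^3 \<Rightarrow> ennreal" and e :: "3 \<Rightarrow> real^3"
  assumes g[measurable]: "g \<in> borel_measurable borel" and d: "\<delta> > 0" "\<delta> \<le> \<bar>det (\<chi> i j. e j $ i)\<bar>"
  shows "iterated_average [e 3, e 2, e 1] g y \<le> ennreal (1 / \<delta>) * (\<integral>\<^sup>+x. g x \<partial>lborel)"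
proof -
  define A where "A x = (\<chi> i j. e j $ i) *v x" for x :: "real^3"
  have A: "linear A" unfolding A_def by (rule matrix_vector_mul_linear)
  have mA: "matrix A = (\<chi> i j. e j $ i)" unfolding A_def by (rule matrix_of_matrix_vector_mul)
  have Am[measurable]: "A \<in> borel_measurable borel"
    by (rule borel_measurable_linear) (rule A)
  have Ae: "A (vector [a, b, c]) = a *\<^sub>R e 1 + b *\<^sub>R e 2 + c *\<^sub>R e 3" for a b c
    by (simp add: A_def vec_eq_iff matrix_vector_mult_def sum_3 mult.commute)
  have "iterated_average [e 3, e 2, e 1] g y \<le> (\<integral>\<^sup>+a. \<integral>\<^sup>+b. \<integral>\<^sup>+c. g (y - a *\<^sub>R e 1 - b *\<^sub>R e 2 - c *\<^sub>R e 3) \<partial>lborel \<partial>lborel \<partial>lborel)"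
  proof -
    have ind: "indicator {0..1::real} s * h \<le> h" for s and h :: ennreal
      by (auto simp: indicator_def)
    then show ?thesis
      unfolding iterated_average.simps
      by (intro nn_integral_mono order_trans[OF ind] order_refl)
  qed
  also have "\<dots> = (\<integral>\<^sup>+a. \<integral>\<^sup>+b. \<integral>\<^sup>+c. g (y - A (vector [a, b, c])) \<partial>lborel \<partial>lborel \<partial>lborel)"
    by (simp add: Ae diff_diff_add)
  also have "\<dots> = (\<integral>\<^sup>+x. g (y - A x) \<partial>lborel)"
    by (rule nn_integral_lborel_vec3) measurable
  also have "\<dots> \<le> ennreal (1 / \<delta>) * (ennreal \<bar>det (matrix A)\<bar> * (\<integral>\<^sup>+x. g (y - A x) \<partial>lborel))"
  proof -
    have "1 \<le> 1 / \<delta> * \<bar>det (matrix A)\<bar>" using d by (simp add: mA field_simps)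
    then have "1 \<le> ennreal (1 / \<delta>) * ennreal \<bar>det (matrix A)\<bar>"
      using d by (simp add: ennreal_mult'[symmetric])
    from mult_right_mono[OF this, of "\<integral>\<^sup>+x. g (y - A x) \<partial>lborel"] show ?thesis by (simp add: mult.assoc)
  qed
  also have "ennreal \<bar>det (matrix A)\<bar> * (\<integral>\<^sup>+x. g (y - A x) \<partial>lborel) = (\<integral>\<^sup>+x. g (y - x) \<partial>lborel)"
    by (rule nn_integral_lborel_linear[OF A, of "\<lambda>x. g (y - x)"]) (use d in \<open>auto simp: mA\<close>)
  also have "\<dots> = (\<integral>\<^sup>+x. g x \<partial>lborel)" by (rule nn_integral_lborel_reflect) fact
  finally show ?thesis .
qed

text \<open>A convex domain contains, at each of its points \<open>x\<close>, a parallelepiped with vertex \<open>x\<close> whose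
  volume is bounded below: its edges point towards \<open>x\<^sub>0 \<plusminus> r axis i\<close>, with signs chosen so that all
  terms of the determinant have the same sign.\<close>

lemma det_cone_lower_bound:
  fixes w :: "real^3"
  assumes "r > 0"
  defines "\<sigma> \<equiv> (\<lambda>j. if w $ j \<ge> 0 then 1 else -1 :: real)"
  shows "r ^ 3 \<le> \<bar>det (\<chi> i j. (w + (r * \<sigma> j) *\<^sub>R axis j 1) $ i)\<bar>"
proof -
  have \<sigma>: "\<sigma> j * w $ j = \<bar>w $ j\<bar>" "\<sigma> j * \<sigma> j = 1" "\<bar>\<sigma> j\<bar> = 1" for j by (auto simp: \<sigma>_def)
  define d where "d = det (\<chi> i j. (w + (r * \<sigma> j) *\<^sub>R axis j 1) $ i)"
  have "d = r^3 * (\<sigma> 1 * \<sigma> 2 * \<sigma> 3) + r^2 * (w $ 1 * \<sigma> 2 * \<sigma> 3 + \<sigma> 1 * w $ 2 * \<sigma> 3 + \<sigma> 1 * \<sigma> 2 * w $ 3)"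
    unfolding d_def det_3 by (simp add: axis_def power3_eq_cube power2_eq_square algebra_simps)
  \<comment> \<open>The product of the three signs turns each coordinate of w into its absolute
    value, all remaining signs being squared.\<close>
  then have "\<sigma> 1 * \<sigma> 2 * \<sigma> 3 * d = r^3 * ((\<sigma> 1 * \<sigma> 1) * (\<sigma> 2 * \<sigma> 2) * (\<sigma> 3 * \<sigma> 3)) 
    + r^2 * ((\<sigma> 1 * w $ 1) * (\<sigma> 2 * \<sigma> 2) * (\<sigma> 3 * \<sigma> 3) + (\<sigma> 1 * \<sigma> 1) * (\<sigma> 2 * w $ 2) * (\<sigma> 3 * \<sigma> 3) + (\<sigma> 1 * \<sigma> 1) * (\<sigma> 2 * \<sigma> 2) * (\<sigma> 3 * w $ 3))"
    by (simp only: algebra_simps)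
  also have "\<dots> = r^3 + r^2 * (\<bar>w $ 1\<bar> + \<bar>w $ 2\<bar> + \<bar>w $ 3\<bar>)" by (simp only: \<sigma> mult_1_right mult_1_left)
  finally have "\<sigma> 1 * \<sigma> 2 * \<sigma> 3 * d \<ge> r^3" by simp
  moreover have "\<bar>\<sigma> 1 * \<sigma> 2 * \<sigma> 3 * d\<bar> = \<bar>d\<bar>" by (simp add: abs_mult \<sigma>)
  ultimately show ?thesis unfolding d_def by linarith
qed

text \<open>For \<phi> \<ge> 0 supported near x, the weak bound with three edges gives that the
  integral of v \<phi> is at most C / \<delta> times the integral of \<phi>, in absolute value. The
  radius of the neighbourhood depends on x, but C and \<delta> do not, so the pointwise bound C /
  \<delta> holds on all of D.\<close>

lemma Sobolev_3_bounded:
  fixes D :: "(real^3) set"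
  assumes D: "open D" "bounded D" "convex D" and v: "v \<in> Sobolev 3 D"
  obtains M where "AE x in lebesgue_on D. \<bar>v x\<bar> \<le> M"
proof (cases "D = {}")
  case True
  then have "AE x in lebesgue_on D. \<bar>v x\<bar> \<le> 0"
    by (intro AE_I2) (auto simp: space_restrict_space)
  then show thesis by (rule that)
next
  case False
  then obtain x0 where "x0 \<in> D" by auto
  then obtain r where r: "r > 0" "cball x0 r \<subseteq> D" using D(1) open_contains_cball by blast
  obtain R where R: "R > 0" "\<And>x. x \<in> D \<Longrightarrow> norm x \<le> R" using D(2) bounded_pos by metis
  have Dm: "D \<in> lmeasurable" "D \<in> sets lebesgue" using D(1,2) by (auto simp: bounded_set_imp_lmeasurable)
  obtain C where C: "C \<ge> 0" "\<And>es \<phi> K B. length es = 3 \<and> sweep_admissible D R es \<phi> K B \<Longrightarrow>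
     \<bar>LINT x|lebesgue_on D. v x * \<phi> x\<bar> \<le> C * B"
    using Sobolev_weak_bound[OF D(1) Dm(1), of R v 3] v R(1) by (auto simp del: Sobolev.simps)
  \<comment> \<open>64 is the cube of 4: the edges are scaled by 1/4, which divides the determinant
    bound \<open>r ^ 3\<close> by 64.\<close>
  define \<delta> where "\<delta> = r^3 / 64"
  have \<delta>: "\<delta> > 0" using r by (simp add: \<delta>_def)
  have "AE x in lebesgue_on D. \<bar>v x\<bar> \<le> C / \<delta>"
  proof (rule AE_lebesgue_on_local[OF D(1)])
    fix x assume x: "x \<in> D"
    define w where "w = x0 - x"
    define \<sigma> where "\<sigma> j = (if w $ j \<ge> 0 then 1 else -1 :: real)" for j
    define c where "c j = x0 + (r * \<sigma> j) *\<^sub>R axis j 1" for j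
    \<comment> \<open>With the factor 1/4 the three coefficients in [0,1] together use at most
      weight 3/4, so every point reached from x is a convex combination of x and the three points
      \<open>c j\<close>.\<close>
    define e where "e j = (1/4) *\<^sub>R (c j - x)" for j
    have cD: "c j \<in> D" for j
      using r by (intro subsetD[OF r(2)]) (auto simp: c_def dist_norm \<sigma>_def)
    have eR: "norm (e j) \<le> R" for j
      using norm_triangle_ineq4[of "c j" x] R(2)[OF cD[of j]] R(2)[OF x] R(1) by (simp add: e_def)
    have det: "\<delta> \<le> \<bar>det (\<chi> i j. e j $ i)\<bar>"
    proof -
      have det4: "det ((1/4) *\<^sub>R X) = (1/64) * det X" for X :: "real^3^3"
        by (simp add: det_3 field_simps)
      have "(\<chi> i j. e j $ i) = (1/4) *\<^sub>R (\<chi> i j. (w + (r * \<sigma> j) *\<^sub>R axis j 1) $ i)"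
        by (simp add: vec_eq_iff e_def c_def w_def)
      then have "det (\<chi> i j. e j $ i) = (1/64) * det (\<chi> i j. (w + (r * \<sigma> j) *\<^sub>R axis j 1) $ i)"
        by (simp only: det4)
      then show ?thesis
        using det_cone_lower_bound[OF r(1), of w] unfolding \<sigma>_def \<delta>_def by (simp add: abs_mult)
    qed
    define P where "P = convex hull {x, c 1, c 2, c 3}"
    \<comment> \<open>Compactness leaves a margin d around the tetrahedron P, so a whole ball around
      x, and not only x, can be swept inside D.\<close>
    have "compact P" unfolding P_def by (intro finite_imp_compact_convex_hull) auto
    moreover have "P \<subseteq> D" unfolding P_def using x cD by (intro hull_minimal D(3)) auto
    ultimately obtain d where d: "d > 0" "(\<Union>p\<in>P. cball p d) \<subseteq> D"
      using compact_subset_open_imp_cball_epsilon_subset[of P D] D(1) by blast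
    have sw: "sweeps (cball x d) [e 3, e 2, e 1] \<subseteq> D"
    proof
      fix z assume "z \<in> sweeps (cball x d) [e 3, e 2, e 1]"
      then obtain k s1 s2 s3 where k: "k \<in> cball x d" and s: "s1 \<in> {0..1}" "s2 \<in> {0..1}" "s3 \<in> {0..1}"
        and z: "z = k + s3 *\<^sub>R e 3 + s2 *\<^sub>R e 2 + s1 *\<^sub>R e 1"
        unfolding sweeps.simps sweep_def by auto
      define p where "p = (1 - s1/4 - s2/4 - s3/4) *\<^sub>R x + (s1/4) *\<^sub>R c 1 + (s2/4) *\<^sub>R c 2 + (s3/4) *\<^sub>R c 3"
      have "p \<in> P"
      proof -
        have "(1 - s1/4 - s2/4 - s3/4) *\<^sub>R x + ((s1/4) *\<^sub>R c 1 + ((s2/4) *\<^sub>R c 2 + (s3/4) *\<^sub>R c 3)) \<in> P"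
        proof -
          have "(\<Sum>i\<in>{0..3::nat}. (if i = 0 then 1 - s1/4 - s2/4 - s3/4 else if i = 1 then s1/4 else if i = 2 then s2/4 else s3/4)
             *\<^sub>R (if i = 0 then x else if i = 1 then c 1 else if i = 2 then c 2 else c 3)) \<in> P"
            unfolding P_def
            by (intro convex_sum convex_convex_hull) (use s in \<open>auto simp: numeral_3_eq_3 intro!: hull_inc\<close>)
          then show ?thesis by (simp add: numeral_3_eq_3 numeral_2_eq_2 add.assoc)
        qed
        then show ?thesis by (simp add: p_def add.assoc)
      qed
      moreover have "z - p = k - x"
        unfolding z p_def e_def by (simp add: algebra_simps)
      then have "dist p z = dist x k" by (metis dist_norm dist_commute)
      then have "z \<in> cball p d" using k by simp
      ultimately show "z \<in> D" using d(2) by blast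
    qed
    define N where "N = ball x d"
    have "x \<in> P" unfolding P_def by (rule hull_inc) simp
    then have "cball x d \<subseteq> D" using d by blast
    then have ND: "N \<subseteq> D" "open N" "N \<in> lmeasurable" "x \<in> N"
      using d(1) by (auto simp: N_def)
    have Nm: "N \<in> sets lebesgue" using ND(3) by auto
    have bound: "\<bar>LINT x|lebesgue_on N. v x * \<phi> x\<bar> \<le> C / \<delta> * (LINT x|lebesgue_on N. \<phi> x)"
      if \<phi>: "\<phi> \<in> test_functions N" and nn: "\<And>x. 0 \<le> \<phi> x" for \<phi>
    proof -
      have \<phi>D: "\<phi> \<in> test_functions D" using \<phi> test_functions_mono[OF ND(1)] by blast
      have \<phi>b: "\<phi> \<in> borel_measurable borel"
        by (intro borel_measurable_continuous_onI smooth_continuous test_functions_smooth[OF \<phi>])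
      define B where "B = (1 / \<delta>) * (LINT x|lebesgue_on N. \<phi> x)"
      have iN: "integrable (lebesgue_on N) \<phi>"
        by (intro L2_space_integrable test_functions_L2[OF \<phi>] ND Nm)
      have "(\<integral>\<^sup>+x. ennreal \<bar>\<phi> x\<bar> \<partial>lborel) = (\<integral>\<^sup>+x. ennreal (\<phi> x) \<partial>lebesgue)"
        using nn \<phi>b by (simp add: nn_integral_completion)
      also have "\<dots> = (\<integral>\<^sup>+x. ennreal (\<phi> x) \<partial>lebesgue_on N)"
        using test_functions_outside[OF \<phi>] Nm
        by (subst nn_integral_restrict_space) (auto intro!: nn_integral_cong simp: indicator_def)
      also have "\<dots> = ennreal (LINT x|lebesgue_on N. \<phi> x)"
        using iN nn by (intro nn_integral_eq_integral) auto
      finally have I: "(\<integral>\<^sup>+x. ennreal \<bar>\<phi> x\<bar> \<partial>lborel) = ennreal (LINT x|lebesgue_on N. \<phi> x)" .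
      have Bn: "0 \<le> B" using nn \<delta> by (simp add: B_def Bochner_Integration.integral_nonneg)
      have "sweep_admissible D R [e 3, e 2, e 1] \<phi> (cball x d) B"
        unfolding sweep_admissible_def
      proof (intro conjI allI impI)
        show "smooth \<phi>" by (rule test_functions_smooth[OF \<phi>])
        show "\<phi> y = 0" if "y \<notin> cball x d" for y
          using test_functions_outside[OF \<phi>, of y] that by (auto simp: N_def)
        fix y
        have "iterated_average [e 3, e 2, e 1] (\<lambda>y. ennreal \<bar>\<phi> y\<bar>) y \<le> ennreal (1 / \<delta>) * (\<integral>\<^sup>+x. ennreal \<bar>\<phi> x\<bar> \<partial>lborel)"
          by (rule iterated_average_le_integral[OF _ \<delta> det]) (use \<phi>b in measurable)
        also have "\<dots> = ennreal B"
          unfolding I B_def using \<delta> by (intro ennreal_mult'[symmetric]) auto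
        finally show "iterated_average [e 3, e 2, e 1] (\<lambda>y. ennreal \<bar>\<phi> y\<bar>) y \<le> ennreal B" .
      qed (use eR sw Bn in auto)
      then have "\<bar>LINT x|lebesgue_on D. v x * \<phi> x\<bar> \<le> C * B" using C(2)[of "[e 3, e 2, e 1]"] by simp
      moreover have "(LINT x|lebesgue_on N. v x * \<phi> x) = (LINT x|lebesgue_on D. v x * \<phi> x)"
        using test_functions_outside[OF \<phi>] by (intro LINT_lebesgue_on_subset Dm Nm ND) auto
      ultimately show ?thesis by (simp add: B_def)
    qed
    have vN: "integrable (lebesgue_on N) v"
      using L2_space_subset[OF Sobolev_L2[OF v] ND(1) Nm Dm(2)] ND by (intro L2_space_integrable)
    have "AE y in lebesgue_on N. v y \<le> C / \<delta>"
      by (rule AE_le_of_test_functions[OF ND(2,3) vN]) (use bound in \<open>fastforce simp: abs_le_iff\<close>)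
    moreover have "AE y in lebesgue_on N. - v y \<le> C / \<delta>"
      by (rule AE_le_of_test_functions[OF ND(2,3)]) (use vN bound in \<open>fastforce simp: abs_le_iff\<close>)+
    ultimately have "AE y in lebesgue_on N. \<bar>v y\<bar> \<le> C / \<delta>" by eventually_elim auto
    then show "\<exists>N. open N \<and> x \<in> N \<and> (AE y in lebesgue_on N. \<bar>v y\<bar> \<le> C / \<delta>)" using ND by blast
  qed
  then show thesis by (rule that)
qed

section \<open>Surface measure on the flat part of the boundary\<close>

lemma emb_component [simp]: "emb z $ 1 = z $ 1" "emb z $ 2 = z $ 2" "emb z $ 3 = 0"
  by (simp_all add: emb_def)

lemma proj_component [simp]: "proj y $ 1 = y $ 1" "proj y $ 2 = y $ 2"
  by (simp_all add: proj_def)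

lemma proj_emb [simp]: "proj (emb z) = z"
  by (simp add: vec_eq_iff forall_2)

lemma emb_proj: "y $ 3 = 0 \<Longrightarrow> emb (proj y) = y"
  by (simp add: vec_eq_iff forall_3)

lemma linear_emb: "linear emb"
  by (rule linearI) (simp_all add: vec_eq_iff forall_3)

lemma linear_proj: "linear proj"
  by (rule linearI) (simp_all add: vec_eq_iff forall_2)

lemma continuous_on_proj: "continuous_on S proj"
  by (rule linear_continuous_on_euclidean[OF linear_proj])

lemma continuous_on_emb: "continuous_on S emb"
  by (rule linear_continuous_on_euclidean[OF linear_emb])

lemma proj_measurable [measurable]: "proj \<in> borel_measurable borel"
  by (intro borel_measurable_continuous_onI continuous_on_proj)

lemma norm_emb [simp]: "norm (emb z) = norm z"
  by (simp add: norm_vec_def L2_set_def sum_3 sum_2)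

lemma emb_image_eq: "emb ` B = {y. y $ 3 = 0 \<and> proj y \<in> B}"
  using emb_proj by (force simp: image_iff)

lemma emb_image_borel:
  assumes "B \<in> sets borel" shows "emb ` B \<in> sets borel"
proof -
  have "proj -` B \<inter> space borel \<in> sets borel" using assms by (rule measurable_sets[OF proj_measurable])
  moreover have "closed {y::real^3. y $ 3 = 0}" by (intro closed_Collect_eq continuous_intros)
  ultimately have "{y. y $ 3 = 0} \<inter> proj -` B \<in> sets borel" by auto
  also have "{y. y $ 3 = 0} \<inter> proj -` B = emb ` B" by (auto simp: emb_image_eq)
  finally show ?thesis .
qed

lemma Basis_vec2: "(Basis :: (real^2) set) = {axis 1 1, axis 2 1}"
  by (auto simp: Basis_vec_def UNIV_2)

text \<open>A square of side s has diameter at most sqrt 2 times s, so its cost is at most pi s^2 /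
  2. With pi < 4 this gives the factor 2.\<close>

lemma square_cover_content:
  fixes u v :: "real^2"
  assumes "\<forall>i\<in>Basis. v \<bullet> i - u \<bullet> i = s" "s \<ge> 0"
  shows "ennreal (unit_ball_vol (real 2) * (diameter (emb ` cbox u v) / 2) ^ 2) \<le> 2 * emeasure lborel (box u v)"
proof -
  have s: "v $ 1 - u $ 1 = s" "v $ 2 - u $ 2 = s"
    using assms(1) by (auto simp: Basis_vec2 inner_axis)
  have "diameter (emb ` cbox u v) \<le> sqrt 2 * s"
  proof (rule diameter_le)
    fix x y assume "x \<in> emb ` cbox u v" "y \<in> emb ` cbox u v"
    then obtain x' y' where x: "x = emb x'" "y = emb y'" "x' \<in> cbox u v" "y' \<in> cbox u v" by auto
    have "\<bar>x' $ i - y' $ i\<bar> \<le> s" for i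
      using x(3,4) s exhaust_2[of i] by (auto simp: mem_box Basis_vec2 inner_axis)
    then have sq: "(x' $ i - y' $ i)\<^sup>2 \<le> s\<^sup>2" for i using abs_le_square_iff assms(2) by fastforce
    have "(norm (x' - y'))\<^sup>2 \<le> s\<^sup>2 + s\<^sup>2"
      using sq[of 1] sq[of 2] unfolding power2_norm_eq_inner inner_vec_def sum_2 by (simp add: power2_eq_square)
    then have "norm (x' - y') \<le> sqrt (2 * s\<^sup>2)" by (intro real_le_rsqrt) simp
    also have "\<dots> = sqrt 2 * s" using assms(2) by (simp add: real_sqrt_mult)
    finally show "norm (x - y) \<le> sqrt 2 * s"
      unfolding x using norm_emb[of "x' - y'"] linear_diff[OF linear_emb, of x' y'] by simp
  qed (use assms(2) in simp)
  moreover have "0 \<le> diameter (emb ` cbox u v)"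
    by (intro diameter_ge_0 compact_imp_bounded compact_continuous_image continuous_on_emb compact_cbox)
  ultimately have "(diameter (emb ` cbox u v) / 2)\<^sup>2 \<le> (sqrt 2 * s / 2)\<^sup>2"
    by (intro power_mono) auto
  also have "\<dots> = s\<^sup>2 / 2" by (simp add: power_divide power_mult_distrib)
  finally have "unit_ball_vol (real 2) * (diameter (emb ` cbox u v) / 2) ^ 2 \<le> pi * (s\<^sup>2 / 2)"
    by (simp add: unit_ball_vol_2 mult_left_mono)
  also have "\<dots> \<le> 4 * (s\<^sup>2 / 2)" using pi_less_4 by (intro mult_right_mono) auto
  also have "\<dots> = 2 * (\<Prod>b\<in>Basis. (v - u) \<bullet> b)"
    using s by (simp add: Basis_vec2 inner_axis power2_eq_square axis_eq_axis)
  finally have "ennreal (unit_ball_vol (real 2) * (diameter (emb ` cbox u v) / 2) ^ 2) \<le> ennreal (2 * (\<Prod>b\<in>Basis. (v - u) \<bullet> b))"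
    by (rule ennreal_leI)
  also have "\<dots> = 2 * emeasure lborel (box u v)"
    using assms by (subst emeasure_lborel_box) (auto simp: ennreal_mult' inner_diff_left)
  finally show ?thesis .
qed

text \<open>B is covered by dyadic squares with disjoint interiors inside an open set G barely
  larger than B. Each square costs at most twice its area, so the total is at most twice the measure
  of G, whatever bound \<delta> on the diameters is imposed.\<close>

lemma hausdorff_outer_emb_le:
  fixes B :: "(real^2) set"
  assumes B: "B \<in> sets borel" "bounded B"
  shows "hausdorff_outer 2 (emb ` B) \<le> 2 * emeasure lborel B"
  unfolding hausdorff_outer_def
proof (rule SUP_least)
  fix \<delta> :: real assume "\<delta> \<in> {0<..}"
  then have \<delta>: "\<delta> > 0" by simp
  let ?c = "\<lambda>V. if V = {} then 0 else ennreal (unit_ball_vol (real 2) * (diameter V / 2) ^ 2)"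
  show "(INF V\<in>{V :: nat \<Rightarrow> (real^3) set. emb ` B \<subseteq> (\<Union>i. V i) \<and> (\<forall>i. bounded (V i) \<and> diameter (V i) \<le> \<delta>)}.
          (\<Sum>i. ?c (V i))) \<le> 2 * emeasure lborel B" (is "?I \<le> _")
  proof (rule ennreal_le_epsilon)
    fix \<epsilon> :: real assume \<epsilon>: "\<epsilon> > 0"
    \<comment> \<open>Half of \<epsilon>, since the measure of G will be doubled.\<close>
    obtain G where G: "open G" "B \<subseteq> G" "emeasure lborel (G - B) \<le> ennreal (\<epsilon> / 2)"
      using outer_regular_lborel_le[OF B(1), of "\<epsilon> / 2"] \<epsilon> by auto
    have "emeasure lborel G = emeasure lborel (B \<union> (G - B))" using G(2) by (simp add: Un_absorb1)
    also have "\<dots> \<le> emeasure lborel B + emeasure lborel (G - B)"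
      using B G by (intro emeasure_subadditive) auto
    also have "\<dots> \<le> emeasure lborel B + ennreal (\<epsilon> / 2)" using G(3) by (intro add_left_mono)
    finally have "2 * emeasure lborel G \<le> 2 * (emeasure lborel B + ennreal (\<epsilon> / 2))" by (intro mult_left_mono) auto
    also have "\<dots> = 2 * emeasure lborel B + ennreal \<epsilon>"
      using \<epsilon> ennreal_mult'[of 2 "\<epsilon> / 2"] by (simp add: distrib_left)
    finally have Gle: "2 * emeasure lborel G \<le> 2 * emeasure lborel B + ennreal \<epsilon>" .
    obtain N where N: "N > 0" "\<And>x. x \<in> B \<Longrightarrow> norm x \<le> N" using B(2) bounded_pos by metis
    define a b :: "real^2" where "a = (- N) *\<^sub>R One" and "b = N *\<^sub>R One"
    have ab: "B \<subseteq> cbox a b"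
    proof
      fix x assume "x \<in> B"
      then have "\<bar>x \<bullet> i\<bar> \<le> N" if "i \<in> Basis" for i using N(2)[of x] Basis_le_norm[OF that, of x] by linarith
      then show "x \<in> cbox a b" by (force simp: mem_box a_def b_def abs_le_iff)
    qed
    have ne: "box a b \<noteq> {}" using N(1) by (auto simp: box_ne_empty a_def b_def)
    \<comment> \<open>The gauge forces each square to lie in G and to have diameter at most
      \<delta>. The second case only completes the gauge outside G; the tags lie in B, hence in
      G.\<close>
    define g where "g x = (if x \<in> G then ball x (\<delta> / 2) \<inter> G else ball x 1)" for x :: "real^2"
    have gauge: "gauge g" unfolding gauge_def g_def using G(1) \<delta> by auto
    obtain \<D> where \<D>: "countable \<D>" "\<Union>\<D> \<subseteq> cbox a b"
      "\<And>K. K \<in> \<D> \<Longrightarrow> interior K \<noteq> {} \<and> (\<exists>c d. K = cbox c d)"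
      "pairwise (\<lambda>A B. interior A \<inter> interior B = {}) \<D>"
      "\<And>K. K \<in> \<D> \<Longrightarrow> \<exists>x \<in> B \<inter> K. K \<subseteq> g x"
      "\<And>u v. cbox u v \<in> \<D> \<Longrightarrow> \<exists>n. \<forall>i \<in> Basis. v \<bullet> i - u \<bullet> i = (b \<bullet> i - a \<bullet> i) / 2^n"
      "B \<subseteq> \<Union>\<D>"
      using covering_lemma[OF ab ne gauge] by blast
    define W where "W i = (if i \<in> to_nat_on \<D> ` \<D> then from_nat_into \<D> i else {})" for i
    have W: "W i \<in> \<D>" if "i \<in> to_nat_on \<D> ` \<D>" for i
      using that \<D>(1) by (auto simp: W_def)
    have UW: "(\<Union>i. W i) = \<Union>\<D>"
    proof
      show "\<Union>\<D> \<subseteq> (\<Union>i. W i)"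
      proof
        fix x assume "x \<in> \<Union>\<D>"
        then obtain K where K: "K \<in> \<D>" "x \<in> K" by auto
        then have "W (to_nat_on \<D> K) = K" using \<D>(1) by (simp add: W_def)
        then show "x \<in> (\<Union>i. W i)" using K by blast
      qed
      show "(\<Union>i. W i) \<subseteq> \<Union>\<D>" using W by (auto simp: W_def split: if_splits)
    qed
    have disj: "disjoint_family (\<lambda>i. interior (W i))"
      unfolding disjoint_family_on_def
    proof (intro ballI impI)
      fix m n :: nat assume "m \<noteq> n"
      show "interior (W m) \<inter> interior (W n) = {}"
      proof (cases "m \<in> to_nat_on \<D> ` \<D> \<and> n \<in> to_nat_on \<D> ` \<D>")
        case True
        then obtain K L where K: "K \<in> \<D>" "m = to_nat_on \<D> K" and L: "L \<in> \<D>" "n = to_nat_on \<D> L" by auto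
        then have "W m = K" "W n = L" using \<D>(1) by (simp_all add: W_def)
        moreover have "K \<noteq> L" using K L \<open>m \<noteq> n\<close> by auto
        ultimately show ?thesis using \<D>(4) K(1) L(1) by (simp add: pairwise_def)
      qed (auto simp: W_def)
    qed
    have Wprop: "bounded (emb ` W i) \<and> diameter (emb ` W i) \<le> \<delta> \<and> ?c (emb ` W i) \<le> 2 * emeasure lborel (interior (W i)) \<and> interior (W i) \<subseteq> G" for i
    proof (cases "i \<in> to_nat_on \<D> ` \<D>")
      case True
      then obtain u v where K: "W i = cbox u v" "cbox u v \<in> \<D>" using W \<D>(3) by metis
      obtain n where n: "\<forall>i \<in> Basis. v \<bullet> i - u \<bullet> i = (b \<bullet> i - a \<bullet> i) / 2^n" using \<D>(6)[OF K(2)] by blast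
      then have n': "\<forall>i \<in> Basis. v \<bullet> i - u \<bullet> i = 2 * N / 2^n" by (simp add: a_def b_def)
      obtain x where x: "x \<in> B" "cbox u v \<subseteq> g x" using \<D>(5)[OF K(2)] by blast
      have "x \<in> G" using x(1) G(2) by blast
      then have sub: "cbox u v \<subseteq> ball x (\<delta> / 2)" "cbox u v \<subseteq> G" using x(2) by (auto simp: g_def)
      have "diameter (emb ` W i) \<le> \<delta>"
      proof (rule diameter_le)
        fix y z assume "y \<in> emb ` W i" "z \<in> emb ` W i"
        then obtain y' z' where yz: "y = emb y'" "z = emb z'" "y' \<in> ball x (\<delta> / 2)" "z' \<in> ball x (\<delta> / 2)"
          using sub(1) unfolding K(1) by blast
        have "norm (y' - z') \<le> \<delta>"
          using yz(3,4) norm_triangle_ineq4[of "y' - x" "z' - x"] by (simp add: dist_norm norm_minus_commute)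
        then show "norm (y - z) \<le> \<delta>"
          unfolding yz using norm_emb[of "y' - z'"] linear_diff[OF linear_emb, of y' z'] by simp
      qed (use \<delta> in simp)
      moreover have "bounded (emb ` W i)" unfolding K(1)
        by (intro compact_imp_bounded compact_continuous_image continuous_on_emb compact_cbox)
      moreover have "?c (emb ` W i) \<le> 2 * emeasure lborel (interior (W i))"
        using square_cover_content[OF n'] N(1) by (simp add: K(1) interior_cbox)
      moreover have "interior (W i) \<subseteq> G" using sub(2) interior_subset[of "W i"] K(1) by auto
      ultimately show ?thesis by blast
    qed (use \<delta> in \<open>auto simp: W_def\<close>)
    have "?I \<le> (\<Sum>i. ?c (emb ` W i))"
    proof (rule INF_lower, rule CollectI, intro conjI allI)
      show "emb ` B \<subseteq> (\<Union>i. emb ` W i)" using \<D>(7) UW by blast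
    qed (use Wprop in blast)+
    also have "\<dots> \<le> (\<Sum>i. 2 * emeasure lborel (interior (W i)))"
      by (intro suminf_le) (use Wprop in auto)
    also have "\<dots> = 2 * (\<Sum>i. emeasure lborel (interior (W i)))" by (rule ennreal_suminf_cmult)
    also have "(\<Sum>i. emeasure lborel (interior (W i))) = emeasure lborel (\<Union>i. interior (W i))"
      by (rule suminf_emeasure[OF _ disj]) auto
    also have "\<dots> \<le> emeasure lborel G" using Wprop G(1) by (intro emeasure_mono) auto
    finally have "?I \<le> 2 * emeasure lborel G" by (simp add: mult_left_mono)
    then show "?I \<le> 2 * emeasure lborel B + ennreal \<epsilon>" using Gle by (rule order_trans)
  qed
qed

section \<open>Integration against the surface measure\<close>

lemma sets_hausdorff_measure [simp, measurable_cong]: "sets (hausdorff_measure m) = sets borel"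
  unfolding hausdorff_measure_def using sets.sigma_sets_eq[of borel] by simp

lemma space_hausdorff_measure [simp]: "space (hausdorff_measure m) = UNIV"
  unfolding hausdorff_measure_def by (simp add: space_measure_of_conv)

text \<open>A measure built by \<open>measure_of\<close> takes either the prescribed value or 0, so
  the upper bound can be read off from the construction.\<close>

lemma emeasure_hausdorff_measure_le: "emeasure (hausdorff_measure m) A \<le> hausdorff_outer m A"
  unfolding hausdorff_measure_def by (simp add: emeasure_measure_of_conv)

text \<open>Pushing the surface measure on the plate forward along \<open>proj\<close> turns the
  estimate for sets into an inequality between two measures on the plane, which is inherited by
  integrals of non-negative functions.\<close>

lemma nn_integral_hausdorff_emb_le:
  fixes f :: "real^2 \<Rightarrow> ennreal"
  assumes \<Omega>: "open \<Omega>" "bounded \<Omega>" and f[measurable]: "f \<in> borel_measurable borel"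
  shows "(\<integral>\<^sup>+y. indicator (emb ` \<Omega>) y * f (proj y) \<partial>hausdorff_measure 2) \<le> 2 * (\<integral>\<^sup>+z. indicator \<Omega> z * f z \<partial>lborel)"
proof -
  let ?H = "hausdorff_measure 2 :: (real^3) measure"
  have [measurable]: "\<Omega> \<in> sets borel" "emb ` \<Omega> \<in> sets borel" using \<Omega> emb_image_borel by auto
  define M where "M = distr (density ?H (indicator (emb ` \<Omega>))) borel proj"
  define N where "N = density lborel (\<lambda>z. 2 * indicator \<Omega> z :: ennreal)"
  have "M \<le> N"
  proof -
    have "emeasure M \<le> emeasure N"
    proof (rule le_funI)
      fix B show "emeasure M B \<le> emeasure N B"
      proof (cases "B \<in> sets borel")
        case True
        note True[measurable]
        have "emeasure M B = emeasure (density ?H (indicator (emb ` \<Omega>))) (proj -` B)"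
          unfolding M_def by (subst emeasure_distr) auto
        also have "\<dots> = (\<integral>\<^sup>+y. indicator (emb ` \<Omega>) y * indicator (proj -` B) y \<partial>?H)"
          using measurable_sets[OF proj_measurable True] by (intro emeasure_density) auto
        also have "\<dots> = (\<integral>\<^sup>+y. indicator (emb ` (\<Omega> \<inter> B)) y \<partial>?H)"
          by (rule nn_integral_cong) (auto simp: indicator_def)
        also have "\<dots> = emeasure ?H (emb ` (\<Omega> \<inter> B))"
          using emb_image_borel[of "\<Omega> \<inter> B"] by (intro nn_integral_indicator) auto
        also have "\<dots> \<le> 2 * emeasure lborel (\<Omega> \<inter> B)"
          using emeasure_hausdorff_measure_le hausdorff_outer_emb_le[of "\<Omega> \<inter> B"] \<Omega> True
          by (meson bounded_Int order_trans borel_open sets.Int)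
        also have "\<dots> = (\<integral>\<^sup>+z. 2 * indicator (\<Omega> \<inter> B) z \<partial>lborel)"
          by (subst nn_integral_cmult_indicator) auto
        also have "\<dots> = (\<integral>\<^sup>+z. 2 * indicator \<Omega> z * indicator B z \<partial>lborel)"
          by (rule nn_integral_cong) (auto simp: indicator_def)
        also have "\<dots> = emeasure N B"
          unfolding N_def by (rule emeasure_density[symmetric]) auto
        finally show ?thesis .
      qed (simp add: M_def N_def emeasure_notin_sets)
    qed
    then show ?thesis by (simp add: le_measure_iff M_def N_def)
  qed
  then have "(\<integral>\<^sup>+z. f z \<partial>M) \<le> (\<integral>\<^sup>+z. f z \<partial>N)"
    by (intro nn_integral_mono_measure) (simp_all add: M_def N_def)
  moreover have "(\<integral>\<^sup>+z. f z \<partial>M) = (\<integral>\<^sup>+y. indicator (emb ` \<Omega>) y * f (proj y) \<partial>?H)"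
    unfolding M_def by (simp add: nn_integral_distr nn_integral_density)
  moreover have "(\<integral>\<^sup>+z. f z \<partial>N) = 2 * (\<integral>\<^sup>+z. indicator \<Omega> z * f z \<partial>lborel)"
    unfolding N_def by (simp add: nn_integral_density mult.assoc nn_integral_cmult)
  ultimately show ?thesis by simp
qed

text \<open>A square-integrable function on the plate is only Lebesgue measurable. Its lift to the
  boundary is measurable because it agrees with a Borel lift off a surface null set and the boundary
  measure is completed.\<close>

lemma borel_measurable_boundary_measure_AE:
  fixes f g :: "'a::euclidean_space \<Rightarrow> real"
  assumes g: "g \<in> borel_measurable borel" and N: "N \<in> null_sets (hausdorff_measure (DIM('a) - 1))"
    and eq: "\<And>x. x \<notin> N \<Longrightarrow> f x = g x"
  shows "f \<in> borel_measurable (boundary_measure D)"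
proof -
  let ?H = "hausdorff_measure (DIM('a) - 1) :: 'a measure"
  have "f \<in> borel_measurable (completion ?H)"
  proof (rule measurableI)
    fix A :: "real set" assume A: "A \<in> sets borel"
    have 1: "g -` A \<in> sets (completion ?H)"
      using measurable_sets_borel[OF g A] by (intro sets_completionI_sets) simp
    have 2: "f -` A \<inter> N \<in> sets (completion ?H)"
      using N by (intro sets_completionI[of _ "{}" "f -` A \<inter> N" N]) auto
    have 3: "N \<in> sets (completion ?H)" using N by (intro sets_completionI_sets) auto
    have "f -` A = (g -` A - N) \<union> (f -` A \<inter> N)" using eq by auto
    then have "f -` A \<in> sets (completion ?H)" using 1 2 3 by (metis sets.Diff sets.Un)
    then show "f -` A \<inter> space (completion ?H) \<in> sets (completion ?H)" by simp
  qed simp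
  then show ?thesis unfolding boundary_measure_def by (rule measurable_restrict_space1)
qed

lemma AE_boundary_measureI:
  assumes "N \<in> null_sets (hausdorff_measure (DIM('a) - 1))" "\<And>y. y \<in> frontier D \<Longrightarrow> y \<notin> N \<Longrightarrow> P y"
  shows "AE y in boundary_measure D. P (y::'a::euclidean_space)"
proof -
  let ?H = "hausdorff_measure (DIM('a) - 1) :: 'a measure"
  have "AE y in completion ?H. y \<notin> N"
    using assms(1) by (intro AE_completion AE_not_in)
  then have "AE y in completion ?H. y \<in> frontier D \<longrightarrow> P y"
    by eventually_elim (use assms(2) in auto)
  moreover have "frontier D \<in> sets (completion ?H)"
    by (intro sets_completionI_sets) (simp add: borel_closed)
  ultimately show ?thesis
    unfolding boundary_measure_def by (subst AE_restrict_space_iff) auto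
qed

lemma nn_integral_boundary_measure:
  fixes f :: "'a::euclidean_space \<Rightarrow> ennreal"
  shows "(\<integral>\<^sup>+y. f y \<partial>boundary_measure D) = (\<integral>\<^sup>+y. f y * indicator (frontier D) y \<partial>hausdorff_measure (DIM('a) - 1))"
proof -
  let ?H = "hausdorff_measure (DIM('a) - 1) :: 'a measure"
  have "frontier D \<in> sets ?H" by (simp add: borel_closed)
  then have "frontier D \<in> sets (completion ?H)" by (intro sets_completionI_sets)
  then have "(\<integral>\<^sup>+y. f y \<partial>boundary_measure D) = (\<integral>\<^sup>+y. f y * indicator (frontier D) y \<partial>completion ?H)"
    unfolding boundary_measure_def by (subst nn_integral_restrict_space) auto
  also have "\<dots> = (\<integral>\<^sup>+y. f y * indicator (frontier D) y \<partial>?H)"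
    by (rule nn_integral_completion)
  finally show ?thesis .
qed

section \<open>Extension of plate fields into the domain\<close>

lemma nn_integral_lborel_slices:
  fixes g :: "real^3 \<Rightarrow> ennreal"
  assumes g[measurable]: "g \<in> borel_measurable borel"
  shows "(\<integral>\<^sup>+s. \<integral>\<^sup>+z. g (vector [(z::real^2) $ 1, z $ 2, s]) \<partial>lborel \<partial>lborel) = (\<integral>\<^sup>+x. g x \<partial>lborel)"
proof -
  define F :: "real \<times> (real^2) \<Rightarrow> real^3" where "F p = vector [snd p $ 1, snd p $ 2, fst p]" for p
  have lin: "linear F"
    by (rule linearI) (auto simp: F_def vec_eq_iff forall_3)
  have Fm[measurable]: "F \<in> borel_measurable borel"
    by (rule borel_measurable_linear) (rule lin)
  have "F ` Basis = Basis"
    by (auto simp: Basis_prod_def Basis_vec3 Basis_vec2 F_def vec_eq_iff forall_3 axis_def image_iff)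
  moreover have "inj_on F Basis"
    by (rule inj_onI) (auto simp: F_def vec_eq_iff forall_3 forall_2 prod_eq_iff)
  ultimately have bij: "bij_betw F Basis Basis" by (simp add: bij_betw_def)
  have "(\<integral>\<^sup>+x. g x \<partial>lborel) = (\<integral>\<^sup>+x. g x \<partial>distr lborel borel F)"
    by (simp add: lborel_distr_Basis_bij[OF lin bij])
  also have "\<dots> = (\<integral>\<^sup>+p. g (F p) \<partial>lborel)"
    by (rule nn_integral_distr) auto
  also have "\<dots> = (\<integral>\<^sup>+p. g (F p) \<partial>(lborel \<Otimes>\<^sub>M lborel))"
    by (simp add: lborel_prod)
  also have "\<dots> = (\<integral>\<^sup>+a. \<integral>\<^sup>+q. g (F (a, q)) \<partial>lborel \<partial>lborel)"
    by (rule lborel.nn_integral_fst[symmetric]) (simp add: lborel_prod)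
  finally show ?thesis by (simp add: F_def)
qed

text \<open>The substitution has Jacobian c to the dimension, at least 1. The case needed is c = 1/t
  on a slice of the cone at height t \<le> 1.\<close>

lemma nn_integral_lborel_dilation_le:
  fixes f :: "'a::euclidean_space \<Rightarrow> ennreal"
  assumes [measurable]: "f \<in> borel_measurable borel" and c: "c \<ge> 1"
  shows "(\<integral>\<^sup>+z. f (b + c *\<^sub>R z) \<partial>lborel) \<le> (\<integral>\<^sup>+z. f z \<partial>lborel)"
proof -
  have "(\<integral>\<^sup>+z. f z \<partial>lborel) = (\<integral>\<^sup>+z. f z \<partial>density (distr lborel borel (\<lambda>x. b + c *\<^sub>R x)) (\<lambda>_. ennreal (\<bar>c\<bar>^DIM('a))))"
    using lborel_affine[of c b] c by simp
  also have "\<dots> = ennreal (\<bar>c\<bar>^DIM('a)) * (\<integral>\<^sup>+z. f (b + c *\<^sub>R z) \<partial>lborel)"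
    by (subst nn_integral_density) (auto simp: nn_integral_distr nn_integral_cmult)
  also have "\<dots> \<ge> 1 * (\<integral>\<^sup>+z. f (b + c *\<^sub>R z) \<partial>lborel)"
    using c by (intro mult_right_mono) auto
  finally show ?thesis by simp
qed

text \<open>Coordinates on the cone over the plane \<open>{x\<^sub>3 = 0}\<close> with apex \<open>(p\<^sub>0, -a)\<close>: the height
  \<open>cone_height\<close> is \<open>0\<close> at the apex and \<open>1\<close> on the plane, and \<open>cone_map\<close> is the central projection onto
  the plane.  The function \<open>reciprocal_cutoff\<close> agrees with \<open>1/t\<close> for \<open>t \<ge> 1/4\<close>.\<close>

definition cone_height :: "real \<Rightarrow> real^3 \<Rightarrow> real" where
  "cone_height a x = 1 + x $ 3 / a"

definition reciprocal_cutoff :: "real \<Rightarrow> real" where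
  "reciprocal_cutoff t = t * inverse (t * t + flat_exp 0 (1/4 - t))"

definition cone_map :: "real \<Rightarrow> real^2 \<Rightarrow> real^3 \<Rightarrow> real^2" where
  "cone_map a p0 x = p0 + reciprocal_cutoff (cone_height a x) *\<^sub>R (proj x - p0)"

text \<open>The normalising value is the one at height 1, so the cutoff equals 1 on the plane of the
  plate. It vanishes up to height 1/2, well above the range t < 1/4 where
  \<open>reciprocal_cutoff\<close> departs from 1/t.\<close>

definition cone_cutoff :: "real \<Rightarrow> real^3 \<Rightarrow> real" where
  "cone_cutoff a x = flat_exp 0 (cone_height a x - 1/2) * inverse (flat_exp 0 (1/2))"

lemma smooth_cone_height: "smooth (cone_height a)"
proof -
  have "smooth (\<lambda>x::real^3. x \<bullet> axis 3 1)" by (intro smooth_linear bounded_linear_inner_left)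
  then have "smooth (\<lambda>x::real^3. 1 + (1 / a) * (x \<bullet> axis 3 1))"
    by (intro smooth_add smooth_mult smooth_const)
  then show ?thesis by (simp add: cone_height_def[abs_def] inner_axis)
qed

text \<open>For t < 1/4 the added \<open>flat_exp\<close> is positive, from 1/4 on the square is.
  Thus the modified reciprocal is smooth on the whole line, including the height 0 of the
  apex.\<close>

lemma reciprocal_cutoff_pos: "t * t + flat_exp 0 (1/4 - t) > 0"
proof (cases "t < 1/4")
  case True
  then have "flat_exp 0 (1/4 - t) > 0" by (simp add: flat_exp_def)
  then show ?thesis by (simp add: add_nonneg_pos)
next
  case False
  then have "t * t > 0" "flat_exp 0 (1/4 - t) = 0" by (auto simp: flat_exp_def)
  then show ?thesis by simp
qed

lemma smooth_reciprocal_cutoff: "smooth reciprocal_cutoff"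
proof -
  have id: "smooth (\<lambda>t::real. t)" by (intro smooth_linear bounded_linear_ident)
  have "smooth (\<lambda>t::real. flat_exp 0 (1/4 - t))"
    by (rule smooth_compose_real[OF smooth_flat_exp]) (intro smooth_diff smooth_const id)
  then show ?thesis unfolding reciprocal_cutoff_def[abs_def]
    using reciprocal_cutoff_pos
    by (intro smooth_mult smooth_inverse smooth_add id) (auto simp: less_imp_neq[symmetric])
qed

lemma reciprocal_cutoff_eq: "t \<ge> 1/4 \<Longrightarrow> reciprocal_cutoff t = 1 / t"
  by (simp add: reciprocal_cutoff_def flat_exp_def field_simps)

lemma smooth_cone_map: 
  assumes "c \<in> Basis" shows "smooth (\<lambda>x. cone_map a p0 x \<bullet> c)"
proof -
  have "smooth (\<lambda>x. proj x \<bullet> c)"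
    using linear_proj by (intro smooth_linear bounded_linear_inner_left_comp) (simp add: linear_conv_bounded_linear)
  moreover have "smooth (\<lambda>x. reciprocal_cutoff (cone_height a x))"
    by (rule smooth_compose_real[OF smooth_reciprocal_cutoff smooth_cone_height])
  ultimately have "smooth (\<lambda>x. p0 \<bullet> c + reciprocal_cutoff (cone_height a x) * (proj x \<bullet> c - p0 \<bullet> c))"
    by (intro smooth_add smooth_mult smooth_diff smooth_const)
  then show ?thesis by (simp add: cone_map_def inner_add_left inner_diff_left)
qed

lemma smooth_cone_cutoff: "smooth (cone_cutoff a)"
proof -
  have "smooth (\<lambda>x. flat_exp 0 (cone_height a x - 1/2))"
    by (rule smooth_compose_real[OF smooth_flat_exp]) (intro smooth_diff smooth_const smooth_cone_height)
  then show ?thesis unfolding cone_cutoff_def[abs_def] by (intro smooth_mult smooth_const)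
qed

lemma cone_cutoff_eq_0: "cone_height a x \<le> 1/2 \<Longrightarrow> cone_cutoff a x = 0"
  by (simp add: cone_cutoff_def flat_exp_def)

lemma cone_cutoff_eq_1: "cone_height a x = 1 \<Longrightarrow> cone_cutoff a x = 1"
  by (simp add: cone_cutoff_def flat_exp_def)

lemma continuous_cone_height: "continuous_on S (cone_height a)"
  using smooth_continuous[OF smooth_cone_height] continuous_on_subset by blast

lemma pderivative_cone_cutoff_eq_0:
  assumes "cone_height a x < 1/2" shows "pderivative b (cone_cutoff a) x = 0"
proof (rule pderivative_eq_0[of "{x. cone_height a x < 1/2}"])
  show "open {x. cone_height a x < 1/2}"
    by (intro open_Collect_less continuous_intros continuous_cone_height)
qed (use assms cone_cutoff_eq_0 in \<open>auto simp: less_imp_le\<close>)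

lemma cone_map_measurable [measurable]: "cone_map a p0 \<in> borel_measurable borel"
proof -
  have "continuous_on UNIV (cone_map a p0)"
    by (subst continuous_on_componentwise) (auto intro: smooth_continuous smooth_cone_map)
  then show ?thesis by (rule borel_measurable_continuous_onI)
qed

lemma closed_cone_slab: "closed {x. cone_height a x \<ge> 1/4 \<and> x $ 3 \<le> 0}"
  by (intro closed_Collect_conj closed_Collect_le continuous_intros continuous_cone_height)

text \<open>On the horizontal slice at height t the central projection is a dilation by 1/t \<ge> 1,
  so the slice contributes at most the integral of f. The relevant slices lie over [-a,0], an
  interval of length a.\<close>

lemma cone_map_nn_integral_le:
  fixes f :: "real^2 \<Rightarrow> ennreal"
  assumes a: "a > 0" and f[measurable]: "f \<in> borel_measurable borel"
  shows "(\<integral>\<^sup>+x. indicator {x. cone_height a x \<ge> 1/4 \<and> x $ 3 \<le> 0} x * f (cone_map a p0 x) \<partial>lborel)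
    \<le> ennreal a * (\<integral>\<^sup>+z. f z \<partial>lborel)"
proof -
  define A where "A = {x. cone_height a x \<ge> 1/4 \<and> x $ 3 \<le> 0}"
  have "closed A" unfolding A_def
    by (rule closed_cone_slab)
  then have [measurable]: "A \<in> sets borel" by (rule borel_closed)
  have "(\<integral>\<^sup>+x. indicator A x * f (cone_map a p0 x) \<partial>lborel) =
      (\<integral>\<^sup>+s. \<integral>\<^sup>+z. indicator A (vector [(z::real^2) $ 1, z $ 2, s]) * f (cone_map a p0 (vector [z $ 1, z $ 2, s])) \<partial>lborel \<partial>lborel)"
    by (rule nn_integral_lborel_slices[symmetric]) measurable
  also have "\<dots> \<le> (\<integral>\<^sup>+s. indicator {- a..0} s * (\<integral>\<^sup>+z. f z \<partial>lborel) \<partial>lborel)"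
  proof (rule nn_integral_mono)
    fix s :: real
    define t where "t = 1 + s / a"
    show "(\<integral>\<^sup>+z. indicator A (vector [(z::real^2) $ 1, z $ 2, s]) * f (cone_map a p0 (vector [z $ 1, z $ 2, s])) \<partial>lborel)
      \<le> indicator {- a..0} s * (\<integral>\<^sup>+z. f z \<partial>lborel)"
    proof (cases "t \<ge> 1/4 \<and> s \<le> 0")
      case True
      then have s: "s \<in> {- a..0}" using a by (auto simp: t_def field_simps)
      have t: "t \<le> 1" "t > 0" using True a by (auto simp: t_def field_simps)
      have pr: "proj (vector [z $ 1, z $ 2, s]) = z" for z :: "real^2" by (simp add: vec_eq_iff forall_2)
      have "cone_map a p0 (vector [z $ 1, z $ 2, s]) = (p0 - (1 / t) *\<^sub>R p0) + (1 / t) *\<^sub>R z" for z :: "real^2"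
        using True unfolding cone_map_def pr
        by (simp add: cone_height_def t_def[symmetric] reciprocal_cutoff_eq algebra_simps)
      note cm = this
      have "(\<integral>\<^sup>+z. indicator A (vector [(z::real^2) $ 1, z $ 2, s]) * f (cone_map a p0 (vector [z $ 1, z $ 2, s])) \<partial>lborel)
        = (\<integral>\<^sup>+z. f ((p0 - (1 / t) *\<^sub>R p0) + (1 / t) *\<^sub>R z) \<partial>lborel)"
      proof -
        have "(vector [z $ 1, z $ 2, s] :: real^3) \<in> A" for z :: "real^2"
          using True unfolding A_def mem_Collect_eq cone_height_def t_def by simp
        then show ?thesis by (simp add: cm)
      qed
      also have "\<dots> \<le> (\<integral>\<^sup>+z. f z \<partial>lborel)"
        by (rule nn_integral_lborel_dilation_le) (use t in \<open>auto simp: field_simps\<close>)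
      finally show ?thesis using s by simp
    next
      case False
      then have "(vector [z $ 1, z $ 2, s] :: real^3) \<notin> A" for z :: "real^2"
        unfolding A_def mem_Collect_eq cone_height_def t_def by simp
      then show ?thesis by simp
    qed
  qed
  also have "\<dots> = ennreal a * (\<integral>\<^sup>+z. f z \<partial>lborel)"
    using a by (subst nn_integral_multc) auto
  finally show ?thesis unfolding A_def .
qed

section \<open>Square-integrable functions pulled back along the cone\<close>

definition L2_tendsto ::
  "'a::euclidean_space set \<Rightarrow> (nat \<Rightarrow> 'a \<Rightarrow> real) \<Rightarrow> ('a \<Rightarrow> real) \<Rightarrow> bool" where
  "L2_tendsto D f g \<longleftrightarrow> (\<forall>j. f j \<in> L2_space D) \<and> g \<in> L2_space D \<and>
     (\<lambda>j. LINT x|lebesgue_on D. (f j x - g x)\<^sup>2) \<longlonglongrightarrow> 0"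

lemma L2_tendsto_add:
  assumes "L2_tendsto D f g" "L2_tendsto D f' g'"
  shows "L2_tendsto D (\<lambda>j x. f j x + f' j x) (\<lambda>x. g x + g' x)"
  unfolding L2_tendsto_def
proof (intro conjI allI)
  have L: "f j \<in> L2_space D" "g \<in> L2_space D" "f' j \<in> L2_space D" "g' \<in> L2_space D" for j
    using assms by (auto simp: L2_tendsto_def)
  show "(\<lambda>x. f j x + f' j x) \<in> L2_space D" "(\<lambda>x. g x + g' x) \<in> L2_space D" for j
    by (intro L2_space_add L)+
  have lim: "(\<lambda>j. 2 * (LINT x|lebesgue_on D. (f j x - g x)\<^sup>2) + 2 * (LINT x|lebesgue_on D. (f' j x - g' x)\<^sup>2)) \<longlonglongrightarrow> 2 * 0 + 2 * 0"
    using assms by (intro tendsto_intros) (auto simp: L2_tendsto_def)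
  show "(\<lambda>j. LINT x|lebesgue_on D. (f j x + f' j x - (g x + g' x))\<^sup>2) \<longlonglongrightarrow> 0"
  proof (rule tendsto_0_le_nonneg[OF lim[simplified]])
    fix j
    have i: "integrable (lebesgue_on D) (\<lambda>x. (f j x - g x)\<^sup>2)" "integrable (lebesgue_on D) (\<lambda>x. (f' j x - g' x)\<^sup>2)"
      "integrable (lebesgue_on D) (\<lambda>x. (f j x + f' j x - (g x + g' x))\<^sup>2)"
      using L2_spaceD(2)[OF L2_space_diff[OF L(1)[of j] L(2)]] L2_spaceD(2)[OF L2_space_diff[OF L(3)[of j] L(4)]]
        L2_spaceD(2)[OF L2_space_diff[OF L2_space_add[OF L(1)[of j] L(3)[of j]] L2_space_add[OF L(2) L(4)]]] by simp_all
    have "(LINT x|lebesgue_on D. (f j x + f' j x - (g x + g' x))\<^sup>2) \<le> (LINT x|lebesgue_on D. 2 * (f j x - g x)\<^sup>2 + 2 * (f' j x - g' x)\<^sup>2)"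
    proof (rule integral_mono)
      fix x
      have "(f j x + f' j x - (g x + g' x)) = (f j x - g x) + (f' j x - g' x)" by simp
      then show "(f j x + f' j x - (g x + g' x))\<^sup>2 \<le> 2 * (f j x - g x)\<^sup>2 + 2 * (f' j x - g' x)\<^sup>2"
        using norm_add_sq_le[of "f j x - g x" "f' j x - g' x"] by (simp only: real_norm_def power2_abs)
    qed (use i in auto)
    then show "(LINT x|lebesgue_on D. (f j x + f' j x - (g x + g' x))\<^sup>2) \<le> 2 * (LINT x|lebesgue_on D. (f j x - g x)\<^sup>2) + 2 * (LINT x|lebesgue_on D. (f' j x - g' x)\<^sup>2)"
      using i by simp
  qed (simp add: Bochner_Integration.integral_nonneg)
qed

lemma L2_tendsto_sum:
  "finite I \<Longrightarrow> (\<And>i. i \<in> I \<Longrightarrow> L2_tendsto D (f i) (g i)) \<Longrightarrow> L2_tendsto D (\<lambda>j x. \<Sum>i\<in>I. f i j x) (\<lambda>x. \<Sum>i\<in>I. g i x)"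
proof (induction I rule: finite_induct)
  case empty
  then show ?case by (simp add: L2_tendsto_def L2_space_zero)
next
  case (insert i I)
  then show ?case by (simp add: L2_tendsto_add)
qed

text \<open>The position of D and the vanishing of \<open>coef\<close> near the apex confine the
  integrand to the slab of the previous estimate. Applied to differences, the bound transfers L^2
  convergence on the plane of the plate to D.\<close>

lemma cone_map_L2:
  fixes D :: "(real^3) set" and h :: "real^2 \<Rightarrow> real"
  assumes a: "a > 0" and D: "open D" "D \<subseteq> {x. x $ 3 < 0}"
    and coef: "coef \<in> borel_measurable borel" "\<And>x. x \<in> D \<Longrightarrow> \<bar>coef x\<bar> \<le> M" "\<And>x. cone_height a x < 1/2 \<Longrightarrow> coef x = 0"
    and h[measurable]: "h \<in> borel_measurable borel" and i: "integrable lborel (\<lambda>z. (h z)\<^sup>2)"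
  shows "(\<lambda>x. coef x * h (cone_map a p0 x)) \<in> L2_space D"
    and "(LINT x|lebesgue_on D. (coef x * h (cone_map a p0 x))\<^sup>2) \<le> M\<^sup>2 * a * (LINT z|lborel. (h z)\<^sup>2)"
proof -
  note coef(1)[measurable]
  let ?A = "{x. cone_height a x \<ge> 1/4 \<and> x $ 3 \<le> 0}"
  have "closed ?A"
    by (rule closed_cone_slab)
  then have Am[measurable]: "?A \<in> sets borel" by (rule borel_closed)
  have Dm: "D \<in> sets lebesgue" using D(1) by auto
  have "(\<integral>\<^sup>+x. ennreal ((coef x * h (cone_map a p0 x))\<^sup>2) \<partial>lebesgue_on D)
    \<le> (\<integral>\<^sup>+x. ennreal (M\<^sup>2) * (indicator ?A x * ennreal ((h (cone_map a p0 x))\<^sup>2)) \<partial>lebesgue)"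
    using Dm
  proof (subst nn_integral_restrict_space, simp, intro nn_integral_mono)
    fix x
    show "ennreal ((coef x * h (cone_map a p0 x))\<^sup>2) * indicator D x \<le> ennreal (M\<^sup>2) * (indicator ?A x * ennreal ((h (cone_map a p0 x))\<^sup>2))"
    proof (cases "x \<in> D \<and> cone_height a x \<ge> 1/4")
      case True
      then have "x \<in> ?A" using D(2) by (auto simp: less_imp_le)
      have "\<bar>coef x\<bar>\<^sup>2 \<le> M\<^sup>2" using coef(2) True by (intro power_mono) auto
      then have "(coef x * h (cone_map a p0 x))\<^sup>2 \<le> M\<^sup>2 * (h (cone_map a p0 x))\<^sup>2"
        by (simp add: power_mult_distrib mult_right_mono)
      then have "ennreal ((coef x * h (cone_map a p0 x))\<^sup>2) \<le> ennreal (M\<^sup>2) * ennreal ((h (cone_map a p0 x))\<^sup>2)"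
        by (simp add: ennreal_mult[symmetric] ennreal_leI)
      then show ?thesis using \<open>x \<in> ?A\<close> True by simp
    next
      case False
      then have "coef x = 0 \<or> x \<notin> D" using coef(3)[of x] by linarith
      then show ?thesis by auto
    qed
  qed
  also have "\<dots> = ennreal (M\<^sup>2) * (\<integral>\<^sup>+x. indicator ?A x * ennreal ((h (cone_map a p0 x))\<^sup>2) \<partial>lborel)"
    unfolding nn_integral_completion by (rule nn_integral_cmult) measurable
  also have "\<dots> \<le> ennreal (M\<^sup>2) * (ennreal a * (\<integral>\<^sup>+z. ennreal ((h z)\<^sup>2) \<partial>lborel))"
    by (intro mult_left_mono cone_map_nn_integral_le a) auto
  also have "(\<integral>\<^sup>+z. ennreal ((h z)\<^sup>2) \<partial>lborel) = ennreal (LINT z|lborel. (h z)\<^sup>2)"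
    using i by (intro nn_integral_eq_integral) auto
  also have "ennreal (M\<^sup>2) * (ennreal a * ennreal (LINT z|lborel. (h z)\<^sup>2)) = ennreal (M\<^sup>2 * a * (LINT z|lborel. (h z)\<^sup>2))"
    using a by (simp add: ennreal_mult'[symmetric] mult.assoc)
  finally have le: "(\<integral>\<^sup>+x. ennreal ((coef x * h (cone_map a p0 x))\<^sup>2) \<partial>lebesgue_on D) \<le> ennreal (M\<^sup>2 * a * (LINT z|lborel. (h z)\<^sup>2))" .
  have m: "(\<lambda>x. coef x * h (cone_map a p0 x)) \<in> borel_measurable (lebesgue_on D)"
    by (rule measurable_lborel_lebesgue_on) measurable
  have int: "integrable (lebesgue_on D) (\<lambda>x. (coef x * h (cone_map a p0 x))\<^sup>2)"
  proof (rule integrableI_nonneg)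
    show "(\<lambda>x. (coef x * h (cone_map a p0 x))\<^sup>2) \<in> borel_measurable (lebesgue_on D)"
      using m by (rule borel_measurable_power)
    show "(\<integral>\<^sup>+x. ennreal ((coef x * h (cone_map a p0 x))\<^sup>2) \<partial>lebesgue_on D) < \<infinity>"
      using le by (rule le_less_trans) simp
  qed simp
  then show "(\<lambda>x. coef x * h (cone_map a p0 x)) \<in> L2_space D"
    using m by (simp add: L2_space_def)
  have "ennreal (LINT x|lebesgue_on D. (coef x * h (cone_map a p0 x))\<^sup>2) \<le> ennreal (M\<^sup>2 * a * (LINT z|lborel. (h z)\<^sup>2))"
    using le nn_integral_eq_integral[OF int] by simp
  then show "(LINT x|lebesgue_on D. (coef x * h (cone_map a p0 x))\<^sup>2) \<le> M\<^sup>2 * a * (LINT z|lborel. (h z)\<^sup>2)"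
    using a by (subst (asm) ennreal_le_iff) (auto intro!: mult_nonneg_nonneg Bochner_Integration.integral_nonneg)
qed

lemma integrable_power2_diff:
  fixes f g :: "'a \<Rightarrow> real"
  assumes [measurable]: "f \<in> borel_measurable M" "g \<in> borel_measurable M"
    and i: "integrable M (\<lambda>x. (f x)\<^sup>2)" "integrable M (\<lambda>x. (g x)\<^sup>2)"
  shows "integrable M (\<lambda>x. (f x - g x)\<^sup>2)"
proof (rule Bochner_Integration.integrable_bound)
  show "integrable M (\<lambda>x. 2 * (f x)\<^sup>2 + 2 * (g x)\<^sup>2)" using i by auto
  have "(f x - g x)\<^sup>2 \<le> 2 * (f x)\<^sup>2 + 2 * (g x)\<^sup>2" for x
    using norm_add_sq_le[of "f x" "- g x"] by simp
  then show "AE x in M. norm ((f x - g x)\<^sup>2) \<le> norm (2 * (f x)\<^sup>2 + 2 * (g x)\<^sup>2)" by simp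
qed simp

lemma cone_map_L2_tendsto:
  fixes D :: "(real^3) set" and h :: "nat \<Rightarrow> real^2 \<Rightarrow> real"
  assumes a: "a > 0" and D: "open D" "bounded D" "D \<subseteq> {x. x $ 3 < 0}"
    and coef: "continuous_on UNIV coef" "\<And>x. cone_height a x < 1/2 \<Longrightarrow> coef x = 0"
    and h: "\<And>j. h j \<in> borel_measurable borel" "\<And>j. integrable lborel (\<lambda>z. (h j z)\<^sup>2)"
    and g: "g \<in> borel_measurable borel" "integrable lborel (\<lambda>z. (g z)\<^sup>2)"
    and lim: "(\<lambda>j. LINT z|lborel. (h j z - g z)\<^sup>2) \<longlonglongrightarrow> 0"
  shows "L2_tendsto D (\<lambda>j x. coef x * h j (cone_map a p0 x)) (\<lambda>x. coef x * g (cone_map a p0 x))"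
proof -
  have "compact (coef ` closure D)"
    using coef(1) D(2) by (intro compact_continuous_image) (auto intro: continuous_on_subset simp: compact_closure)
  then obtain M where "\<forall>y\<in>coef ` closure D. norm y \<le> M"
    using compact_imp_bounded bounded_iff by metis
  then have M: "\<bar>coef x\<bar> \<le> M" if "x \<in> D" for x using that closure_subset[of D] by auto
  have cm: "coef \<in> borel_measurable borel" by (rule borel_measurable_continuous_onI[OF coef(1)])
  have dm: "(\<lambda>z. h j z - g z) \<in> borel_measurable borel" for j using h(1)[of j] g(1) by measurable
  have di: "integrable lborel (\<lambda>z. (h j z - g z)\<^sup>2)" for j
    using h g by (intro integrable_power2_diff) simp_all
  show ?thesis unfolding L2_tendsto_def
  proof (intro conjI allI)
    show "(\<lambda>x. coef x * h j (cone_map a p0 x)) \<in> L2_space D" for j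
      by (rule cone_map_L2(1)[OF a D(1,3) cm M coef(2) h(1,2)])
    show "(\<lambda>x. coef x * g (cone_map a p0 x)) \<in> L2_space D"
      by (rule cone_map_L2(1)[OF a D(1,3) cm M coef(2) g])
    have "(\<lambda>j. M\<^sup>2 * a * (LINT z|lborel. (h j z - g z)\<^sup>2)) \<longlonglongrightarrow> M\<^sup>2 * a * 0"
      by (intro tendsto_intros lim)
    then have lim0: "(\<lambda>j. M\<^sup>2 * a * (LINT z|lborel. (h j z - g z)\<^sup>2)) \<longlonglongrightarrow> 0" by simp
    show "(\<lambda>j. LINT x|lebesgue_on D. (coef x * h j (cone_map a p0 x) - coef x * g (cone_map a p0 x))\<^sup>2) \<longlonglongrightarrow> 0"
    proof (rule tendsto_0_le_nonneg[OF lim0])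
      fix j
      show "(LINT x|lebesgue_on D. (coef x * h j (cone_map a p0 x) - coef x * g (cone_map a p0 x))\<^sup>2) \<le> M\<^sup>2 * a * (LINT z|lborel. (h j z - g z)\<^sup>2)"
        using cone_map_L2(2)[OF a D(1,3) cm M coef(2) dm[of j] di[of j], of p0] by (simp add: right_diff_distrib)
    qed (auto simp: Bochner_Integration.integral_nonneg)
  qed
qed

text \<open>Composition with the cone map is carried out for Borel functions, and extension by zero
  allows integration over the whole space.\<close>

lemma L2_borel_representative:
  fixes f :: "'a::euclidean_space \<Rightarrow> real"
  assumes "f \<in> L2_space D" "open D"
  obtains g where "g \<in> borel_measurable borel" "\<And>x. x \<notin> D \<Longrightarrow> g x = 0" "AE x in lborel. x \<in> D \<longrightarrow> f x = g x"
    "integrable lborel (\<lambda>x. (g x)\<^sup>2)"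
proof -
  have Dm: "D \<in> sets lebesgue" using assms(2) by auto
  have "(\<lambda>x. if x \<in> D then f x else 0) \<in> borel_measurable lebesgue"
    using L2_spaceD(1)[OF assms(1)] Dm by (simp add: borel_measurable_if)
  then obtain g0 where g0: "g0 \<in> borel_measurable lborel" "AE x in lborel. (if x \<in> D then f x else 0) = g0 x"
    using completion_ex_borel_measurable_real by blast
  define g where "g x = indicator D x * g0 x" for x
  have gm: "g \<in> borel_measurable borel" unfolding g_def[abs_def]
    using g0(1) assms(2) by (intro borel_measurable_times borel_measurable_indicator) auto
  have eq: "AE x in lborel. x \<in> D \<longrightarrow> f x = g x"
    using g0(2) by eventually_elim (auto simp: g_def)
  have "integrable lebesgue (\<lambda>x. indicator D x *\<^sub>R (f x)\<^sup>2)"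
    using L2_spaceD(2)[OF assms(1)] Dm by (subst (asm) integrable_restrict_space) auto
  also have "integrable lebesgue (\<lambda>x. indicator D x *\<^sub>R (f x)\<^sup>2) \<longleftrightarrow> integrable lebesgue (\<lambda>x. (g x)\<^sup>2)"
  proof (rule integrable_cong_AE)
    show "(\<lambda>x. indicator D x *\<^sub>R (f x)\<^sup>2) \<in> borel_measurable lebesgue"
      using borel_measurable_integrable calculation by blast
    show "(\<lambda>x. (g x)\<^sup>2) \<in> borel_measurable lebesgue"
      using gm by (intro borel_measurable_power measurable_completion) simp
    have "AE x in lebesgue. x \<in> D \<longrightarrow> f x = g x" using eq by (rule AE_completion)
    then show "AE x in lebesgue. indicator D x *\<^sub>R (f x)\<^sup>2 = (g x)\<^sup>2"
      by eventually_elim (auto simp: g_def indicator_def)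
  qed
  also have "\<dots> \<longleftrightarrow> integrable lborel (\<lambda>x. (g x)\<^sup>2)"
    using gm by (intro integrable_completion) simp
  finally show thesis using gm eq by (intro that[of g]) (auto simp: g_def)
qed

lemma LINT_borel_representative:
  fixes f g :: "'a::euclidean_space \<Rightarrow> real"
  assumes "open D" "f \<in> L2_space D" "g \<in> borel_measurable borel" "\<And>x. x \<notin> D \<Longrightarrow> g x = 0" "AE x in lborel. x \<in> D \<longrightarrow> f x = g x"
    and \<phi>: "\<phi> \<in> borel_measurable borel" "\<And>x. x \<notin> D \<Longrightarrow> \<phi> x = 0"
  shows "(LINT x|lborel. (\<phi> x - g x)\<^sup>2) = (LINT x|lebesgue_on D. (\<phi> x - f x)\<^sup>2)"
proof -
  have Dm: "D \<in> sets lebesgue" using assms(1) by auto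
  have m: "(\<lambda>x. (\<phi> x - g x)\<^sup>2) \<in> borel_measurable borel" using \<phi>(1) assms(3) by measurable
  have "(LINT x|lborel. (\<phi> x - g x)\<^sup>2) = (LINT x|lebesgue. (\<phi> x - g x)\<^sup>2)"
    using m by (simp add: integral_completion)
  also have "\<dots> = (LINT x|lebesgue. indicator D x * (\<phi> x - g x)\<^sup>2)"
    by (rule Bochner_Integration.integral_cong) (use assms(4) \<phi>(2) in \<open>auto simp: indicator_def\<close>)
  also have "\<dots> = (LINT x|lebesgue_on D. (\<phi> x - g x)\<^sup>2)"
    using Dm by (simp add: LINT_lebesgue_on_eq_indicator)
  also have "\<dots> = (LINT x|lebesgue_on D. (\<phi> x - f x)\<^sup>2)"
  proof (rule integral_cong_AE)
    show "(\<lambda>x. (\<phi> x - g x)\<^sup>2) \<in> borel_measurable (lebesgue_on D)" using m by (rule measurable_lborel_lebesgue_on)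
    show "(\<lambda>x. (\<phi> x - f x)\<^sup>2) \<in> borel_measurable (lebesgue_on D)"
      by (intro borel_measurable_power borel_measurable_diff L2_spaceD(1)[OF assms(2)] measurable_lborel_lebesgue_on \<phi>(1))
    have "AE x in lebesgue. x \<in> D \<longrightarrow> f x = g x" using assms(5) by (rule AE_completion)
    then have "AE x in lebesgue_on D. f x = g x" using Dm by (subst AE_restrict_space_iff) auto
    then show "AE x in lebesgue_on D. (\<phi> x - g x)\<^sup>2 = (\<phi> x - f x)\<^sup>2" by eventually_elim simp
  qed
  finally show ?thesis .
qed

lemma test_functions_lborel:
  assumes "\<phi> \<in> test_functions D"
  shows "\<phi> \<in> borel_measurable borel" "integrable lborel (\<lambda>x. (\<phi> x)\<^sup>2)"
proof -
  show m: "\<phi> \<in> borel_measurable borel"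
    by (intro borel_measurable_continuous_onI smooth_continuous test_functions_smooth[OF assms])
  have "\<phi> \<in> L2_space UNIV" by (rule test_functions_L2[OF assms]) simp
  then have "integrable (lebesgue_on UNIV) (\<lambda>x. (\<phi> x)\<^sup>2)" using L2_spaceD(2) by fastforce
  then have "integrable lebesgue (\<lambda>x. (\<phi> x)\<^sup>2)" by (subst (asm) integrable_restrict_space) auto
  then show "integrable lborel (\<lambda>x. (\<phi> x)\<^sup>2)" using m by (subst (asm) integrable_completion) auto
qed

text \<open>The vertical ray upwards from a point of the bounded set D meets the frontier, which
  lies in the half-space x_3 \<le> 0; the starting point is strictly lower.\<close>

lemma flow_plate_below:
  assumes "flow_plate_geometry D S \<Omega>"
  shows "D \<subseteq> {x. x $ 3 < 0}"
proof
  fix x assume x: "x \<in> D"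
  have D: "open D" "bounded D" and fr: "frontier D = closure S \<union> closure (emb ` \<Omega>)" and S: "S \<subseteq> {x. x $ 3 \<le> 0}"
    using assms by (auto simp: flow_plate_geometry_def)
  have cl: "closed {x::real^3. x $ 3 \<le> 0}" by (intro closed_Collect_le continuous_intros)
  have "closure S \<subseteq> {x. x $ 3 \<le> 0}" "closure (emb ` \<Omega>) \<subseteq> {x. x $ 3 \<le> 0}"
    by (rule closure_minimal[OF S cl], rule closure_minimal[OF _ cl]) auto
  then have fr3: "frontier D \<subseteq> {x. x $ 3 \<le> 0}" using fr by simp
  obtain d where d: "d > 0" "x + d *\<^sub>R axis 3 1 \<in> frontier D"
    using ray_to_frontier[OF D(2), of x "axis 3 1"] x D(1) by (auto simp: interior_open)
  then have "(x + d *\<^sub>R axis 3 1) $ 3 \<le> 0" using fr3 by blast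
  then show "x \<in> {x. x $ 3 < 0}" using d(1) by simp
qed

lemma flow_plate_emb_frontier:
  assumes "flow_plate_geometry D S \<Omega>" "z \<in> \<Omega>"
  shows "emb z \<in> frontier D"
proof -
  have "frontier D = closure S \<union> closure (emb ` \<Omega>)" using assms by (auto simp: flow_plate_geometry_def)
  then show ?thesis using assms(2) closure_subset[of "emb ` \<Omega>"] by auto
qed

lemma flow_plate_bounded:
  assumes "flow_plate_geometry D S \<Omega>"
  shows "bounded \<Omega>"
proof -
  have "bounded D" using assms by (auto simp: flow_plate_geometry_def)
  then have "bounded (frontier D)" by (rule bounded_subset[OF bounded_closure]) (auto simp: frontier_def)
  then obtain M where "\<And>y. y \<in> frontier D \<Longrightarrow> norm y \<le> M" using bounded_iff by metis
  then have "norm z \<le> M" if "z \<in> \<Omega>" for z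
    using flow_plate_emb_frontier[OF assms that] norm_emb by metis
  then show ?thesis using bounded_iff by metis
qed

lemma cone_map_emb:
  "cone_height a (emb z) = 1" "cone_map a p0 (emb z) = z"
  by (simp_all add: cone_height_def cone_map_def reciprocal_cutoff_eq)

text \<open>A frontier point of a convex domain that lies on a segment from an interior point to a point of the
  closure is the end point of this segment.\<close>

lemma cone_map_frontier:
  assumes geo: "flow_plate_geometry D S \<Omega>" and x0: "x0 \<in> D"
    and y: "y \<in> frontier D" "cone_height (- x0 $ 3) y > 1/2" "cone_map (- x0 $ 3) (proj x0) y \<in> \<Omega>"
  shows "y \<in> emb ` \<Omega>"
proof -
  define t where "t = cone_height (- x0 $ 3) y"
  define z where "z = cone_map (- x0 $ 3) (proj x0) y"
  have D: "open D" "convex D" using geo by (auto simp: flow_plate_geometry_def)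
  have x03: "x0 $ 3 < 0" using flow_plate_below[OF geo] x0 by auto
  have "closure D \<subseteq> {x. x $ 3 \<le> 0}"
    using flow_plate_below[OF geo] by (intro closure_minimal closed_Collect_le continuous_intros) auto
  then have y3: "y $ 3 \<le> 0" using y(1) by (auto simp: frontier_def)
  have t: "t > 1/2" "t \<le> 1" using y(2) y3 x03 by (auto simp: t_def cone_height_def field_simps)
  have z': "z = proj x0 + (1 / t) *\<^sub>R (proj y - proj x0)"
    unfolding z_def cone_map_def t_def[symmetric] using t by (simp add: reciprocal_cutoff_eq)
  have t3: "t * x0 $ 3 = x0 $ 3 - y $ 3" using x03 by (simp add: t_def cone_height_def field_simps)
  \<comment> \<open>The central projection inverted: y divides the segment from the apex to the
    plate point z in the ratio given by its height t.\<close>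
  have "y = (1 - t) *\<^sub>R x0 + t *\<^sub>R emb z"
    using t t3 by (simp add: vec_eq_iff forall_3 z' field_simps)
  have fz: "emb z \<in> frontier D" using flow_plate_emb_frontier[OF geo] y(3) by (simp add: z_def)
  have nD: "frontier D \<inter> D = {}" using D(1) by (auto simp add: frontier_def interior_open)
  have "t = 1"
  proof (rule ccontr)
    assume "t \<noteq> 1"
    then have "t < 1" using t by simp
    have "x0 \<noteq> emb z" using fz x0 nD by auto
    then have "y \<in> open_segment x0 (emb z)"
      using \<open>y = (1 - t) *\<^sub>R x0 + t *\<^sub>R emb z\<close> t(1) \<open>t < 1\<close>
      unfolding in_segment by (intro conjI exI[of _ t]) auto
    moreover have "open_segment x0 (emb z) \<subseteq> interior D"
      using D x0 fz by (intro in_interior_closure_convex_segment) (auto simp: interior_open frontier_def)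
    ultimately show False using y(1) nD D(1) by (auto simp: interior_open)
  qed
  then have "y = emb z" using \<open>y = (1 - t) *\<^sub>R x0 + t *\<^sub>R emb z\<close> by simp
  then show ?thesis using y(3) by (simp add: z_def)
qed

lemma pderivative_cone_extension:
  assumes \<phi>: "smooth \<phi>"
  shows "pderivative b (\<lambda>x. cone_cutoff a x * \<phi> (cone_map a p0 x)) x =
    (\<Sum>c\<in>Basis. (cone_cutoff a x * pderivative b (\<lambda>x. cone_map a p0 x \<bullet> c) x) * pderivative c \<phi> (cone_map a p0 x))
    + pderivative b (cone_cutoff a) x * \<phi> (cone_map a p0 x)"
proof -
  have d: "((\<lambda>x. \<phi> (cone_map a p0 x)) has_derivative
     (\<lambda>h. \<Sum>c\<in>Basis. pderivative h (\<lambda>x. cone_map a p0 x \<bullet> c) x * pderivative c \<phi> (cone_map a p0 x))) (at x)"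
    by (intro has_derivative_compose_pderivative smooth_differentiable \<phi> smooth_cone_map)
  then have "(\<lambda>x. \<phi> (cone_map a p0 x)) differentiable (at x)" by (rule differentiableI)
  then show ?thesis
    by (subst pderivative_mult) (simp_all add: smooth_differentiable smooth_cone_cutoff pderivative_eq[OF d] sum_distrib_left mult.assoc)
qed

text \<open>The approximating test functions are extended rather than \<beta> itself. Their
  extensions \<open>E j\<close> are smooth on the whole space, and their values on the frontier are
  known exactly. The cone estimates give convergence of \<open>E j\<close> and of its first
  derivatives in L^2; by closedness of weak derivatives the limit V lies in H^1 with derivatives
  \<open>dV\<close>.\<close>

lemma plate_extension_exists:
  assumes geo: "flow_plate_geometry D S \<Omega>" and \<beta>: "\<beta> \<in> Sobolev0 1 \<Omega>"
  obtains \<psi> where "\<psi> \<in> Sobolev_vec 1 D" "has_trace D \<psi> (plate_field D \<Omega> \<beta>)"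
proof -
  have D: "open D" "bounded D" "convex D" "D \<noteq> {}" and \<Omega>: "open \<Omega>"
    and n: "\<And>z. z \<in> \<Omega> \<Longrightarrow> outward_normal D (emb z) = axis 3 1"
    using geo by (auto simp: flow_plate_geometry_def)
  have \<Omega>b: "bounded \<Omega>" by (rule flow_plate_bounded[OF geo])
  have Dm: "D \<in> sets lebesgue" using D(1) by auto
  obtain x0 where x0: "x0 \<in> D" using D(4) by auto
  define a where "a = - x0 $ 3"
  define p0 where "p0 = proj x0"
  have D3: "D \<subseteq> {x. x $ 3 < 0}" by (rule flow_plate_below[OF geo])
  then have a: "a > 0" using x0 by (auto simp: a_def)
  obtain \<phi> where \<phi>: "\<beta> \<in> Sobolev 1 \<Omega>" "\<And>j. \<phi> j \<in> test_functions \<Omega>" "Sobolev_tendsto 1 \<Omega> \<phi> \<beta>"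
    using \<beta> unfolding Sobolev0_def by blast
  have \<beta>L: "\<beta> \<in> L2_space \<Omega>" using \<phi>(1) by (rule Sobolev_L2)
  obtain \<beta>' where \<beta>': "\<beta>' \<in> borel_measurable borel" "\<And>x. x \<notin> \<Omega> \<Longrightarrow> \<beta>' x = 0" "AE x in lborel. x \<in> \<Omega> \<longrightarrow> \<beta> x = \<beta>' x"
    "integrable lborel (\<lambda>x. (\<beta>' x)\<^sup>2)"
    by (rule L2_borel_representative[OF \<beta>L \<Omega>], rule that) blast+
  have lim0: "(\<lambda>j. LINT z|lborel. (\<phi> j z - \<beta>' z)\<^sup>2) \<longlonglongrightarrow> 0"
    using Sobolev_tendsto_L2[OF \<phi>(3)]
      LINT_borel_representative[OF \<Omega> \<beta>L \<beta>'(1,2,3) test_functions_lborel(1)[OF \<phi>(2)] test_functions_outside[OF \<phi>(2)]]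
    by simp
  \<comment> \<open>The first derivatives of \<beta> need Borel representatives as well, since the
    chain rule composes them with the cone map.\<close>
  have "\<forall>c\<in>Basis. \<exists>g'. g' \<in> borel_measurable borel \<and> integrable lborel (\<lambda>x. (g' x)\<^sup>2) \<and>
      (\<lambda>j. LINT z|lborel. (pderivative c (\<phi> j) z - g' z)\<^sup>2) \<longlonglongrightarrow> 0"
  proof
    fix c :: "real^2" assume c: "c \<in> Basis"
    have L: "weak_deriv \<Omega> c \<beta> \<in> L2_space \<Omega>"
      using weak_deriv_Sobolev(1)[OF \<Omega> \<phi>(1)[unfolded One_nat_def] c] by simp
    obtain g' where g': "g' \<in> borel_measurable borel" "\<And>x. x \<notin> \<Omega> \<Longrightarrow> g' x = 0" "AE x in lborel. x \<in> \<Omega> \<longrightarrow> weak_deriv \<Omega> c \<beta> x = g' x"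
      "integrable lborel (\<lambda>x. (g' x)\<^sup>2)"
      by (rule L2_borel_representative[OF L \<Omega>], rule that) blast+
    have "Sobolev_tendsto 0 \<Omega> (\<lambda>j. pderivative c (\<phi> j)) (weak_deriv \<Omega> c \<beta>)"
      using Sobolev_tendsto_pderivative[OF \<Omega> \<phi>(2) \<phi>(1,3)[unfolded One_nat_def] c] .
    from Sobolev_tendsto_L2[OF this]
    have "(\<lambda>j. LINT z|lborel. (pderivative c (\<phi> j) z - g' z)\<^sup>2) \<longlonglongrightarrow> 0"
      using LINT_borel_representative[OF \<Omega> L g'(1,2,3) test_functions_lborel(1)[OF test_functions_pderivative[OF \<phi>(2)]]
          test_functions_outside[OF test_functions_pderivative[OF \<phi>(2)]]]
      by simp
    then show "\<exists>g'. g' \<in> borel_measurable borel \<and> integrable lborel (\<lambda>x. (g' x)\<^sup>2) \<and>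
      (\<lambda>j. LINT z|lborel. (pderivative c (\<phi> j) z - g' z)\<^sup>2) \<longlonglongrightarrow> 0"
      using g'(1,4) by (intro exI[of _ g'] conjI)
  qed
  from bchoice[OF this] obtain g' where g'all: "\<forall>c\<in>Basis. g' c \<in> borel_measurable borel \<and> integrable lborel (\<lambda>x. (g' c x)\<^sup>2) \<and>
      (\<lambda>j. LINT z|lborel. (pderivative c (\<phi> j) z - g' c z)\<^sup>2) \<longlonglongrightarrow> 0" ..
  then have g': "\<And>c. c \<in> Basis \<Longrightarrow> g' c \<in> borel_measurable borel" "\<And>c. c \<in> Basis \<Longrightarrow> integrable lborel (\<lambda>x. (g' c x)\<^sup>2)"
      "\<And>c. c \<in> Basis \<Longrightarrow> (\<lambda>j. LINT z|lborel. (pderivative c (\<phi> j) z - g' c z)\<^sup>2) \<longlonglongrightarrow> 0"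
    by auto
  define X where "X = cone_cutoff a"
  define T where "T = cone_map a p0"
  define E where "E j x = X x * \<phi> j (T x)" for j x
  define V where "V x = X x * \<beta>' (T x)" for x
  define dE where "dE b j x = (\<Sum>c\<in>Basis. (X x * pderivative b (\<lambda>x. T x \<bullet> c) x) * pderivative c (\<phi> j) (T x))
    + pderivative b X x * \<phi> j (T x)" for b j x
  define dV where "dV b x = (\<Sum>c\<in>Basis. (X x * pderivative b (\<lambda>x. T x \<bullet> c) x) * g' c (T x))
    + pderivative b X x * \<beta>' (T x)" for b x
  have X0: "X x = 0" "pderivative b X x = 0" if "cone_height a x < 1/2" for x b
    using that cone_cutoff_eq_0 pderivative_cone_cutoff_eq_0 by (auto simp: X_def)
  have cX: "continuous_on UNIV X" "continuous_on UNIV (pderivative b X)" for b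
    unfolding X_def by (intro smooth_continuous smooth_pderivative smooth_cone_cutoff)+
  have cT: "continuous_on UNIV (pderivative b (\<lambda>x. T x \<bullet> c))" if "c \<in> Basis" for b c
    unfolding T_def by (intro smooth_continuous smooth_pderivative smooth_cone_map that)
  have LE: "L2_tendsto D E V"
    unfolding E_def[abs_def] V_def[abs_def] T_def
    by (rule cone_map_L2_tendsto[OF a D(1,2) D3 cX(1) X0(1) test_functions_lborel[OF \<phi>(2)] \<beta>'(1,4) lim0])
  have LdE: "L2_tendsto D (dE b) (dV b)" for b
    unfolding dE_def[abs_def] dV_def[abs_def]
  proof (intro L2_tendsto_add L2_tendsto_sum finite_Basis)
    show "L2_tendsto D (\<lambda>j x. pderivative b X x * \<phi> j (T x)) (\<lambda>x. pderivative b X x * \<beta>' (T x))"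
      unfolding T_def
      by (rule cone_map_L2_tendsto[OF a D(1,2) D3 cX(2) X0(2) test_functions_lborel[OF \<phi>(2)] \<beta>'(1,4) lim0])
    fix c :: "real^2" assume c: "c \<in> Basis"
    show "L2_tendsto D (\<lambda>j x. (X x * pderivative b (\<lambda>x. T x \<bullet> c) x) * pderivative c (\<phi> j) (T x))
       (\<lambda>x. (X x * pderivative b (\<lambda>x. T x \<bullet> c) x) * g' c (T x))"
      unfolding T_def
      by (rule cone_map_L2_tendsto[OF a D(1,2) D3 continuous_on_mult[OF cX(1) cT[unfolded T_def, OF c]] _
            test_functions_lborel[OF test_functions_pderivative[OF \<phi>(2)]] g'(1,2,3)[OF c]]) (simp add: X0)
  qed
  have sE: "smooth (E j)" for j
    unfolding E_def[abs_def] X_def T_def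
    by (intro smooth_mult smooth_cone_cutoff smooth_compose[OF test_functions_smooth[OF \<phi>(2)]] smooth_cone_map)
  have pE: "pderivative b (E j) = dE b j" for b j
    unfolding E_def[abs_def] dE_def[abs_def] X_def T_def
    by (rule ext) (rule pderivative_cone_extension[OF test_functions_smooth[OF \<phi>(2)]])
  have wE: "is_weak_deriv D b (E j) (dE b j)" for b j
    using smooth_is_weak_deriv[OF sE Dm, of b j] by (simp add: pE)
  have wV: "is_weak_deriv D b V (dV b)" for b
    using LE LdE[of b] unfolding L2_tendsto_def by (intro is_weak_deriv_limit[OF Dm _ _ _ _ _ _ wE]) auto
  have V1: "V \<in> Sobolev 1 D"
    using LE LdE wV unfolding L2_tendsto_def by auto
  have E1: "E j \<in> Sobolev 1 D" for j by (rule smooth_Sobolev[OF D(2) Dm sE])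
  have lim: "Sobolev_tendsto 1 D E V"
  proof -
    have L: "E j \<in> L2_space D" "V \<in> L2_space D" "dE b j \<in> L2_space D" "dV b \<in> L2_space D" for b j
      using LE LdE[of b] by (auto simp: L2_tendsto_def)
    have "Sobolev_sqnorm 0 D (weak_deriv D b (\<lambda>x. E j x - V x)) = Sobolev_sqnorm 0 D (\<lambda>x. dE b j x - dV b x)" for b j
    proof (rule Sobolev_sqnorm_cong_AE[OF Dm])
      have dL: "(\<lambda>x. dE b j x - dV b x) \<in> L2_space D" by (intro L2_space_diff L)
      note w = weak_deriv_works[OF D(1) dL is_weak_deriv_diff[OF Dm L wE wV]]
      show "weak_deriv D b (\<lambda>x. E j x - V x) \<in> L2_space D" by (rule w)
      show "(\<lambda>x. dE b j x - dV b x) \<in> L2_space D" by (rule dL)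
      show "AE x in lebesgue_on D. weak_deriv D b (\<lambda>x. E j x - V x) x = dE b j x - dV b x" by (rule w)
    qed
    then have eq: "Sobolev_sqnorm 1 D (\<lambda>x. E j x - V x) = (LINT x|lebesgue_on D. (E j x - V x)\<^sup>2) + (\<Sum>b\<in>Basis. LINT x|lebesgue_on D. (dE b j x - dV b x)\<^sup>2)" for j
      by simp
    have "(\<lambda>j. (LINT x|lebesgue_on D. (E j x - V x)\<^sup>2) + (\<Sum>b\<in>Basis. LINT x|lebesgue_on D. (dE b j x - dV b x)\<^sup>2)) \<longlonglongrightarrow> 0 + (\<Sum>b\<in>(Basis::(real^3) set). 0)"
      using LE LdE by (intro tendsto_intros) (auto simp: L2_tendsto_def)
    then show ?thesis unfolding Sobolev_tendsto_def eq by simp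
  qed
  \<comment> \<open>Off the plate a frontier point either has height at most 1/2, where the cutoff
    vanishes, or is projected outside \<Omega>, where the test function vanishes. This is where
    convexity enters.\<close>
  have Efr: "E j y = (if y \<in> emb ` \<Omega> then \<phi> j (proj y) else 0)" if y: "y \<in> frontier D" for j y
  proof (cases "y \<in> emb ` \<Omega>")
    case True
    then show ?thesis by (auto simp: E_def X_def T_def cone_map_emb cone_cutoff_eq_1)
  next
    case False
    then have "cone_height a y \<le> 1/2 \<or> T y \<notin> \<Omega>"
      using cone_map_frontier[OF geo x0 y] by (auto simp: a_def p0_def T_def)
    then show ?thesis using False cone_cutoff_eq_0[of a y] test_functions_outside[OF \<phi>(2)]
      by (auto simp: E_def X_def)
  qed
  \<comment> \<open>The exceptional set of the Borel representative lifts to a null set of the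
    surface measure, by the upper bound on the plate.\<close>
  obtain N0 where N0: "{z. \<not> (z \<in> \<Omega> \<longrightarrow> \<beta> z = \<beta>' z)} \<subseteq> N0" "N0 \<in> null_sets lborel"
    using \<beta>'(3) by (auto elim!: AE_E simp: null_sets_def)
  define N where "N = emb ` (N0 \<inter> \<Omega>)"
  have N: "N \<in> null_sets (hausdorff_measure 2)"
  proof
    have N0b: "N0 \<inter> \<Omega> \<in> sets borel" using N0(2) \<Omega> by (auto simp: null_sets_def)
    show "N \<in> sets (hausdorff_measure 2)" unfolding N_def using emb_image_borel[OF N0b] by simp
    have "emeasure (hausdorff_measure 2) N \<le> 2 * emeasure lborel (N0 \<inter> \<Omega>)"
      unfolding N_def using emeasure_hausdorff_measure_le hausdorff_outer_emb_le[OF N0b bounded_Int[OF disjI2[OF \<Omega>b]]]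
      by (rule order_trans)
    also have "\<dots> \<le> 2 * emeasure lborel N0"
      using N0(2) by (intro mult_left_mono emeasure_mono) (auto simp: null_sets_def)
    finally show "emeasure (hausdorff_measure 2) N = 0" using N0(2) by (simp add: null_sets_def)
  qed
  define G where "G y = (if y \<in> emb ` \<Omega> then \<beta> (proj y) else 0)" for y
  define G' where "G' y = (if y \<in> emb ` \<Omega> then \<beta>' (proj y) else 0)" for y
  have GG': "G y = G' y" if "y \<notin> N" for y
  proof (cases "y \<in> emb ` \<Omega>")
    case True
    then obtain z where z: "z \<in> \<Omega>" "y = emb z" by auto
    then have "z \<notin> N0" using that by (auto simp: N_def)
    then have "\<beta> z = \<beta>' z" using N0(1) z(1) by blast
    then show ?thesis using z by (simp add: G_def G'_def)
  qed (simp add: G_def G'_def)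
  have \<Omega>m: "emb ` \<Omega> \<in> sets borel" using \<Omega> by (intro emb_image_borel) auto
  have G'm: "G' \<in> borel_measurable borel"
  proof -
    have "(\<lambda>y. \<beta>' (proj y)) \<in> borel_measurable borel" using \<beta>'(1) by measurable
    then show ?thesis unfolding G'_def[abs_def] using \<Omega>m by (intro measurable_If_set) auto
  qed
  have N': "N \<in> null_sets (hausdorff_measure (DIM(real^3) - 1))" using N by simp
  have Gm: "G \<in> borel_measurable (boundary_measure D)"
    by (rule borel_measurable_boundary_measure_AE[OF G'm N' GG'])
  \<comment> \<open>Used twice: with h = 0 for square integrability of the trace G, and with h =
    \<open>\<phi> j\<close> for convergence of the boundary values.\<close>
  have transfer: "(\<integral>\<^sup>+ y. ennreal ((F y - G y)\<^sup>2) \<partial>boundary_measure D) \<le> 2 * ennreal (LINT z|lborel. (h z - \<beta>' z)\<^sup>2)"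
    if h: "h \<in> borel_measurable borel" "integrable lborel (\<lambda>z. (h z - \<beta>' z)\<^sup>2)"
      and F: "\<And>y. y \<in> frontier D \<Longrightarrow> F y = (if y \<in> emb ` \<Omega> then h (proj y) else 0)" for F h
  proof -
    have "AE y in boundary_measure D. ennreal ((F y - G y)\<^sup>2) = ennreal (indicator (emb ` \<Omega>) y * (h (proj y) - \<beta>' (proj y))\<^sup>2)"
      by (rule AE_boundary_measureI[OF N']) (auto simp: F GG' G'_def indicator_def)
    then have "(\<integral>\<^sup>+ y. ennreal ((F y - G y)\<^sup>2) \<partial>boundary_measure D) = (\<integral>\<^sup>+ y. ennreal (indicator (emb ` \<Omega>) y * (h (proj y) - \<beta>' (proj y))\<^sup>2) \<partial>boundary_measure D)"
      by (rule nn_integral_cong_AE)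
    also have "\<dots> \<le> (\<integral>\<^sup>+ y. indicator (emb ` \<Omega>) y * ennreal ((h (proj y) - \<beta>' (proj y))\<^sup>2) \<partial>hausdorff_measure 2)"
      unfolding nn_integral_boundary_measure by (simp, intro nn_integral_mono) (auto simp: indicator_def)
    also have "\<dots> \<le> 2 * (\<integral>\<^sup>+z. indicator \<Omega> z * ennreal ((h z - \<beta>' z)\<^sup>2) \<partial>lborel)"
      using h(1) \<beta>'(1) by (intro nn_integral_hausdorff_emb_le[OF \<Omega> \<Omega>b]) measurable
    also have "\<dots> \<le> 2 * (\<integral>\<^sup>+z. ennreal ((h z - \<beta>' z)\<^sup>2) \<partial>lborel)"
      by (intro mult_left_mono nn_integral_mono) (auto simp: indicator_def)
    also have "(\<integral>\<^sup>+z. ennreal ((h z - \<beta>' z)\<^sup>2) \<partial>lborel) = ennreal (LINT z|lborel. (h z - \<beta>' z)\<^sup>2)"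
      by (intro nn_integral_eq_integral h) auto
    finally show ?thesis .
  qed
  have VG: "has_trace_real D V G"
    unfolding has_trace_real_def
  proof (intro conjI exI[of _ E] allI V1 E1 sE lim Gm)
    show "integrable (boundary_measure D) (\<lambda>y. (G y)\<^sup>2)"
    proof (rule integrableI_nonneg)
      show "(\<lambda>y. (G y)\<^sup>2) \<in> borel_measurable (boundary_measure D)" using Gm by (rule borel_measurable_power)
      have "(\<integral>\<^sup>+ y. ennreal ((0 - G y)\<^sup>2) \<partial>boundary_measure D) \<le> 2 * ennreal (LINT z|lborel. (0 - \<beta>' z)\<^sup>2)"
        by (rule transfer) (use \<beta>'(4) in auto)
      also have "\<dots> < \<infinity>" by (simp add: ennreal_mult_less_top)
      finally show "(\<integral>\<^sup>+ y. ennreal ((G y)\<^sup>2) \<partial>boundary_measure D) < \<infinity>" by simp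
    qed simp
    show "(\<lambda>j. \<integral>\<^sup>+ y. ennreal ((E j y - G y)\<^sup>2) \<partial>boundary_measure D) \<longlonglongrightarrow> 0"
    proof (rule tendsto_sandwich[of "\<lambda>_. 0"])
      show "\<forall>\<^sub>F j in sequentially. (\<integral>\<^sup>+ y. ennreal ((E j y - G y)\<^sup>2) \<partial>boundary_measure D) \<le> 2 * ennreal (LINT z|lborel. (\<phi> j z - \<beta>' z)\<^sup>2)"
      proof (intro always_eventually allI transfer)
        fix j
        show "\<phi> j \<in> borel_measurable borel" by (rule test_functions_lborel(1)[OF \<phi>(2)])
        show "integrable lborel (\<lambda>z. (\<phi> j z - \<beta>' z)\<^sup>2)"
          using test_functions_lborel[OF \<phi>(2)] \<beta>'(1,4) by (intro integrable_power2_diff) simp_all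
      qed (rule Efr)
      have "(\<lambda>j. 2 * ennreal (LINT z|lborel. (\<phi> j z - \<beta>' z)\<^sup>2)) \<longlonglongrightarrow> 2 * ennreal 0"
        by (intro ennreal_tendsto_cmult tendsto_ennrealI lim0) simp
      then show "(\<lambda>j. 2 * ennreal (LINT z|lborel. (\<phi> j z - \<beta>' z)\<^sup>2)) \<longlonglongrightarrow> 0" by simp
    qed auto
  qed
  have pf: "plate_field D \<Omega> \<beta> y = G y *\<^sub>R axis 3 1" for y
    using n by (auto simp: plate_field_def G_def)
  have zero: "has_trace_real D (\<lambda>x. 0) (\<lambda>y. 0)"
    by (rule Sobolev0_has_trace_zero[OF D(1) test_functions_Sobolev0[OF D(1) test_functions_zero], of 1]) simp
  have cases: "axis 3 1 \<bullet> b = (if b = axis 3 1 then 1 else 0 :: real)" if "b \<in> Basis" for b :: "real^3"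
    using that by (auto simp: Basis_vec3 inner_axis_axis axis_eq_axis)
  show thesis
  proof (rule that[of "\<lambda>x. V x *\<^sub>R (axis 3 1 :: real^3)"])
    show "(\<lambda>x. V x *\<^sub>R (axis 3 1 :: real^3)) \<in> Sobolev_vec 1 D"
      unfolding Sobolev_vec_def using V1 Sobolev_zero[of 1 D] by (auto simp: cases simp del: Sobolev.simps One_nat_def)
    show "has_trace D (\<lambda>x. V x *\<^sub>R (axis 3 1 :: real^3)) (plate_field D \<Omega> \<beta>)"
      unfolding has_trace_def pf using VG zero by (auto simp: cases)
  qed
qed

section \<open>Weak solutions of the stationary flow-plate system\<close>

lemma Sobolev_vec_component:
  fixes v :: "real^3 \<Rightarrow> real^3"
  shows "v \<in> Sobolev_vec k D \<Longrightarrow> (\<lambda>x. v x $ i) \<in> Sobolev k D"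
  by (auto simp: Sobolev_vec_def Basis_vec_def inner_axis)

lemma Sobolev_vec_L2:
  "v \<in> Sobolev_vec k D \<Longrightarrow> v \<in> L2_space D"
  by (rule L2_space_componentwise) (auto simp: Sobolev_vec_def dest: Sobolev_L2)

lemma L2_space_vec:
  fixes f :: "'a::euclidean_space \<Rightarrow> real^'n"
  assumes "\<And>i. (\<lambda>x. f x $ i) \<in> L2_space D"
  shows "f \<in> L2_space D"
  by (rule L2_space_componentwise) (use assms in \<open>auto simp: Basis_vec_def inner_axis\<close>)

lemma L2_space_matrix:
  fixes f :: "'a::euclidean_space \<Rightarrow> real^'n^'m"
  assumes "\<And>i j. (\<lambda>x. f x $ i $ j) \<in> L2_space D"
  shows "f \<in> L2_space D"
proof (rule L2_space_componentwise)
  fix b :: "real^'n^'m" assume "b \<in> Basis"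
  then obtain i c where "b = axis i c" "c \<in> Basis" by (auto simp: Basis_vec_def)
  then obtain j where "b = axis i (axis j 1)" by (auto simp: Basis_vec_def)
  then show "(\<lambda>x. f x \<bullet> b) \<in> L2_space D" using assms[of i j] by (simp add: inner_axis)
qed

lemma weak_jacobian_L2:
  assumes "open D" "v \<in> Sobolev_vec (Suc k) D"
  shows "(\<lambda>x. weak_jacobian D v x $ i $ j) \<in> L2_space D"
    "is_weak_deriv D (axis j 1) (\<lambda>x. v x $ i) (\<lambda>x. weak_jacobian D v x $ i $ j)"
  using weak_deriv_Sobolev[OF assms(1) Sobolev_vec_component[OF assms(2)], of "axis j 1" i] Sobolev_L2
  by (auto simp: weak_jacobian_def axis_in_Basis_iff)

lemma weak_div_L2:
  assumes "open D" "v \<in> Sobolev_vec (Suc k) D"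
  shows "weak_div D v \<in> L2_space D"
  unfolding weak_div_def[abs_def] by (intro L2_space_sum weak_jacobian_L2(1)[OF assms])

lemma strain_L2:
  assumes "open D" "v \<in> Sobolev_vec (Suc k) D"
  shows "strain D v \<in> L2_space D"
proof (rule L2_space_matrix)
  fix i j
  have "(\<lambda>x. 1/2 * (weak_jacobian D v x $ j $ i + weak_jacobian D v x $ i $ j)) \<in> L2_space D"
    by (intro L2_space_cmult L2_space_add weak_jacobian_L2(1)[OF assms])
  then show "(\<lambda>x. strain D v x $ i $ j) \<in> L2_space D" by (simp add: strain_def)
qed

lemma stress_L2:
  assumes "open D" "v \<in> Sobolev_vec (Suc k) D"
  shows "stress D nu lam v \<in> L2_space D"
proof (rule L2_space_matrix)
  fix i j
  have "(\<lambda>x. strain D v x $ i $ j) \<in> L2_space D"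
    using L2_space_inner_left[OF strain_L2[OF assms], of "axis i (axis j 1)"] by (simp add: inner_axis)
  then have "(\<lambda>x. (2 * nu) * (strain D v x $ i $ j) + (lam * (mat 1 :: real^3^3) $ i $ j) * weak_div D v x) \<in> L2_space D"
    by (intro L2_space_add L2_space_cmult weak_div_L2[OF assms])
  then show "(\<lambda>x. stress D nu lam v x $ i $ j) \<in> L2_space D" by (simp add: stress_def mult_ac)
qed

lemma stress_sym: "stress D nu lam u x $ i $ j = stress D nu lam u x $ j $ i"
  by (simp add: stress_def strain_def mat_def add.commute)

definition directional_deriv :: "(real^3 \<Rightarrow> real^3) \<Rightarrow> (real^3 \<Rightarrow> real) \<Rightarrow> real^3 \<Rightarrow> real" where
  "directional_deriv U \<phi> x = (\<Sum>j\<in>UNIV. U x $ j * pderivative (axis j 1) \<phi> x)"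

lemma test_mult_L2:
  assumes "f \<in> L2_space D" "\<phi> \<in> test_functions E"
  shows "(\<lambda>x. f x * \<phi> x) \<in> L2_space D"
proof -
  obtain M where M: "\<And>x. \<bar>\<phi> x\<bar> \<le> M" using test_functions_bounded[OF assms(2)] by metis
  have "(\<lambda>x. \<phi> x * f x) \<in> L2_space D"
    by (rule L2_space_bounded_mult[OF assms(1) _ AE_I2[OF M]])
      (intro continuous_measurable_lebesgue_on smooth_continuous test_functions_smooth[OF assms(2)])
  then show ?thesis by (simp add: mult.commute)
qed

lemma directional_deriv_L2:
  assumes "open D" "U \<in> Sobolev_vec k D" "\<phi> \<in> test_functions E"
  shows "directional_deriv U \<phi> \<in> L2_space D"
  unfolding directional_deriv_def[abs_def]
  by (intro L2_space_sum test_mult_L2[OF Sobolev_L2[OF Sobolev_vec_component[OF assms(2)]] test_functions_pderivative[OF assms(3)]])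

text \<open>Each component of U is tested with the product of the two test functions. As a
  consequence test functions belong to \<open>W_space\<close> and may be inserted in the first
  equation.\<close>

lemma is_transport_test_function:
  assumes D: "open D" and U: "U \<in> Sobolev_vec (Suc k) D" and \<phi>: "\<phi> \<in> test_functions D"
  shows "is_transport D U \<phi> (directional_deriv U \<phi>)"
  unfolding is_transport_def
proof
  fix \<eta> assume \<eta>: "\<eta> \<in> test_functions D"
  have Dm: "D \<in> sets lebesgue" using D by auto
  have UL: "(\<lambda>x. U x $ j) \<in> L2_space D" for j by (rule Sobolev_L2[OF Sobolev_vec_component[OF U]])
  have s\<phi>: "smooth \<phi>" and s\<eta>: "smooth \<eta>" using \<phi> \<eta> by (auto intro: test_functions_smooth)
  have \<phi>\<eta>: "(\<lambda>x. \<phi> x * \<eta> x) \<in> test_functions D" by (rule test_functions_smooth_mult[OF \<eta> s\<phi>])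
  have i1: "integrable (lebesgue_on D) (\<lambda>x. U x $ j * (\<phi> x * pderivative (axis j 1) \<eta> x))" for j
    by (intro L2_mult_integrable UL test_functions_L2[OF test_functions_smooth_mult[OF test_functions_pderivative[OF \<eta>] s\<phi>] Dm])
  have i2: "integrable (lebesgue_on D) (\<lambda>x. U x $ j * (\<eta> x * pderivative (axis j 1) \<phi> x))" for j
    by (intro L2_mult_integrable UL test_functions_L2[OF test_functions_smooth_mult[OF test_functions_pderivative[OF \<phi>] s\<eta>] Dm])
  have i3: "integrable (lebesgue_on D) (\<lambda>x. weak_jacobian D U x $ j $ j * (\<phi> x * \<eta> x))" for j
    by (intro L2_mult_integrable weak_jacobian_L2(1)[OF D U] test_functions_L2[OF \<phi>\<eta> Dm])
  have key: "(LINT x|lebesgue_on D. U x $ j * (\<eta> x * pderivative (axis j 1) \<phi> x)) =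
    - ((LINT x|lebesgue_on D. U x $ j * (\<phi> x * pderivative (axis j 1) \<eta> x)) + (LINT x|lebesgue_on D. weak_jacobian D U x $ j $ j * (\<phi> x * \<eta> x)))" for j
  proof -
    have "(LINT x|lebesgue_on D. U x $ j * pderivative (axis j 1) (\<lambda>x. \<phi> x * \<eta> x) x) = - (LINT x|lebesgue_on D. weak_jacobian D U x $ j $ j * (\<phi> x * \<eta> x))"
      using weak_jacobian_L2(2)[OF D U, of j j] \<phi>\<eta> by (simp add: is_weak_deriv_def)
    also have "(LINT x|lebesgue_on D. U x $ j * pderivative (axis j 1) (\<lambda>x. \<phi> x * \<eta> x) x)
      = (LINT x|lebesgue_on D. U x $ j * (\<phi> x * pderivative (axis j 1) \<eta> x) + U x $ j * (\<eta> x * pderivative (axis j 1) \<phi> x))"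
      by (simp add: pderivative_mult smooth_differentiable s\<phi> s\<eta> algebra_simps)
    also have "\<dots> = (LINT x|lebesgue_on D. U x $ j * (\<phi> x * pderivative (axis j 1) \<eta> x)) + (LINT x|lebesgue_on D. U x $ j * (\<eta> x * pderivative (axis j 1) \<phi> x))"
      by (rule Bochner_Integration.integral_add[OF i1 i2])
    finally show ?thesis by linarith
  qed
  have "(LINT x|lebesgue_on D. directional_deriv U \<phi> x * \<eta> x) = (LINT x|lebesgue_on D. (\<Sum>j\<in>UNIV. U x $ j * (\<eta> x * pderivative (axis j 1) \<phi> x)))"
    by (simp add: directional_deriv_def sum_distrib_left mult_ac)
  also have "\<dots> = (\<Sum>j\<in>UNIV. LINT x|lebesgue_on D. U x $ j * (\<eta> x * pderivative (axis j 1) \<phi> x))"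
    by (rule Bochner_Integration.integral_sum) (rule i2)
  also have "\<dots> = - ((\<Sum>j\<in>UNIV. LINT x|lebesgue_on D. U x $ j * (\<phi> x * pderivative (axis j 1) \<eta> x))
      + (\<Sum>j\<in>UNIV. LINT x|lebesgue_on D. weak_jacobian D U x $ j $ j * (\<phi> x * \<eta> x)))"
    by (simp only: key sum_negf sum.distrib)
  also have "\<dots> = - (LINT x|lebesgue_on D. (\<Sum>j\<in>UNIV. U x $ j * (\<phi> x * pderivative (axis j 1) \<eta> x)) + (\<Sum>j\<in>UNIV. weak_jacobian D U x $ j $ j * (\<phi> x * \<eta> x)))"
    using i1 i3 by simp
  also have "\<dots> = - (LINT x|lebesgue_on D. \<phi> x * ((\<Sum>j\<in>UNIV. U x $ j * pderivative (axis j 1) \<eta> x) + weak_div D U x * \<eta> x))"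
    by (simp add: weak_div_def sum_distrib_left sum_distrib_right distrib_left mult_ac)
  finally show "(LINT x|lebesgue_on D. directional_deriv U \<phi> x * \<eta> x) =
    - (LINT x|lebesgue_on D. \<phi> x * ((\<Sum>j\<in>UNIV. U x $ j * pderivative (axis j 1) \<eta> x) + weak_div D U x * \<eta> x))" .
qed

section \<open>Functions representing distributions; square integrability of the convection
  term\<close>

lemma is_transport_unique:
  assumes "open D" "f \<in> L2_space D" "g \<in> L2_space D" "is_transport D U q f" "is_transport D U q g"
  shows "AE x in lebesgue_on D. f x = g x"
  using assms by (intro L2_AE_eq_of_test_functions) (auto simp: is_transport_def)

lemma transport_works:
  assumes "open D" "f \<in> L2_space D" "is_transport D U q f"
  shows "transport D U q \<in> L2_space D" "is_transport D U q (transport D U q)"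
    "AE x in lebesgue_on D. transport D U q x = f x"
proof -
  have "transport D U q \<in> L2_space D \<and> is_transport D U q (transport D U q)"
    unfolding transport_def by (rule someI[of _ f]) (use assms in simp)
  then show "transport D U q \<in> L2_space D" "is_transport D U q (transport D U q)" by auto
  then show "AE x in lebesgue_on D. transport D U q x = f x"
    using assms by (intro is_transport_unique)
qed

lemma is_stress_div_unique:
  assumes D: "open D" and F: "F \<in> L2_space D" "G \<in> L2_space D" "is_stress_div D nu lam p u F" "is_stress_div D nu lam p u G"
  shows "AE x in lebesgue_on D. F x = G x"
proof -
  have "AE x in lebesgue_on D. F x $ i = G x $ i" for i
  proof (rule L2_AE_eq_of_test_functions[OF D])
    show "(\<lambda>x. F x $ i) \<in> L2_space D" "(\<lambda>x. G x $ i) \<in> L2_space D"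
      using F(1,2)[THEN L2_space_inner_left, of "axis i 1"] by (simp_all add: inner_axis)
  qed (use F(3,4) in \<open>auto simp: is_stress_div_def\<close>)
  then have "AE x in lebesgue_on D. \<forall>i. F x $ i = G x $ i" by (simp add: AE_all_countable)
  then show ?thesis by eventually_elim (simp add: vec_eq_iff)
qed

lemma stress_div_works:
  assumes "open D" "F \<in> L2_space D" "is_stress_div D nu lam p u F"
  shows "stress_div D nu lam p u \<in> L2_space D" "AE x in lebesgue_on D. stress_div D nu lam p u x = F x"
proof -
  have "stress_div D nu lam p u \<in> L2_space D \<and> is_stress_div D nu lam p u (stress_div D nu lam p u)"
    unfolding stress_div_def by (rule someI[of _ F]) (use assms in simp)
  then show "stress_div D nu lam p u \<in> L2_space D" "AE x in lebesgue_on D. stress_div D nu lam p u x = F x"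
    using assms is_stress_div_unique by auto
qed

text \<open>The Jacobian of u is merely square integrable; multiplication by U preserves this
  because components in H^3 are essentially bounded.\<close>

lemma convection_L2:
  assumes D: "open D" "bounded D" "convex D" and U: "U \<in> Sobolev_vec 3 D" and u: "u \<in> Sobolev_vec (Suc k) D"
  shows "convection D U u \<in> L2_space D"
proof (rule L2_space_vec)
  fix i
  have "(\<lambda>x. U x $ j * weak_jacobian D u x $ i $ j) \<in> L2_space D" for j
  proof -
    obtain M where M: "AE x in lebesgue_on D. \<bar>U x $ j\<bar> \<le> M"
      using Sobolev_3_bounded[OF D Sobolev_vec_component[OF U]] by metis
    show ?thesis
      by (rule L2_space_bounded_mult[OF weak_jacobian_L2(1)[OF D(1) u] _ M])
        (rule L2_spaceD(1)[OF Sobolev_L2[OF Sobolev_vec_component[OF U]]])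
  qed
  then have "(\<lambda>x. \<Sum>j\<in>UNIV. U x $ j * weak_jacobian D u x $ i $ j) \<in> L2_space D" by (rule L2_space_sum)
  then show "(\<lambda>x. convection D U u x $ i) \<in> L2_space D"
    by (simp add: convection_def matrix_vector_mult_def mult.commute)
qed

section \<open>The weak bilaplacian\<close>

lemma weak_laplacian_L2:
  assumes "open D" "v \<in> Sobolev 2 D"
  shows "weak_laplacian D v \<in> L2_space D"
proof -
  have v: "v \<in> Sobolev (Suc 1) D" using assms(2) by (simp only: Suc_1)
  have "weak_deriv D b (weak_deriv D b v) \<in> L2_space D" if "b \<in> Basis" for b
    using weak_deriv_Sobolev(1)[OF assms(1) weak_deriv_Sobolev(1)[OF assms(1) v that, unfolded One_nat_def] that] by simp
  then show ?thesis unfolding weak_laplacian_def[abs_def] by (rule L2_space_sum)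
qed

lemma test_functions_laplacian: "\<phi> \<in> test_functions D \<Longrightarrow> laplacian \<phi> \<in> test_functions D"
  unfolding laplacian_def[abs_def] by (intro test_functions_sum test_functions_pderivative)

lemma LINT_mult_sum_right:
  fixes f :: "'a::euclidean_space \<Rightarrow> real"
  assumes "f \<in> L2_space D" "\<And>b. b \<in> I \<Longrightarrow> g b \<in> L2_space D"
  shows "(LINT x|lebesgue_on D. f x * (\<Sum>b\<in>I. g b x)) = (\<Sum>b\<in>I. LINT x|lebesgue_on D. f x * g b x)"
  unfolding sum_distrib_left by (rule Bochner_Integration.integral_sum) (intro L2_mult_integrable assms)

lemma LINT_mult_sum_left:
  fixes f :: "'a::euclidean_space \<Rightarrow> real"
  assumes "f \<in> L2_space D" "\<And>b. b \<in> I \<Longrightarrow> g b \<in> L2_space D"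
  shows "(LINT x|lebesgue_on D. (\<Sum>b\<in>I. g b x) * f x) = (\<Sum>b\<in>I. LINT x|lebesgue_on D. g b x * f x)"
  unfolding sum_distrib_right by (rule Bochner_Integration.integral_sum) (intro L2_mult_integrable assms)

lemma LINT_laplacian_test_function:
  assumes D: "open D" and w: "w \<in> Sobolev 2 D" and \<phi>: "\<phi> \<in> test_functions D"
  shows "(LINT x|lebesgue_on D. w x * laplacian \<phi> x) = (LINT x|lebesgue_on D. weak_laplacian D w x * \<phi> x)"
proof -
  have Dm: "D \<in> sets lebesgue" using D by auto
  have w2: "w \<in> Sobolev (Suc 1) D" using w by (simp only: Suc_1)
  have w1: "weak_deriv D b w \<in> Sobolev 1 D" "is_weak_deriv D b w (weak_deriv D b w)" if "b \<in> Basis" for b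
    using weak_deriv_Sobolev[OF D w2 that] by auto
  have w0: "weak_deriv D b (weak_deriv D b w) \<in> L2_space D" "is_weak_deriv D b (weak_deriv D b w) (weak_deriv D b (weak_deriv D b w))" if "b \<in> Basis" for b
    using weak_deriv_Sobolev[OF D w1(1)[OF that, unfolded One_nat_def] that] by auto
  have p: "pderivative b (pderivative b \<phi>) \<in> L2_space D" for b
    by (intro test_functions_L2[where E=D, OF _ Dm] test_functions_pderivative \<phi>)
  have "(LINT x|lebesgue_on D. w x * laplacian \<phi> x) = (\<Sum>b\<in>Basis. LINT x|lebesgue_on D. w x * pderivative b (pderivative b \<phi>) x)"
    unfolding laplacian_def by (rule LINT_mult_sum_right[OF Sobolev_L2[OF w] p])
  also have "\<dots> = (\<Sum>b\<in>Basis. LINT x|lebesgue_on D. weak_deriv D b (weak_deriv D b w) x * \<phi> x)"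
  proof (rule sum.cong[OF refl])
    fix b :: 'a assume b: "b \<in> Basis"
    show "(LINT x|lebesgue_on D. w x * pderivative b (pderivative b \<phi>) x) = (LINT x|lebesgue_on D. weak_deriv D b (weak_deriv D b w) x * \<phi> x)"
      using w1(2)[OF b] w0(2)[OF b] test_functions_pderivative[OF \<phi>, of b] \<phi> unfolding is_weak_deriv_def by simp
  qed
  also have "\<dots> = (LINT x|lebesgue_on D. weak_laplacian D w x * \<phi> x)"
    unfolding weak_laplacian_def by (rule LINT_mult_sum_left[symmetric, OF test_functions_L2[OF \<phi> Dm] w0(1)])
  finally show ?thesis .
qed

text \<open>One Laplacian is moved from the test function to w; the remaining second derivatives
  converge in L^2 to those of \<beta>. All approximating sequences give the same limit, so
  \<open>THE\<close> has a witness, and it is unique because \<beta> possesses such a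
  sequence.\<close>

lemma bilaplacian_pairing_eq:
  assumes D: "open D" and w: "w \<in> Sobolev 2 D" and \<beta>: "\<beta> \<in> Sobolev0 2 D"
  shows "bilaplacian_pairing D w \<beta> = L2_inner D (weak_laplacian D w) (weak_laplacian D \<beta>)"
proof -
  have Dm: "D \<in> sets lebesgue" using D by auto
  have \<beta>2: "\<beta> \<in> Sobolev (Suc (Suc 0)) D" using \<beta> by (simp add: Sobolev0_def numeral_2_eq_2)
  have lim: "(\<lambda>j. LINT x|lebesgue_on D. w x * laplacian (laplacian (\<phi> j)) x) \<longlonglongrightarrow> L2_inner D (weak_laplacian D w) (weak_laplacian D \<beta>)"
    if \<phi>: "\<And>j. \<phi> j \<in> test_functions D" "Sobolev_tendsto 2 D \<phi> \<beta>" for \<phi>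
  proof -
    have t2: "Sobolev_tendsto (Suc (Suc 0)) D \<phi> \<beta>" using \<phi>(2) by (simp only: numeral_2_eq_2)
    have "(\<lambda>j. LINT x|lebesgue_on D. pderivative b (pderivative b (\<phi> j)) x * weak_laplacian D w x) \<longlonglongrightarrow>
        (LINT x|lebesgue_on D. weak_deriv D b (weak_deriv D b \<beta>) x * weak_laplacian D w x)" if b: "b \<in> Basis" for b
    proof (rule L2_inner_tendsto)
      have 1: "weak_deriv D b \<beta> \<in> Sobolev (Suc 0) D" by (rule weak_deriv_Sobolev(1)[OF D \<beta>2 b])
      show "weak_deriv D b (weak_deriv D b \<beta>) \<in> L2_space D" using weak_deriv_Sobolev(1)[OF D 1 b] by simp
      show "weak_laplacian D w \<in> L2_space D" by (rule weak_laplacian_L2[OF D w])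
      show "pderivative b (pderivative b (\<phi> j)) \<in> L2_space D" for j
        by (intro test_functions_L2[where E=D, OF _ Dm] test_functions_pderivative \<phi>)
      have "Sobolev_tendsto (Suc 0) D (\<lambda>j. pderivative b (\<phi> j)) (weak_deriv D b \<beta>)"
        by (rule Sobolev_tendsto_pderivative[OF D \<phi>(1) \<beta>2 t2 b])
      then have "Sobolev_tendsto 0 D (\<lambda>j. pderivative b (pderivative b (\<phi> j))) (weak_deriv D b (weak_deriv D b \<beta>))"
        by (rule Sobolev_tendsto_pderivative[OF D test_functions_pderivative[OF \<phi>(1)] 1 _ b])
      then show "(\<lambda>j. LINT x|lebesgue_on D. (pderivative b (pderivative b (\<phi> j)) x - weak_deriv D b (weak_deriv D b \<beta>) x)\<^sup>2) \<longlonglongrightarrow> 0"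
        by (rule Sobolev_tendsto_L2)
    qed
    then have "(\<lambda>j. \<Sum>b\<in>Basis. LINT x|lebesgue_on D. pderivative b (pderivative b (\<phi> j)) x * weak_laplacian D w x) \<longlonglongrightarrow>
        (\<Sum>b\<in>Basis. LINT x|lebesgue_on D. weak_deriv D b (weak_deriv D b \<beta>) x * weak_laplacian D w x)"
      by (rule tendsto_sum)
    moreover have "(\<Sum>b\<in>Basis. LINT x|lebesgue_on D. pderivative b (pderivative b (\<phi> j)) x * weak_laplacian D w x)
      = (LINT x|lebesgue_on D. w x * laplacian (laplacian (\<phi> j)) x)" for j
    proof -
      have "(\<Sum>b\<in>Basis. LINT x|lebesgue_on D. pderivative b (pderivative b (\<phi> j)) x * weak_laplacian D w x)
        = (LINT x|lebesgue_on D. laplacian (\<phi> j) x * weak_laplacian D w x)"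
        unfolding laplacian_def
        by (rule LINT_mult_sum_left[symmetric, OF weak_laplacian_L2[OF D w]])
          (intro test_functions_L2[where E=D, OF _ Dm] test_functions_pderivative \<phi>)
      also have "\<dots> = (LINT x|lebesgue_on D. w x * laplacian (laplacian (\<phi> j)) x)"
        using LINT_laplacian_test_function[OF D w test_functions_laplacian[OF \<phi>(1)], of j] by (simp add: mult.commute)
      finally show ?thesis .
    qed
    moreover have "(\<Sum>b\<in>Basis. LINT x|lebesgue_on D. weak_deriv D b (weak_deriv D b \<beta>) x * weak_laplacian D w x)
      = L2_inner D (weak_laplacian D w) (weak_laplacian D \<beta>)"
    proof -
      have "weak_deriv D b (weak_deriv D b \<beta>) \<in> L2_space D" if "b \<in> Basis" for b
        using weak_deriv_Sobolev(1)[OF D weak_deriv_Sobolev(1)[OF D \<beta>2 that] that] by simp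
      then have "(\<Sum>b\<in>Basis. LINT x|lebesgue_on D. weak_deriv D b (weak_deriv D b \<beta>) x * weak_laplacian D w x)
        = (LINT x|lebesgue_on D. weak_laplacian D \<beta> x * weak_laplacian D w x)"
        unfolding weak_laplacian_def[of D \<beta>]
        by (rule LINT_mult_sum_left[symmetric, OF weak_laplacian_L2[OF D w]])
      then show ?thesis by (simp add: L2_inner_def mult.commute)
    qed
    ultimately show ?thesis by simp
  qed
  obtain \<phi> where \<phi>: "\<And>j. \<phi> j \<in> test_functions D" "Sobolev_tendsto 2 D \<phi> \<beta>"
    using \<beta> unfolding Sobolev0_def by blast
  show ?thesis unfolding bilaplacian_pairing_def
  proof (rule the_equality)
    show "\<forall>\<phi>. (\<forall>j. \<phi> j \<in> test_functions D) \<and> Sobolev_tendsto 2 D \<phi> \<beta> \<longrightarrow>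
        (\<lambda>j. LINT x|lebesgue_on D. w x * laplacian (laplacian (\<phi> j)) x) \<longlonglongrightarrow> L2_inner D (weak_laplacian D w) (weak_laplacian D \<beta>)"
      using lim by blast
    fix c assume "\<forall>\<phi>. (\<forall>j. \<phi> j \<in> test_functions D) \<and> Sobolev_tendsto 2 D \<phi> \<beta> \<longrightarrow>
        (\<lambda>j. LINT x|lebesgue_on D. w x * laplacian (laplacian (\<phi> j)) x) \<longlonglongrightarrow> c"
    then have "(\<lambda>j. LINT x|lebesgue_on D. w x * laplacian (laplacian (\<phi> j)) x) \<longlonglongrightarrow> c" using \<phi> by blast
    then show "c = L2_inner D (weak_laplacian D w) (weak_laplacian D \<beta>)"
      using lim[OF \<phi>] by (rule LIMSEQ_unique)
  qed
qed

section \<open>Test fields and evaluation of the stress trace\<close>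

lemma L2_inner_cong_AE:
  assumes "f \<in> L2_space D" "f' \<in> L2_space D" "g \<in> L2_space D" "g' \<in> L2_space D"
    "AE x in lebesgue_on D. f x = f' x" "AE x in lebesgue_on D. g x = g' x"
  shows "L2_inner D f g = L2_inner D f' g'"
  unfolding L2_inner_def
proof (rule integral_cong_AE)
  show "(\<lambda>x. f x \<bullet> g x) \<in> borel_measurable (lebesgue_on D)" "(\<lambda>x. f' x \<bullet> g' x) \<in> borel_measurable (lebesgue_on D)"
    using assms(1-4)[THEN L2_spaceD(1)] by (auto intro: borel_measurable_inner)
  show "AE x in lebesgue_on D. f x \<bullet> g x = f' x \<bullet> g' x"
    using assms(5,6) by eventually_elim simp
qed

lemma L2_inner_zero_right: "L2_inner D f (\<lambda>x. 0) = 0"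
  by (simp add: L2_inner_def)

lemma weak_laplacian_zero:
  assumes "open D" shows "AE x in lebesgue_on D. weak_laplacian D (\<lambda>x. 0) x = 0"
proof -
  have Dm: "D \<in> sets lebesgue" using assms by auto
  have "AE x in lebesgue_on D. weak_deriv D b (weak_deriv D b (\<lambda>x. 0)) x = 0" for b
  proof -
    note w = weak_deriv_works[OF assms L2_space_zero is_weak_deriv_zero, of b]
    have "weak_deriv D b (weak_deriv D b (\<lambda>x. 0)) = weak_deriv D b (\<lambda>x. 0)"
      by (rule weak_deriv_cong_AE[OF Dm w(1) L2_space_zero w(3)])
    then show ?thesis using w(3) by simp
  qed
  then have "AE x in lebesgue_on D. \<forall>b\<in>Basis. weak_deriv D b (weak_deriv D b (\<lambda>x. 0)) x = 0"
    by (subst AE_ball_countable) (auto simp: countable_finite)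
  then show ?thesis by eventually_elim (simp add: weak_laplacian_def)
qed

lemma has_trace_test_field:
  assumes "open D" "\<phi> \<in> test_functions D"
  shows "has_trace D (\<lambda>x. \<phi> x *\<^sub>R e) (\<lambda>y. 0)"
  unfolding has_trace_def
proof
  fix b :: 'b
  have "(\<lambda>x. (e \<bullet> b) * \<phi> x) \<in> test_functions D"
    by (rule test_functions_smooth_mult[OF assms(2) smooth_const])
  from Sobolev0_has_trace_zero[OF assms(1) test_functions_Sobolev0[OF assms(1) this], of 1]
  show "has_trace_real D (\<lambda>x. (\<phi> x *\<^sub>R e) \<bullet> b) (\<lambda>y. 0 \<bullet> b)" by (simp add: mult.commute)
qed

lemma Sobolev_vec_mono: "v \<in> Sobolev_vec n D \<Longrightarrow> k \<le> n \<Longrightarrow> v \<in> Sobolev_vec k D"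
  by (auto simp: Sobolev_vec_def intro: Sobolev_mono)

lemma test_field_Sobolev_vec:
  assumes "D \<in> sets lebesgue" "\<phi> \<in> test_functions E"
  shows "(\<lambda>x. \<phi> x *\<^sub>R e) \<in> Sobolev_vec k D"
  unfolding Sobolev_vec_def
proof (intro CollectI ballI)
  fix b :: 'b
  have "(\<lambda>x. (e \<bullet> b) * \<phi> x) \<in> Sobolev k D"
    by (intro test_functions_Sobolev[where E=E, OF assms(1)] test_functions_smooth_mult[OF assms(2)] smooth_const)
  then show "(\<lambda>x. (\<phi> x *\<^sub>R e) \<bullet> b) \<in> Sobolev k D" by (simp add: mult.commute)
qed

lemma test_field_jacobian:
  assumes D: "open D" and \<phi>: "\<phi> \<in> test_functions D"
  shows "AE x in lebesgue_on D. \<forall>k j. weak_jacobian D (\<lambda>x. \<phi> x *\<^sub>R axis i 1) x $ k $ j = axis i 1 $ k * pderivative (axis j 1) \<phi> x"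
proof -
  have Dm: "D \<in> sets lebesgue" using D by auto
  have "AE x in lebesgue_on D. weak_jacobian D (\<lambda>x. \<phi> x *\<^sub>R axis i 1) x $ k $ j = axis i 1 $ k * pderivative (axis j 1) \<phi> x" for k j
  proof -
    have t: "(\<lambda>x. (axis i 1 $ k) * \<phi> x) \<in> test_functions D"
      by (rule test_functions_smooth_mult[OF \<phi> smooth_const])
    have "pderivative (axis j 1) (\<lambda>x. (axis i 1 $ k) * \<phi> x) x = axis i 1 $ k * pderivative (axis j 1) \<phi> x" for x
      using smooth_differentiable[OF test_functions_smooth[OF \<phi>]]
      by (subst pderivative_mult) (simp_all add: pderivative_const)
    then show ?thesis
      using weak_deriv_smooth[OF D test_functions_smooth[OF t] test_functions_L2[OF test_functions_pderivative[OF t] Dm], of "axis j 1"]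
      by (simp add: weak_jacobian_def mult.commute)
  qed
  then show ?thesis by (simp add: AE_all_countable)
qed

text \<open>Contracting a symmetric matrix with the symmetric part of a matrix is the same as
  contracting with the matrix itself. Here the latter has row i equal to d, as for the gradient of
  the field \<phi> e_i.\<close>

lemma symmetric_inner_strain:
  fixes \<sigma> :: "real^3^3"
  assumes "\<And>k j. \<sigma> $ k $ j = \<sigma> $ j $ k"
  shows "\<sigma> \<bullet> (\<chi> k j. 1/2 * (axis i 1 $ j * d k + axis i 1 $ k * d j)) = (\<Sum>j\<in>UNIV. \<sigma> $ i $ j * d j)"
  using exhaust_3[of i] assms[of 1 2] assms[of 1 3] assms[of 2 3]
  by (auto simp: inner_vec_def sum_3 axis_def algebra_simps)

text \<open>The condition under \<open>THE\<close> is an implication over all extensions, so every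
  number would satisfy it if there were none. One extension is therefore required for uniqueness,
  and the common value over all extensions for existence.\<close>

lemma stress_trace_eqI:
  assumes "\<psi> \<in> Sobolev_vec 1 D" "has_trace D \<psi> g"
    and "\<And>\<psi>. \<psi> \<in> Sobolev_vec 1 D \<Longrightarrow> has_trace D \<psi> g \<Longrightarrow>
      L2_inner D (stress_div D nu lam p u) \<psi> + L2_inner D (stress D nu lam u) (strain D \<psi>) - L2_inner D p (weak_div D \<psi>) = c"
  shows "stress_trace D nu lam p u g = c"
  unfolding stress_trace_def
proof (rule the_equality)
  show "\<forall>\<psi>\<in>Sobolev_vec 1 D. has_trace D \<psi> g \<longrightarrow>
        c = L2_inner D (stress_div D nu lam p u) \<psi> + L2_inner D (stress D nu lam u) (strain D \<psi>) - L2_inner D p (weak_div D \<psi>)"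
    using assms(3) by force
  fix c' assume "\<forall>\<psi>\<in>Sobolev_vec 1 D. has_trace D \<psi> g \<longrightarrow>
        c' = L2_inner D (stress_div D nu lam p u) \<psi> + L2_inner D (stress D nu lam u) (strain D \<psi>) - L2_inner D p (weak_div D \<psi>)"
  then have "c' = L2_inner D (stress_div D nu lam p u) \<psi> + L2_inner D (stress D nu lam u) (strain D \<psi>) - L2_inner D p (weak_div D \<psi>)"
    using assms(1,2) by blast
  also have "\<dots> = c" by (rule assms(3)[OF assms(1,2)])
  finally show "c' = c" .
qed

text \<open>A test function is an admissible q, and the chosen representative
  \<open>transport D U \<phi>\<close> agrees almost everywhere with the classical directional
  derivative.\<close>

lemma is_transport_of_weak_equation:
  assumes D: "open D" and U: "U \<in> Sobolev_vec (Suc k) D" and p: "p \<in> L2_space D" and u: "u \<in> Sobolev_vec (Suc l) D"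
    and eq: "\<And>q. q \<in> W_space D U \<Longrightarrow>
           L2_inner D (weak_div D u) q =
             (LINT x|lebesgue_on D. weak_div D U x * p x * q x)
             + (LINT x|lebesgue_on D. transport D U q x * p x)"
  shows "is_transport D U p (\<lambda>x. - weak_div D u x)"
  unfolding is_transport_def
proof
  fix \<phi> assume \<phi>: "\<phi> \<in> test_functions D"
  have Dm: "D \<in> sets lebesgue" using D by auto
  have \<phi>L: "\<phi> \<in> L2_space D" by (rule test_functions_L2[OF \<phi> Dm])
  note dL = directional_deriv_L2[OF D U \<phi>] and dt = is_transport_test_function[OF D U \<phi>]
  note t = transport_works[OF D dL dt]
  have "\<phi> \<in> W_space D U" unfolding W_space_def using \<phi>L dL dt by blast
  from eq[OF this] have "(LINT x|lebesgue_on D. weak_div D u x * \<phi> x) =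
             (LINT x|lebesgue_on D. weak_div D U x * p x * \<phi> x) + (LINT x|lebesgue_on D. transport D U \<phi> x * p x)"
    by (simp add: L2_inner_def)
  also have "(LINT x|lebesgue_on D. transport D U \<phi> x * p x) = (LINT x|lebesgue_on D. p x * directional_deriv U \<phi> x)"
    using L2_inner_cong_AE[OF t(1) dL p p t(3)] by (simp add: L2_inner_def mult.commute)
  also have "(LINT x|lebesgue_on D. weak_div D U x * p x * \<phi> x) = (LINT x|lebesgue_on D. p x * (weak_div D U x * \<phi> x))"
    by (simp add: mult_ac)
  also have "\<dots> + (LINT x|lebesgue_on D. p x * directional_deriv U \<phi> x) = (LINT x|lebesgue_on D. p x * (weak_div D U x * \<phi> x) + p x * directional_deriv U \<phi> x)"
    by (intro Bochner_Integration.integral_add[symmetric] L2_mult_integrable p dL test_mult_L2[OF weak_div_L2[OF D U] \<phi>])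
  finally show "(LINT x|lebesgue_on D. - weak_div D u x * \<phi> x) =
        - (LINT x|lebesgue_on D. p x * ((\<Sum>j\<in>UNIV. U x $ j * pderivative (axis j 1) \<phi> x) + weak_div D U x * \<phi> x))"
    by (simp add: directional_deriv_def distrib_left add.commute)
qed

lemma zero_in_Sobolev0: "open D \<Longrightarrow> (\<lambda>x. 0) \<in> Sobolev0 k D"
  by (intro test_functions_Sobolev0 test_functions_zero)

lemma weak_laplacian_zero_inner:
  assumes "open D" "w \<in> Sobolev 2 D"
  shows "L2_inner D (weak_laplacian D w) (weak_laplacian D (\<lambda>x. 0)) = 0"
proof -
  have "L2_inner D (weak_laplacian D w) (weak_laplacian D (\<lambda>x. 0)) = L2_inner D (weak_laplacian D w) (\<lambda>x. 0)"
    using weak_laplacian_L2[OF assms] weak_laplacian_L2[OF assms(1) Sobolev_zero] weak_laplacian_zero[OF assms(1)]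
    by (intro L2_inner_cong_AE L2_space_zero) auto
  then show ?thesis by (simp add: L2_inner_zero_right)
qed

lemma is_stress_div_of_weak_equation:
  assumes D: "open D" and \<Omega>: "open \<Omega>" and p: "p \<in> L2_space D" and u: "u \<in> Sobolev_vec (Suc k) D" and w: "w \<in> Sobolev 2 \<Omega>"
    and conv: "convection D U u \<in> L2_space D"
    and eq: "\<And>\<psi> \<beta>. in_V_Omega D S \<Omega> \<psi> \<beta> \<Longrightarrow>
           a_form D nu lam eta u \<psi> - L2_inner D p (weak_div D \<psi>) =
             - (LINT x|lebesgue_on D. convection D U u x \<bullet> \<psi> x)
             - L2_inner \<Omega> (weak_laplacian \<Omega> w) (weak_laplacian \<Omega> \<beta>)"
  shows "is_stress_div D nu lam p u (\<lambda>x. convection D U u x + eta *\<^sub>R u x)"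
  unfolding is_stress_div_def
proof (intro allI ballI)
  fix i \<phi> assume \<phi>: "\<phi> \<in> test_functions D"
  have Dm: "D \<in> sets lebesgue" using D by auto
  have \<phi>L: "\<phi> \<in> L2_space D" by (rule test_functions_L2[OF \<phi> Dm])
  define \<psi> where "\<psi> x = \<phi> x *\<^sub>R (axis i 1 :: real^3)" for x
  have \<psi>V: "\<psi> \<in> Sobolev_vec m D" for m unfolding \<psi>_def[abs_def] by (rule test_field_Sobolev_vec[OF Dm \<phi>])
  have tr: "has_trace D \<psi> (\<lambda>y. 0)" unfolding \<psi>_def[abs_def] by (rule has_trace_test_field[OF D \<phi>])
  \<comment> \<open>The field has zero trace, so its normal trace is \<beta> = 0 and the plate term
    drops out.\<close>
  have "in_V_Omega D S \<Omega> \<psi> (\<lambda>z. 0)"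
    unfolding in_V_Omega_def normal_trace_on_def
    using \<psi>V zero_in_Sobolev0[OF \<Omega>] tr by (auto intro!: exI[of _ "\<lambda>y. 0"])
  note e = eq[OF this, unfolded weak_laplacian_zero_inner[OF \<Omega> w] a_form_def]
  note J = test_field_jacobian[OF D \<phi>, of i, folded \<psi>_def]
  have uL: "u \<in> L2_space D" by (rule Sobolev_vec_L2[OF u])
  have pd: "pderivative b \<phi> \<in> L2_space D" for b by (rule test_functions_L2[OF test_functions_pderivative[OF \<phi>] Dm])
  have sL: "(\<lambda>x. stress D nu lam u x $ i $ j) \<in> L2_space D" for i j
    using L2_space_inner_left[OF stress_L2[OF D u], where b="axis i (axis j 1)"] by (simp add: inner_axis)
  have "L2_inner D (stress D nu lam u) (strain D \<psi>) = (LINT x|lebesgue_on D. (\<Sum>j\<in>UNIV. stress D nu lam u x $ i $ j * pderivative (axis j 1) \<phi> x))"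
    unfolding L2_inner_def
  proof (rule integral_cong_AE)
    show "(\<lambda>x. stress D nu lam u x \<bullet> strain D \<psi> x) \<in> borel_measurable (lebesgue_on D)"
      using L2_spaceD(1)[OF stress_L2[OF D u]] L2_spaceD(1)[OF strain_L2[OF D \<psi>V]] by (rule borel_measurable_inner)
    show "(\<lambda>x. \<Sum>j\<in>UNIV. stress D nu lam u x $ i $ j * pderivative (axis j 1) \<phi> x) \<in> borel_measurable (lebesgue_on D)"
      by (intro borel_measurable_sum borel_measurable_times L2_spaceD(1)[OF sL] L2_spaceD(1)[OF pd])
    show "AE x in lebesgue_on D. stress D nu lam u x \<bullet> strain D \<psi> x = (\<Sum>j\<in>UNIV. stress D nu lam u x $ i $ j * pderivative (axis j 1) \<phi> x)"
      using J
    proof eventually_elim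
      case (elim x)
      have "strain D \<psi> x = (\<chi> k j. 1/2 * (axis i 1 $ j * pderivative (axis k 1) \<phi> x + axis i 1 $ k * pderivative (axis j 1) \<phi> x))"
        using elim by (simp add: strain_def \<psi>_def[abs_def])
      then show ?case using symmetric_inner_strain[of "stress D nu lam u x" i] stress_sym by simp
    qed
  qed
  moreover have "L2_inner D p (weak_div D \<psi>) = L2_inner D p (pderivative (axis i 1) \<phi>)"
  proof (rule L2_inner_cong_AE[OF p p weak_div_L2[OF D \<psi>V] pd])
    show "AE x in lebesgue_on D. weak_div D \<psi> x = pderivative (axis i 1) \<phi> x"
      using J
    proof eventually_elim
      case (elim x)
      then show ?case using exhaust_3[of i] by (auto simp: weak_div_def sum_3 axis_def \<psi>_def[abs_def])
    qed
  qed simp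
  moreover have "L2_inner D u \<psi> = (LINT x|lebesgue_on D. u x $ i * \<phi> x)"
    by (simp add: L2_inner_def \<psi>_def inner_axis mult.commute)
  moreover have "(LINT x|lebesgue_on D. convection D U u x \<bullet> \<psi> x) = (LINT x|lebesgue_on D. convection D U u x $ i * \<phi> x)"
    by (simp add: \<psi>_def inner_axis mult.commute)
  moreover have "(LINT x|lebesgue_on D. (convection D U u x + eta *\<^sub>R u x) $ i * \<phi> x)
      = (LINT x|lebesgue_on D. convection D U u x $ i * \<phi> x) + eta * (LINT x|lebesgue_on D. u x $ i * \<phi> x)"
  proof -
    have "(\<lambda>x. convection D U u x $ i) \<in> L2_space D" "(\<lambda>x. u x $ i) \<in> L2_space D"
      using L2_space_inner_left[OF conv, of "axis i 1"] L2_space_inner_left[OF uL, of "axis i 1"] by (simp_all add: inner_axis)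
    then have "integrable (lebesgue_on D) (\<lambda>x. convection D U u x $ i * \<phi> x)" "integrable (lebesgue_on D) (\<lambda>x. u x $ i * \<phi> x)"
      using \<phi>L by (auto intro: L2_mult_integrable)
    then show ?thesis by (simp add: distrib_right mult.assoc)
  qed
  ultimately show "(LINT x|lebesgue_on D. (convection D U u x + eta *\<^sub>R u x) $ i * \<phi> x) =
        - (LINT x|lebesgue_on D. (\<Sum>j\<in>UNIV. stress D nu lam u x $ i $ j * pderivative (axis j 1) \<phi> x))
        + (LINT x|lebesgue_on D. p x * pderivative (axis i 1) \<phi> x)"
    using e by (simp add: L2_inner_def)
qed

theorem lemma6p1:
  fixes D S :: "(real^3) set" and \<Omega> :: "(real^2) set"
    and nu lam eta :: real
    and U u :: "real^3 \<Rightarrow> real^3" and p :: "real^3 \<Rightarrow> real" and w :: "real^2 \<Rightarrow> real"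
  assumes "flow_plate_geometry D S \<Omega>"
    and "nu > 0" and "lam \<ge> 0" and "eta > 0"
    and "U \<in> V0_space D \<inter> Sobolev_vec 3 D"
    and "p \<in> L2_space D" and "u \<in> V0_space D" and "w \<in> Sobolev0 2 \<Omega>"
    and "\<And>q. q \<in> W_space D U \<Longrightarrow>
           L2_inner D (weak_div D u) q =
             (LINT x|lebesgue_on D. weak_div D U x * p x * q x)
             + (LINT x|lebesgue_on D. transport D U q x * p x)"
    and "\<And>\<psi> \<beta>. in_V_Omega D S \<Omega> \<psi> \<beta> \<Longrightarrow>
           a_form D nu lam eta u \<psi> - L2_inner D p (weak_div D \<psi>) =
             - (LINT x|lebesgue_on D. convection D U u x \<bullet> \<psi> x)
             - L2_inner \<Omega> (weak_laplacian \<Omega> w) (weak_laplacian \<Omega> \<beta>)"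
  shows
    "p \<in> W_space D U \<and>
     (AE x in lebesgue_on D. transport D U p x + weak_div D u x = 0) \<and>
     (\<exists>F\<in>L2_space D. is_stress_div D nu lam p u F) \<and>
     (AE x in lebesgue_on D. convection D U u x - stress_div D nu lam p u x + eta *\<^sub>R u x = 0) \<and>
     (\<forall>\<tau>\<in>TH_half D. stress_trace D nu lam p u \<tau> = 0) \<and>
     normal_trace_on D u (frontier D) (\<lambda>_. 0) \<and>
     (\<forall>\<beta>\<in>Sobolev0 2 \<Omega>. plate_functional D \<Omega> nu lam p u w \<beta> = 0) \<and>
     trace_on \<Omega> w (frontier \<Omega>) (\<lambda>_. 0) \<and>
     normal_trace_on \<Omega> (weak_grad \<Omega> w) (frontier \<Omega>) (\<lambda>_. 0) \<and>
     (p, u, w, \<lambda>_. 0) \<in> dom_A D S \<Omega> nu lam U \<and>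
     state_zero D \<Omega> (op_A D \<Omega> nu lam eta U (p, u, w, \<lambda>_. 0)) \<and>
     (p, u, w, \<lambda>_. 0) \<in> null_A D S \<Omega> nu lam eta U"
proof -
  note geo = assms(1) and p = assms(6) and w0 = assms(8)
  have D: "open D" "bounded D" "convex D" and \<Omega>: "open \<Omega>" and S\<Omega>: "S \<inter> emb ` \<Omega> = {}"
    and n: "\<And>z. z \<in> \<Omega> \<Longrightarrow> outward_normal D (emb z) = axis 3 1"
    using geo by (auto simp: flow_plate_geometry_def)
  have U3: "U \<in> Sobolev_vec 3 D" and uV: "u \<in> Sobolev_vec 1 D" and u_normal: "normal_trace_on D u (frontier D) (\<lambda>_. 0)"
    using assms(5,7) by (auto simp: V0_space_def)
  have U: "U \<in> Sobolev_vec (Suc 0) D" by (rule Sobolev_vec_mono[OF U3]) simp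
  have u: "u \<in> Sobolev_vec (Suc 0) D" using uV by simp
  have uL: "u \<in> L2_space D" by (rule Sobolev_vec_L2[OF u])
  have w: "w \<in> Sobolev 2 \<Omega>" using w0 by (simp add: Sobolev0_def)

  have tr: "is_transport D U p (\<lambda>x. - weak_div D u x)"
    by (rule is_transport_of_weak_equation[OF D(1) U p u assms(9)])
  have trL: "(\<lambda>x. - weak_div D u x) \<in> L2_space D"
    using L2_space_cmult[OF weak_div_L2[OF D(1) u], of "-1"] by simp
  have pW: "p \<in> W_space D U" unfolding W_space_def using p tr trL by blast
  have mass: "AE x in lebesgue_on D. transport D U p x + weak_div D u x = 0"
    using transport_works(3)[OF D(1) trL tr] by eventually_elim simp

  have conv: "convection D U u \<in> L2_space D" by (rule convection_L2[OF D U3 u])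
  define F where "F x = convection D U u x + eta *\<^sub>R u x" for x
  have FL: "F \<in> L2_space D"
    unfolding F_def[abs_def] by (intro L2_space_add L2_space_scaleR conv uL)
  have F: "is_stress_div D nu lam p u F"
    unfolding F_def[abs_def] by (rule is_stress_div_of_weak_equation[OF D(1) \<Omega> p u w conv assms(10)])
  note sd = stress_div_works[OF D(1) FL F]
  have momentum: "AE x in lebesgue_on D. convection D U u x - stress_div D nu lam p u x + eta *\<^sub>R u x = 0"
    using sd(2) by eventually_elim (simp add: F_def)

  \<comment> \<open>After insertion of the momentum equation the terms with \<eta> and the
    convection cancel, and the expression defining the stress trace depends on the test field only
    through \<beta>.\<close>
  have green: "L2_inner D (stress_div D nu lam p u) \<psi> + L2_inner D (stress D nu lam u) (strain D \<psi>) - L2_inner D p (weak_div D \<psi>)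
      = - L2_inner \<Omega> (weak_laplacian \<Omega> w) (weak_laplacian \<Omega> \<beta>)" if V: "in_V_Omega D S \<Omega> \<psi> \<beta>" for \<psi> \<beta>
  proof -
    have \<psi>L: "\<psi> \<in> L2_space D" using V Sobolev_vec_L2 by (auto simp: in_V_Omega_def)
    have "L2_inner D (stress_div D nu lam p u) \<psi> = L2_inner D F \<psi>"
      using sd by (intro L2_inner_cong_AE FL \<psi>L) auto
    also have "\<dots> = (LINT x|lebesgue_on D. convection D U u x \<bullet> \<psi> x) + eta * L2_inner D u \<psi>"
      unfolding L2_inner_def F_def using L2_inner_integrable[OF conv \<psi>L] L2_inner_integrable[OF uL \<psi>L]
      by (simp add: inner_add_left)
    finally show ?thesis using assms(10)[OF V] by (simp add: a_form_def)
  qed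

  have tangential: "stress_trace D nu lam p u \<tau> = 0" if \<tau>: "\<tau> \<in> TH_half D" for \<tau>
  proof -
    have \<tau>n: "AE y in boundary_measure D. \<tau> y \<bullet> outward_normal D y = 0" using \<tau> by (simp add: TH_half_def)
    obtain \<psi>0 where \<psi>0: "\<psi>0 \<in> Sobolev_vec 1 D" "has_trace D \<psi>0 \<tau>"
      using \<tau> by (auto simp: TH_half_def H_half_def)
    show ?thesis
    proof (rule stress_trace_eqI[OF \<psi>0])
      fix \<psi> assume \<psi>: "\<psi> \<in> Sobolev_vec 1 D" "has_trace D \<psi> \<tau>"
      \<comment> \<open>Any extension of a tangential boundary field belongs to the test space with
        \<beta> = 0, so all extensions give 0.\<close>
      have "normal_trace_on D \<psi> \<Gamma> (\<lambda>_. 0)" for \<Gamma>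
        unfolding normal_trace_on_def using \<psi>(2) \<tau>n by (intro exI[of _ \<tau>]) auto
      then have "in_V_Omega D S \<Omega> \<psi> (\<lambda>_. 0)"
        unfolding in_V_Omega_def using \<psi>(1) zero_in_Sobolev0[OF \<Omega>] by auto
      from green[OF this] show "L2_inner D (stress_div D nu lam p u) \<psi> + L2_inner D (stress D nu lam u) (strain D \<psi>) - L2_inner D p (weak_div D \<psi>) = 0"
        by (simp add: weak_laplacian_zero_inner[OF \<Omega> w])
    qed
  qed

  have plate: "plate_functional D \<Omega> nu lam p u w \<beta> = 0" if \<beta>: "\<beta> \<in> Sobolev0 2 \<Omega>" for \<beta>
  proof -
    have \<beta>1: "\<beta> \<in> Sobolev0 1 \<Omega>"
    proof -
      obtain \<phi> where "\<beta> \<in> Sobolev 2 \<Omega>" "\<And>j. \<phi> j \<in> test_functions \<Omega>" "Sobolev_tendsto 2 \<Omega> \<phi> \<beta>"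
        using \<beta> unfolding Sobolev0_def by blast
      then show ?thesis unfolding Sobolev0_def
        using Sobolev_mono[of \<beta> 2 \<Omega> 1] Sobolev_tendsto_SucD[of 1 \<Omega> \<phi> \<beta>] unfolding Suc_1 by auto
    qed
    obtain \<psi>0 where \<psi>0: "\<psi>0 \<in> Sobolev_vec 1 D" "has_trace D \<psi>0 (plate_field D \<Omega> \<beta>)"
      using plate_extension_exists[OF geo \<beta>1] .
    have "stress_trace D nu lam p u (plate_field D \<Omega> \<beta>) = - L2_inner \<Omega> (weak_laplacian \<Omega> w) (weak_laplacian \<Omega> \<beta>)"
    proof (rule stress_trace_eqI[OF \<psi>0])
      fix \<psi> assume \<psi>: "\<psi> \<in> Sobolev_vec 1 D" "has_trace D \<psi> (plate_field D \<Omega> \<beta>)"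
      \<comment> \<open>On S the plate field vanishes because S does not meet the plate; on the
        plate the normal is a unit vector. Hence every extension of the plate field, and not just
        the cone extension, is a test field belonging to \<beta>.\<close>
      have "plate_field D \<Omega> \<beta> y \<bullet> outward_normal D y = 0" if "y \<in> S" for y
        using that S\<Omega> by (auto simp: plate_field_def)
      moreover have "plate_field D \<Omega> \<beta> y \<bullet> outward_normal D y = \<beta> (proj y)" if "y \<in> emb ` \<Omega>" for y
        using that n by (auto simp: plate_field_def inner_axis_axis)
      ultimately have "in_V_Omega D S \<Omega> \<psi> \<beta>"
        unfolding in_V_Omega_def normal_trace_on_def using \<psi> \<beta> by (auto intro!: exI[of _ "plate_field D \<Omega> \<beta>"])
      then show "L2_inner D (stress_div D nu lam p u) \<psi> + L2_inner D (stress D nu lam u) (strain D \<psi>) - L2_inner D p (weak_div D \<psi>)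
        = - L2_inner \<Omega> (weak_laplacian \<Omega> w) (weak_laplacian \<Omega> \<beta>)" by (rule green)
    qed
    then show ?thesis
      unfolding plate_functional_def by (simp add: bilaplacian_pairing_eq[OF \<Omega> w \<beta>])
  qed

  have clamped: "trace_on \<Omega> w (frontier \<Omega>) (\<lambda>_. 0)"
    unfolding trace_on_def has_trace_def using Sobolev0_has_trace_zero[OF \<Omega> w0]
    by (intro exI[of _ "\<lambda>_. 0"]) auto
  \<comment> \<open>Each partial derivative of w lies in \<open>Sobolev0 1 \<Omega>\<close>, so the
    whole gradient has zero trace, and with it the normal component.\<close>
  have clamped': "normal_trace_on \<Omega> (weak_grad \<Omega> w) (frontier \<Omega>) (\<lambda>_. 0)"
    unfolding normal_trace_on_def has_trace_def
  proof (intro exI[of _ "\<lambda>_. 0"] conjI ballI)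
    fix b :: "real^2" assume b: "b \<in> Basis"
    have "weak_deriv \<Omega> b w \<in> Sobolev0 1 \<Omega>"
      using Sobolev0_weak_deriv[OF \<Omega> _ b, of w 1] w0 unfolding Suc_1 by simp
    then have "has_trace_real \<Omega> (weak_deriv \<Omega> b w) (\<lambda>y. 0)" by (rule Sobolev0_has_trace_zero[OF \<Omega>]) simp
    moreover have "(\<lambda>x. weak_grad \<Omega> w x \<bullet> b) = weak_deriv \<Omega> b w"
      using b by (auto simp: weak_grad_def)
    ultimately show "has_trace_real \<Omega> (\<lambda>x. weak_grad \<Omega> w x \<bullet> b) (\<lambda>y. 0 \<bullet> b)" by simp
  qed simp

  have force0: "is_plate_force D \<Omega> nu lam p u w (\<lambda>_. 0)"
    unfolding is_plate_force_def using plate by (simp add: L2_inner_def)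
  have dom: "(p, u, w, \<lambda>_. 0) \<in> dom_A D S \<Omega> nu lam U"
  proof -
    have zV: "(\<lambda>x. 0) \<in> Sobolev_vec 1 D" by (simp add: Sobolev_vec_def Sobolev_zero del: One_nat_def)
    have zt: "has_trace D (\<lambda>x. 0 :: real^3) (\<lambda>y. 0)"
      using has_trace_test_field[OF D(1) test_functions_zero, of "0 :: real^3"] by simp
    have "trace_on D (\<lambda>x. 0 :: real^3) S (\<lambda>_. 0)" "trace_on D (\<lambda>x. 0) (emb ` \<Omega>) (\<lambda>y. 0 *\<^sub>R outward_normal D y)"
      unfolding trace_on_def using zt by (auto intro!: exI[of _ "\<lambda>_. 0"])
    \<comment> \<open>For vanishing plate velocity the decomposition is u + 0, as u itself lies in
      \<open>V0_space D\<close>.\<close>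
    then have "\<exists>\<mu>\<in>V0_space D. \<exists>\<mu>'\<in>Sobolev_vec 1 D.
           trace_on D \<mu>' S (\<lambda>_. 0) \<and> trace_on D \<mu>' (emb ` \<Omega>) (\<lambda>y. 0 *\<^sub>R outward_normal D y) \<and>
           (AE x in lebesgue_on D. u x = \<mu> x + \<mu>' x)"
      using assms(7) zV by (intro bexI[of _ u] bexI[of _ "\<lambda>_. 0"]) auto
    then show ?thesis unfolding dom_A_def
      using p uV w0 zero_in_Sobolev0[OF \<Omega>] tr trL FL F force0 L2_space_zero tangential by blast
  qed
  \<comment> \<open>The zero function is one representative of the plate force; the chosen one pairs
    to 0 with every test function and therefore vanishes almost everywhere.\<close>
  have force: "AE z in lebesgue_on \<Omega>. plate_force D \<Omega> nu lam p u w z = 0"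
  proof -
    have pf: "plate_force D \<Omega> nu lam p u w \<in> L2_space \<Omega> \<and> is_plate_force D \<Omega> nu lam p u w (plate_force D \<Omega> nu lam p u w)"
      unfolding plate_force_def by (rule someI[of _ "\<lambda>_. 0"]) (use force0 L2_space_zero in auto)
    show ?thesis
    proof (rule fundamental_lemma_variations[OF \<Omega>])
      fix \<phi> assume "\<phi> \<in> test_functions \<Omega>"
      then have "\<phi> \<in> Sobolev0 2 \<Omega>" by (rule test_functions_Sobolev0[OF \<Omega>])
      then show "(LINT z|lebesgue_on \<Omega>. plate_force D \<Omega> nu lam p u w z * \<phi> z) = 0"
        using pf plate by (simp add: is_plate_force_def L2_inner_def)
    qed (use pf in simp)
  qed
  have zero: "state_zero D \<Omega> (op_A D \<Omega> nu lam eta U (p, u, w, \<lambda>_. 0))"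
    unfolding op_A.simps state_zero.simps
  proof (intro conjI)
    show "AE x in lebesgue_on D. - transport D U p x - weak_div D u x = 0"
      using mass by eventually_elim simp
    show "AE x in lebesgue_on D. stress_div D nu lam p u x - eta *\<^sub>R u x - convection D U u x = 0"
      using sd(2) by eventually_elim (simp add: F_def)
  qed (use force in auto)
  have null: "(p, u, w, \<lambda>_. 0) \<in> null_A D S \<Omega> nu lam eta U"
    unfolding null_A_def using dom zero by blast
  show ?thesis
    using pW mass FL F momentum tangential u_normal plate clamped clamped' dom zero null by blast
qed

end
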